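(* Let $V$ be a skew-symmetric $n\times n$ matrix function of $(u_1,\dots,u_n)$ such that the operator $\Lambda(z)=\frac{d}{dz}-U-\frac{V}{z}$, $U=\operatorname{diag}(u_1,\dots,u_n)$, has constant monodromy data (a semisimple Frobenius manifold). Let $S$ be its Stokes matrix (upper triangular with units on the diagonal). Assume that $V$ is non-resonant, that its eigenvalues $\mu_1,\dots,\mu_n$ satisfy $\Re\mu_i\in(-\frac12,\frac12)$, and that $\operatorname{rank}(S+S^T)=n$. Consider the Fuchsian system $$\frac{d\tilde\Phi}{d\lambda}=\sum_{k=1}^{\tilde n}\frac{\tilde{\mathcal A}_k}{\lambda-u_k}\,\tilde\Phi,\qquad u_{\tilde n}=0,\quad \tilde{\mathcal A}_i=\mathcal A_i^0\ (1\le i\le\tilde n-1),\quad \tilde{\mathcal A}_{\tilde n}=\sum_{j=1}^{n-\tilde n+1}\mathcal B_j^0,$$ which is obtained by clashing the poles $u_{\tilde n},\dots,u_n$ of the $n$-pole Fuchsian system of the Frobenius manifold and has monodromy matrices $\mathcal M_1,\dots,\mathcal M_{\tilde n-1},\mathcal M_h$ (all described in the context). Then the Poisson algebra of the monodromy data of this system is given by the algebra $\mathfrak D_N$, where $N=\tilde n-1$ is the number of poles that are not clashed.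
   Context: **The systems.** $E_k$ is the diagonal matrix unit, $(E_k)_{ij}=\delta_{ik}\delta_{kj}$, and $G=S+S^T$. The $n$-pole Fuchsian system of the Frobenius manifold is $\frac{d\Psi}{d\lambda}=\sum_{k=1}^n\frac{\mathcal A_k}{\lambda-u_k}\Psi$ with $\mathcal A_k=-E_k(V+\frac12)$, where the $\mathcal A_k$ solve the Schlesinger equations. Its monodromy matrices are $\mathcal M_k=1-E_kG$, $k=1,\dots,n$. Put $\mathcal M_h=\mathcal M_{\tilde n}\mathcal M_{\tilde n+1}\cdots\mathcal M_n$. **Clashing.** Put $\tilde{\mathbf u}=(u_1,\dots,u_{\tilde n-1})$ and $u_j=tv_j$ for $j=\tilde n,\dots,n$. Regard $\mathcal A_1,\dots,\mathcal A_{\tilde n-1}$ and $\mathcal B_j:=\mathcal A_{\tilde n-1+j}$ ($1\le j\le n-\tilde n+1$) as functions of $(\tilde{\mathbf u},t)$, and let $t\to0$. Under the stated assumptions there exist matrix functions $\mathcal A_i^0(\tilde{\mathbf u})$, $\mathcal B_j^0(\tilde{\mathbf u})$ such that the clashed system in the claim has monodromy matrices $\mathcal M_1,\dots,\mathcal M_{\tilde n-1},\mathcal M_h$. With $\Lambda_0=\sum_j\mathcal B_j^0$, as $t\to0$ one has $|\mathcal A_i-\mathcal A_i^0|\le K|t|^{1-\sigma}$, $|t^{-\Lambda_0}(\mathcal A_i-\mathcal A_i^0)t^{\Lambda_0}|\le K|t|^{1-\sigma}$ and $|t^{-\Lambda_0}\mathcal B_jt^{\Lambda_0}-\mathcal B_j^0|\le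 K|t|^{1-\sigma}$, for a constant $K$ and some $\sigma$ with $\max_{i,j=\tilde n,\dots,n}|\Re(\mu_i-\mu_j)|<\sigma<1$. **Poisson algebra of the monodromy data.** This is the Korotkin–Samtleben bracket restricted to functions invariant under simultaneous conjugation, such as $\operatorname{Tr}(\mathcal M_i\mathcal M_j)$ and $\operatorname{Tr}(\mathcal M_i\mathcal M_h^k\mathcal M_j\mathcal M_h^{-k})$. With $\overset1A=A\otimes1$, $\overset2A=1\otimes A$, $\Omega=\sum_{i,j}E_{ij}\otimes E_{ji}$ ($E_{ij}$ the matrix units), the bracket is $$\{M_i\otimes_,M_i\}=\tfrac12(\overset2{M_i}\Omega\overset1{M_i}-\overset1{M_i}\Omega\overset2{M_i}),$$ $$\{M_i\otimes_,M_j\}=\tfrac12(\overset1{M_i}\Omega\overset2{M_j}+\overset2{M_j}\Omega\overset1{M_i}-\Omega\overset1{M_i}\overset2{M_j}-\overset2{M_j}\overset1{M_i}\Omega)\quad(i<j),$$ with $h$ ordered last. It satisfies the Jacobi identity on adjoint-invariant functions. **The algebra $\mathfrak D_N$.** It is the abstract Poisson algebra with generators $G^{(k)}_{i,j}$, $1\le i,j\le N$, where $G^{(-k)}_{j,i}=G^{(k)}_{i,j}$ and $G^{(0)}_{i,i}=2$. Let $\mathcal G_{i,j}(\lambda)=\mathcal A^{(0)}_{i,j}+\sum_{k\ge1}G^{(k)}_{i,j}\lambda^{-k}$, with $\mathcal A^{(0)}_{i,j}=G^{(0)}_{i,j}$ for $i<j$, $1$ for $i=j$, $0$ for $i>j$.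 The bracket is $$\begin{aligned}\{\mathcal G_{j,i}(\lambda),\mathcal G_{p,l}(\mu)\}={}&\Bigl(\epsilon(j-p)-\tfrac{\lambda+\mu}{\lambda-\mu}\Bigr)\mathcal G_{p,i}(\lambda)\mathcal G_{j,l}(\mu)+\Bigl(\epsilon(i-l)+\tfrac{\lambda+\mu}{\lambda-\mu}\Bigr)\mathcal G_{p,i}(\mu)\mathcal G_{j,l}(\lambda)\\&+\Bigl(\epsilon(i-p)-\tfrac{1+\lambda\mu}{1-\lambda\mu}\Bigr)\mathcal G_{j,p}(\lambda)\mathcal G_{i,l}(\mu)+\Bigl(\epsilon(j-l)+\tfrac{1+\lambda\mu}{1-\lambda\mu}\Bigr)\mathcal G_{l,i}(\lambda)\mathcal G_{p,j}(\mu),\end{aligned}$$ where $\epsilon$ is the sign function, $\epsilon(0)=0$. **Meaning of "given by".** In the source the generators are realized as $G^{(k)}_{i,j}=(G\,\mathcal M_h^k)_{ij}$, and their brackets coincide with those of $\mathfrak D_N$ up to a factor $-\frac12$.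
   Formalization: With the Korotkin–Samtleben bracket and the bracket of 𝔇_N normalized as printed, the brackets of the realized generators coincide with those of 𝔇_N up to the factor 1/4, not −1/2 as reported from the source; the statement proved has 1/4. *)

theory Defs
  imports "HOL-Analysis.Analysis" "HOL-Library.Poly_Mapping"
begin

text \<open>
  The poles and the rows and columns of all matrices are numbered by a finite linear order
  \<open>'n\<close>, in place of \<open>{1, ..., n}\<close>. An element \<open>c :: 'n\<close> plays the role of the number
  \<open>n~\<close>: the poles \<open>k < c\<close> are not clashed, the poles \<open>k \<ge> c\<close> are, and \<open>N\<close> is the number of
  elements of \<open>{..<c}\<close>. A complex scalar \<open>z\<close> acts on matrices as \<open>mat z\<close>.
\<close>

section \<open>Matrices\<close>

type_synonym 'n cvec = "(complex, 'n) vec"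
type_synonym 'n cmat = "((complex, 'n) vec, 'n) vec"

definition elem_mat :: "'n::finite \<Rightarrow> 'n \<Rightarrow> 'n cmat" where
  "elem_mat i j = (\<chi> a b. if a = i \<and> b = j then 1 else 0)"

definition diag_mat :: "'n cvec \<Rightarrow> ('n::finite) cmat" where
  "diag_mat x = (\<chi> i j. if i = j then x $ i else 0)"

definition mat_pow :: "('n::finite) cmat \<Rightarrow> nat \<Rightarrow> 'n cmat" where
  "mat_pow A k = (((**) A) ^^ k) (mat 1)"

definition mat_powi :: "('n::finite) cmat \<Rightarrow> int \<Rightarrow> 'n cmat" where
  "mat_powi A k = (if k \<ge> 0 then mat_pow A (nat k) else mat_pow (matrix_inv A) (nat (- k)))"

definition mat_exp :: "('n::finite) cmat \<Rightarrow> 'n cmat" where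
  "mat_exp A = suminf (\<lambda>k. (1 / fact k) *\<^sub>R mat_pow A k)"

definition upper_unitriangular :: "('n::{finite,linorder}) cmat \<Rightarrow> bool" where
  "upper_unitriangular S \<longleftrightarrow> (\<forall>i. S $ i $ i = 1) \<and> (\<forall>i j. j < i \<longrightarrow> S $ i $ j = 0)"


section \<open>The irregular system and its monodromy data\<close>

definition solves_on :: "complex set \<Rightarrow> (complex \<Rightarrow> 'n cmat) \<Rightarrow> (complex \<Rightarrow> ('n::finite) cmat) \<Rightarrow> bool"
  where
  "solves_on X A Y \<longleftrightarrow>
     (\<forall>z\<in>X. (\<forall>i j. ((\<lambda>x. Y x $ i $ j) has_field_derivative (A z ** Y z) $ i $ j) (at z))
           \<and> invertible (Y z))"

definition sector :: "real \<Rightarrow> real \<Rightarrow> complex set" where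
  "sector \<alpha> h = {z. z \<noteq> 0 \<and> \<bar>Arg (cis (- \<alpha>) * z)\<bar> < h}"

text \<open>
  Solutions of \<open>dY/dz = (U + V/z) Y\<close> with \<open>Y \<sim> (1 + O(1/z)) exp (z U)\<close> in a sector. For a
  skew-symmetric \<open>V\<close> the formal solution carries no power of \<open>z\<close>, and in a sector of opening
  larger than \<open>\<pi>\<close> the leading term already determines \<open>Y\<close>.
\<close>
definition canonical_solution ::
  "complex set \<Rightarrow> 'n cvec \<Rightarrow> 'n cmat \<Rightarrow> (complex \<Rightarrow> ('n::finite) cmat) \<Rightarrow> bool" where
  "canonical_solution X u V Y \<longleftrightarrow>
     solves_on X (\<lambda>z. diag_mat u + mat (1 / z) ** V) Y \<and>
     ((\<lambda>z. Y z ** diag_mat (\<chi> k. exp (- z * u $ k))) \<longlongrightarrow> mat 1) (inf at_infinity (principal X))"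

text \<open>
  Monodromy data of \<open>d/dz - U - V/z\<close> with respect to the oriented line \<open>arg z = \<phi>\<close>: the
  exponent \<open>J\<close> at \<open>z = 0\<close>, the Stokes matrix \<open>S\<close> and the connection matrix \<open>C\<close>.
  \<^item> \<open>YL\<close> and \<open>YR\<close> are the canonical solutions in the half planes to the left and to the right of
    the line, both enlarged by a small angle \<open>\<epsilon>\<close>. On the positive half line \<open>YL = YR S\<close>, on
    the negative one \<open>YL = YR S\<^sup>T\<close>.
  \<^item> \<open>H z z\<^sup>J\<close>, \<open>H\<close> entire, is a fundamental solution at \<open>z = 0\<close>. This form is available for
    non-resonant \<open>V\<close>, and then \<open>J\<close> is similar to \<open>V\<close>. The branch of \<open>z\<^sup>J\<close> on the right
    sector is the one with \<open>arg z\<close> close to \<open>\<phi> - \<pi>/2\<close> on its bisector.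
\<close>
definition monodromy_data ::
  "real \<Rightarrow> 'n cvec \<Rightarrow> 'n cmat \<Rightarrow> 'n cmat \<Rightarrow> 'n cmat \<Rightarrow> ('n::finite) cmat \<Rightarrow> bool"
  where
  "monodromy_data \<phi> u V J S C \<longleftrightarrow>
     invertible C \<and>
     (\<exists>\<epsilon> YL YR H. 0 < \<epsilon> \<and> \<epsilon> < pi / 2 \<and>
        canonical_solution (sector (\<phi> + pi / 2) (pi / 2 + \<epsilon>)) u V YL \<and>
        canonical_solution (sector (\<phi> - pi / 2) (pi / 2 + \<epsilon>)) u V YR \<and>
        (\<forall>z\<in>sector \<phi> \<epsilon>. YL z = YR z ** S) \<and>
        (\<forall>z\<in>sector (\<phi> + pi) \<epsilon>. YL z = YR z ** transpose S) \<and>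
        (\<forall>i j. (\<lambda>z. H z $ i $ j) holomorphic_on UNIV) \<and>
        (\<forall>z. invertible (H z)) \<and>
        V ** H 0 = H 0 ** J \<and>
        (\<forall>z\<in>sector (\<phi> - pi / 2) (pi / 2 + \<epsilon>).
           YR z = H z
             ** mat_exp (mat (Ln (cis (- (\<phi> - pi / 2)) * z) + \<i> * of_real (\<phi> - pi / 2)) ** J)
             ** C))"


section \<open>Fuchsian systems\<close>

definition pole_residue :: "('n cvec \<Rightarrow> 'n cmat) \<Rightarrow> 'n cvec \<Rightarrow> 'n \<Rightarrow> ('n::finite) cmat" where
  "pole_residue V u k = - (elem_mat k k ** (V u + mat (1 / 2)))"

definition branch_cut :: "real \<Rightarrow> complex \<Rightarrow> complex set" where
  "branch_cut \<phi> p = {p - \<i> * cis (- \<phi>) * of_real \<rho> | \<rho>. 0 \<le> \<rho>}"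

text \<open>
  \<open>m k\<close>, \<open>k \<le> c\<close>, are the monodromy matrices of \<open>d\<Phi>/d\<lambda> = (\<Sum>k\<le>c. A k / (\<lambda> - w k)) \<Phi>\<close> with
  respect to some fundamental matrix \<open>\<Phi>\<close> on the plane with parallel cuts going down from the
  poles in the coordinate \<open>e\<^sup>i\<^sup>\<phi> \<lambda>\<close>. Continuing \<open>\<Phi>\<close> across the cut of \<open>w k\<close> from right to left,
  that is, along the clockwise loop around \<open>w k\<close> based far above the poles, gives \<open>\<Phi> m k\<close>.
  This choice is forced by \<open>YL = YR S\<close> on the positive half line: with it the \<open>n\<close>-pole system
  has the monodromy matrices \<open>1 - E\<^sub>k G\<close> (these are involutions, so that the orientation is not
  visible for them), and the loop around the poles \<open>k \<ge> c\<close> has the ordered product \<open>M\<^sub>h\<close> below.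
\<close>
definition has_monodromy ::
  "real \<Rightarrow> 'n \<Rightarrow> 'n cvec \<Rightarrow> ('n \<Rightarrow> 'n cmat) \<Rightarrow> ('n \<Rightarrow> ('n::{finite,linorder}) cmat) \<Rightarrow> bool"
  where
  "has_monodromy \<phi> c w A m \<longleftrightarrow>
     (\<exists>\<Phi>. solves_on (- (\<Union>k\<in>{..c}. branch_cut \<phi> (w $ k)))
              (\<lambda>z. \<Sum>k\<in>{..c}. mat (1 / (z - w $ k)) ** A k) \<Phi> \<and>
          (\<forall>k\<le>c. \<forall>p \<in> branch_cut \<phi> (w $ k) - {w $ k}. \<exists>L. invertible L \<and>
              (\<Phi> \<longlongrightarrow> L) (at p within {z. Re (cis \<phi> * (z - p)) < 0}) \<and>
              (\<Phi> \<longlongrightarrow> L ** m k) (at p within {z. Re (cis \<phi> * (z - p)) > 0})))"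

text \<open>
  Clashing of the poles \<open>k \<ge> c\<close> along \<open>u = w + t v\<close>, \<open>t \<rightarrow> 0\<close>. Here \<open>w\<close> carries the
  coordinates \<open>u k\<close>, \<open>k < c\<close>, and vanishes for \<open>k \<ge> c\<close>, whereas \<open>v\<close> vanishes for \<open>k < c\<close>.
  The powers of \<open>t\<close> are multivalued, and \<open>t\<close> tends to \<open>0\<close> in a sector around the positive half
  line (any other direction can be absorbed into \<open>v\<close>). \<open>B0\<close> is numbered by \<open>k \<ge> c\<close>.
\<close>
definition t_pow :: "complex \<Rightarrow> 'n cmat \<Rightarrow> ('n::finite) cmat" where
  "t_pow t L = mat_exp (mat (Ln t) ** L)"

definition clash_exponent ::
  "'n \<Rightarrow> ('n \<Rightarrow> 'n cvec \<Rightarrow> 'n cmat) \<Rightarrow> 'n cvec \<Rightarrow> ('n::{finite,linorder}) cmat" where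
  "clash_exponent c B0 w = (\<Sum>k\<in>{c..}. B0 k w)"

definition clash_limit ::
  "'n \<Rightarrow> ('n cvec \<Rightarrow> 'n cmat) \<Rightarrow> 'n cvec set \<Rightarrow> 'n cvec \<Rightarrow> real \<Rightarrow>
   ('n \<Rightarrow> 'n cvec \<Rightarrow> 'n cmat) \<Rightarrow> ('n \<Rightarrow> 'n cvec \<Rightarrow> 'n cmat) \<Rightarrow>
   ('n::{finite,linorder}) cvec \<Rightarrow> bool" where
  "clash_limit c V \<U> v \<sigma> A0 B0 w \<longleftrightarrow>
     (\<exists>K \<delta> \<theta>. 0 < \<delta> \<and> 0 < \<theta> \<and> \<theta> \<le> pi \<and>
        (\<forall>t\<in>sector 0 \<theta>. norm t < \<delta> \<longrightarrow>
           (let u = w + t *s v; \<Lambda> = clash_exponent c B0 w; r = K * norm t powr (1 - \<sigma>) in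
              u \<in> \<U> \<and>
              (\<forall>i<c. norm (pole_residue V u i - A0 i w) \<le> r \<and>
                      norm (t_pow t (- \<Lambda>) ** (pole_residue V u i - A0 i w) ** t_pow t \<Lambda>) \<le> r) \<and>
              (\<forall>j\<ge>c. norm (t_pow t (- \<Lambda>) ** pole_residue V u j ** t_pow t \<Lambda> - B0 j w) \<le> r))))"

definition clashed_residue ::
  "'n \<Rightarrow> ('n \<Rightarrow> 'n cvec \<Rightarrow> 'n cmat) \<Rightarrow> ('n \<Rightarrow> 'n cvec \<Rightarrow> 'n cmat) \<Rightarrow>
   'n cvec \<Rightarrow> 'n \<Rightarrow> ('n::{finite,linorder}) cmat" where
  "clashed_residue c A0 B0 w k = (if k < c then A0 k w else clash_exponent c B0 w)"


section \<open>Monodromy data as functions of the Stokes matrix\<close>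

definition gram :: "'n cmat \<Rightarrow> ('n::finite) cmat" where
  "gram S = S + transpose S"

definition refl_mat :: "'n cmat \<Rightarrow> 'n \<Rightarrow> ('n::finite) cmat" where
  "refl_mat S k = mat 1 - elem_mat k k ** gram S"

definition M_h :: "'n \<Rightarrow> 'n cmat \<Rightarrow> ('n::{finite,linorder}) cmat" where
  "M_h c S = foldr (\<lambda>k P. refl_mat S k ** P) (sorted_list_of_set {c..}) (mat 1)"

text \<open>
  Tuples of monodromy matrices of the clashed system are functions on \<open>'n\<close> of which only the
  values at \<open>k \<le> c\<close> matter; the value at \<open>c\<close> belongs to the clashed pole, the index \<open>h\<close>.
\<close>
definition clashed_tuple :: "'n \<Rightarrow> 'n cmat \<Rightarrow> 'n \<Rightarrow> ('n::{finite,linorder}) cmat" where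
  "clashed_tuple c S k = (if k < c then refl_mat S k else M_h c S)"

definition stokes_space :: "(('n::{finite,linorder}) cmat) set" where
  "stokes_space = {S. upper_unitriangular S \<and> rank (S + transpose S) = CARD('n)}"

definition monodromy_class ::
  "'n \<Rightarrow> 'n cmat \<Rightarrow> ('n \<Rightarrow> ('n::{finite,linorder}) cmat) set" where
  "monodromy_class c S =
     {m. \<exists>P. invertible P \<and> (\<forall>k\<le>c. m k = matrix_inv P ** clashed_tuple c S k ** P)}"


section \<open>The Korotkin--Samtleben bracket\<close>

text \<open>Rows and columns of the tensor product are numbered by pairs:
  \<open>kron A B $ (i, k) $ (j, l) = A\<^sub>i\<^sub>j B\<^sub>k\<^sub>l\<close>.\<close>
definition kron :: "'n cmat \<Rightarrow> 'n cmat \<Rightarrow> ('n::finite \<times> 'n) cmat" where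
  "kron A B = (\<chi> p q. A $ fst p $ fst q * B $ snd p $ snd q)"

definition Omega :: "('n::finite \<times> 'n) cmat" where
  "Omega = (\<Sum>i\<in>UNIV. \<Sum>j\<in>UNIV. kron (elem_mat i j) (elem_mat j i))"

definition ks_same :: "'n cmat \<Rightarrow> ('n::finite \<times> 'n) cmat" where
  "ks_same M = (let M1 = kron M (mat 1); M2 = kron (mat 1) M in
     mat (1 / 2) ** (M2 ** Omega ** M1 - M1 ** Omega ** M2))"

definition ks_less ::
  "'n cmat \<Rightarrow> 'n cmat \<Rightarrow> ('n::finite \<times> 'n) cmat" where
  "ks_less A B = (let A1 = kron A (mat 1); B2 = kron (mat 1) B in
     mat (1 / 2) ** (A1 ** Omega ** B2 + B2 ** Omega ** A1 - Omega ** A1 ** B2 - B2 ** A1 ** Omega))"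

text \<open>The bracket of the entries \<open>(M\<^sub>a)\<^sub>i\<^sub>j\<close> and \<open>(M\<^sub>b)\<^sub>k\<^sub>l\<close>, skew-symmetrically extended to \<open>a > b\<close>.\<close>
definition ks_entry ::
  "('n \<Rightarrow> 'n cmat) \<Rightarrow> 'n \<Rightarrow> 'n \<Rightarrow> 'n \<Rightarrow> 'n \<Rightarrow> 'n \<Rightarrow> 'n::{finite,linorder} \<Rightarrow> complex" where
  "ks_entry m a i j b k l =
     (if a = b then ks_same (m a) $ (i, k) $ (j, l)
      else if a < b then ks_less (m a) (m b) $ (i, k) $ (j, l)
      else - (ks_less (m b) (m a) $ (k, i) $ (l, j)))"

definition entry_deriv ::
  "'n \<Rightarrow> 'n \<Rightarrow> 'n \<Rightarrow> (('n \<Rightarrow> 'n cmat) \<Rightarrow> complex) \<Rightarrow> ('n \<Rightarrow> ('n::finite) cmat) \<Rightarrow> complex" where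
  "entry_deriv a i j F m = deriv (\<lambda>z. F (m(a := m a + mat z ** elem_mat i j))) 0"

definition ks_bracket ::
  "'n \<Rightarrow> (('n \<Rightarrow> 'n cmat) \<Rightarrow> complex) \<Rightarrow> (('n \<Rightarrow> 'n cmat) \<Rightarrow> complex) \<Rightarrow>
   ('n \<Rightarrow> ('n::{finite,linorder}) cmat) \<Rightarrow> complex" where
  "ks_bracket c F H m =
     (\<Sum>a\<in>{..c}. \<Sum>i\<in>UNIV. \<Sum>j\<in>UNIV. \<Sum>b\<in>{..c}. \<Sum>k\<in>UNIV. \<Sum>l\<in>UNIV.
        entry_deriv a i j F m * entry_deriv b k l H m * ks_entry m a i j b k l)"

definition inv_trace ::
  "'n \<Rightarrow> int \<Rightarrow> 'n \<Rightarrow> 'n \<Rightarrow> ('n \<Rightarrow> ('n::finite) cmat) \<Rightarrow> complex" where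
  "inv_trace c k i j m = trace (m i ** mat_powi (m c) k ** m j ** mat_powi (m c) (- k))"


section \<open>The algebra \<open>\<DD>\<^sub>N\<close>\<close>

text \<open>
  The relations \<open>G(-k) j i = G(k) i j\<close> and \<open>G(0) i i = 2\<close> are used to eliminate generators:
  \<open>\<DD>\<^sub>N\<close> is the polynomial algebra in the variables \<open>(k, i, j)\<close> with \<open>k \<ge> 1\<close>, or \<open>k = 0\<close> and
  \<open>i < j\<close>. The lower indices range over an \<open>N\<close>-element linearly ordered set \<open>I\<close>.
\<close>
type_synonym 'i dvar = "nat \<times> 'i \<times> 'i"
type_synonym 'i dalg = "('i dvar \<Rightarrow>\<^sub>0 nat) \<Rightarrow>\<^sub>0 complex"

definition D_vars :: "'i::linorder set \<Rightarrow> 'i dvar set" where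
  "D_vars I = {(k, i, j). i \<in> I \<and> j \<in> I \<and> (k = 0 \<longrightarrow> i < j)}"

definition poly_vars :: "'i dalg \<Rightarrow> 'i dvar set" where
  "poly_vars p = (\<Union>m\<in>Poly_Mapping.keys p. Poly_Mapping.keys m)"

definition D_alg :: "'i::linorder set \<Rightarrow> 'i dalg set" where
  "D_alg I = {p. poly_vars p \<subseteq> D_vars I}"

definition D_var :: "nat \<Rightarrow> 'i \<Rightarrow> 'i \<Rightarrow> 'i dalg" where
  "D_var k i j = Poly_Mapping.single (Poly_Mapping.single (k, i, j) 1) 1"

definition D_gen :: "int \<Rightarrow> 'i::linorder \<Rightarrow> 'i \<Rightarrow> 'i dalg" where
  "D_gen k i j =
     (if k > 0 then D_var (nat k) i j
      else if k < 0 then D_var (nat (- k)) j i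
      else if i < j then D_var 0 i j
      else if i = j then 2
      else D_var 0 j i)"

text \<open>The coefficient of \<open>\<lambda>\<^sup>-\<^sup>k\<close> in the generating series \<open>\<G> i j\<close>.\<close>
definition D_coeff :: "'i::linorder \<Rightarrow> 'i \<Rightarrow> nat \<Rightarrow> 'i dalg" where
  "D_coeff i j k =
     (if k = 0 then (if i < j then D_gen 0 i j else if i = j then 1 else 0) else D_gen (int k) i j)"

definition eps :: "'i::linorder \<Rightarrow> 'i \<Rightarrow> 'i dalg" where
  "eps i j = (if j < i then 1 else if i < j then - 1 else 0)"

text \<open>
  The coefficient of \<open>\<lambda>\<^sup>-\<^sup>k \<mu>\<^sup>-\<^sup>m\<close> in \<open>{\<G> j i \<lambda>, \<G> p l \<mu>}\<close>. With
  \<open>P(\<lambda>,\<mu>) = \<G>\<^sub>p\<^sub>i(\<mu>) \<G>\<^sub>j\<^sub>l(\<lambda>) - \<G>\<^sub>p\<^sub>i(\<lambda>) \<G>\<^sub>j\<^sub>l(\<mu>)\<close> and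
  \<open>Q(\<lambda>,\<mu>) = \<G>\<^sub>l\<^sub>i(\<lambda>) \<G>\<^sub>p\<^sub>j(\<mu>) - \<G>\<^sub>j\<^sub>p(\<lambda>) \<G>\<^sub>i\<^sub>l(\<mu>)\<close> the right-hand side contains
  \<open>(\<lambda>+\<mu>)/(\<lambda>-\<mu>) P + (1+\<lambda>\<mu>)/(1-\<lambda>\<mu>) Q\<close>, and
  \<open>(\<lambda>+\<mu>)/(\<lambda>-\<mu>) = 1 + 2 (\<Sum>q\<ge>1. (\<mu>/\<lambda>)\<^sup>q)\<close>, \<open>(1+\<lambda>\<mu>)/(1-\<lambda>\<mu>) = - 1 - 2 (\<Sum>q\<ge>1. (\<lambda>\<mu>)\<^sup>-\<^sup>q)\<close>.
  As \<open>P\<close> vanishes on \<open>\<lambda> = \<mu>\<close>, its factor may equally well be expanded for \<open>\<bar>\<mu>\<bar> > \<bar>\<lambda>\<bar>\<close>.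
\<close>
definition D_bracket_coeff :: "'i::linorder \<Rightarrow> 'i \<Rightarrow> nat \<Rightarrow> 'i \<Rightarrow> 'i \<Rightarrow> nat \<Rightarrow> 'i dalg" where
  "D_bracket_coeff j i k p l m =
     (let P = (\<lambda>r s. D_coeff p i s * D_coeff j l r - D_coeff p i r * D_coeff j l s);
          Q = (\<lambda>r s. D_coeff l i r * D_coeff p j s - D_coeff j p r * D_coeff i l s)
      in eps j p * D_coeff p i k * D_coeff j l m
       + eps i l * D_coeff p i m * D_coeff j l k
       + eps i p * D_coeff j p k * D_coeff i l m
       + eps j l * D_coeff l i k * D_coeff p j m
       + (P k m + 2 * (\<Sum>q=1..k. P (k - q) (m + q)))
       - (Q k m + 2 * (\<Sum>q=1..min k m. Q (k - q) (m - q))))"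

definition poly_deriv :: "'i dvar \<Rightarrow> 'i dalg \<Rightarrow> 'i dalg" where
  "poly_deriv x p =
     (\<Sum>m\<in>Poly_Mapping.keys p. Poly_Mapping.single (m - Poly_Mapping.single x 1)
        (of_nat (Poly_Mapping.lookup m x) * Poly_Mapping.lookup p m))"

definition D_bracket :: "'i::linorder dalg \<Rightarrow> 'i dalg \<Rightarrow> 'i dalg" where
  "D_bracket f g =
     (\<Sum>(k, j, i)\<in>poly_vars f. \<Sum>(m, p, l)\<in>poly_vars g.
        poly_deriv (k, j, i) f * poly_deriv (m, p, l) g * D_bracket_coeff j i k p l m)"

definition poly_eval :: "('i dvar \<Rightarrow> complex) \<Rightarrow> 'i dalg \<Rightarrow> complex" where
  "poly_eval f p =
     (\<Sum>m\<in>Poly_Mapping.keys p. Poly_Mapping.lookup p m *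
        (\<Prod>x\<in>Poly_Mapping.keys m. f x ^ Poly_Mapping.lookup m x))"


section \<open>The Poisson algebra of the monodromy data\<close>

definition realized_gen :: "'n \<Rightarrow> 'n cmat \<Rightarrow> int \<Rightarrow> 'n \<Rightarrow> 'n::{finite,linorder} \<Rightarrow> complex" where
  "realized_gen c S k i j = (gram S ** mat_powi (M_h c S) k) $ i $ j"

text \<open>Functions on the space of monodromy data are extended by \<open>0\<close> beyond it.\<close>
definition on_stokes :: "('n cmat \<Rightarrow> complex) \<Rightarrow> ('n::{finite,linorder}) cmat \<Rightarrow> complex" where
  "on_stokes F = (\<lambda>S. if S \<in> stokes_space then F S else 0)"

definition realization :: "'n \<Rightarrow> 'n dalg \<Rightarrow> ('n::{finite,linorder}) cmat \<Rightarrow> complex" where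
  "realization c a = on_stokes (\<lambda>S. poly_eval (\<lambda>(k, i, j). realized_gen c S (int k) i j) a)"

definition monodromy_algebra :: "'n \<Rightarrow> (('n::{finite,linorder}) cmat \<Rightarrow> complex) set" where
  "monodromy_algebra c = realization c ` D_alg {..<c}"

definition poisson_bracket_on ::
  "('a \<Rightarrow> complex) set \<Rightarrow> (('a \<Rightarrow> complex) \<Rightarrow> ('a \<Rightarrow> complex) \<Rightarrow> 'a \<Rightarrow> complex) \<Rightarrow> bool" where
  "poisson_bracket_on R \<beta> \<longleftrightarrow>
     (\<forall>F\<in>R. \<forall>G\<in>R. \<beta> F G \<in> R \<and> \<beta> F G = (\<lambda>x. - \<beta> G F x)) \<and>
     (\<forall>F\<in>R. \<forall>G\<in>R. \<forall>H\<in>R. \<forall>s. \<beta> (\<lambda>x. s * F x + G x) H = (\<lambda>x. s * \<beta> F H x + \<beta> G H x)) \<and>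
     (\<forall>F\<in>R. \<forall>G\<in>R. \<forall>H\<in>R. \<beta> (\<lambda>x. F x * G x) H = (\<lambda>x. F x * \<beta> G H x + G x * \<beta> F H x)) \<and>
     (\<forall>F\<in>R. \<forall>G\<in>R. \<forall>H\<in>R. \<forall>x. \<beta> F (\<beta> G H) x + \<beta> G (\<beta> H F) x + \<beta> H (\<beta> F G) x = 0)"

text \<open>
  The Poisson bracket on the functions of the monodromy data that is the restriction of the
  Korotkin--Samtleben bracket: it gives the Korotkin--Samtleben brackets of the conjugation
  invariant functions \<open>Tr (M\<^sub>i M\<^sub>h\<^sup>k M\<^sub>j M\<^sub>h\<^sup>-\<^sup>k)\<close>, at all tuples of monodromy matrices. On monodromy
  data these functions are \<open>n - 4 + (G(k) i j)\<^sup>2\<close>, and the generators themselves are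
  functions of the Stokes matrix, but not of the conjugacy class of the tuple, which determines
  them only up to signs.

  The normalizations of the two brackets differ by the factor \<open>1/4\<close>. For instance, with
  \<open>M\<^sub>i\<^sup>2 = 1\<close>, the formulas above give for \<open>i < j < l < c\<close>
  \<open>{Tr (M\<^sub>i M\<^sub>j), Tr (M\<^sub>j M\<^sub>l)} = Tr (M\<^sub>i M\<^sub>j M\<^sub>l M\<^sub>j) - Tr (M\<^sub>i M\<^sub>l) = G\<^sub>i\<^sub>j G\<^sub>j\<^sub>l (G\<^sub>i\<^sub>j G\<^sub>j\<^sub>l - 2 G\<^sub>i\<^sub>l)\<close>.
  By the Leibniz rule this is \<open>4 G\<^sub>i\<^sub>j G\<^sub>j\<^sub>l {G\<^sub>i\<^sub>j, G\<^sub>j\<^sub>l}\<close>, while \<open>{G\<^sub>i\<^sub>j, G\<^sub>j\<^sub>l} = G\<^sub>i\<^sub>j G\<^sub>j\<^sub>l - 2 G\<^sub>i\<^sub>l\<close>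
  in \<open>\<DD>\<^sub>N\<close>.
\<close>
definition induced_by_ks ::
  "'n \<Rightarrow> (('n cmat \<Rightarrow> complex) \<Rightarrow> ('n cmat \<Rightarrow> complex) \<Rightarrow>
    ('n::{finite,linorder}) cmat \<Rightarrow> complex) \<Rightarrow> bool" where
  "induced_by_ks c \<beta> \<longleftrightarrow>
     (\<forall>S\<in>stokes_space. \<forall>m\<in>monodromy_class c S. \<forall>k k' i j p l.
        i < c \<and> j < c \<and> p < c \<and> l < c \<longrightarrow>
        \<beta> (on_stokes (\<lambda>S. inv_trace c k i j (clashed_tuple c S)))
          (on_stokes (\<lambda>S. inv_trace c k' p l (clashed_tuple c S))) S
        = ks_bracket c (inv_trace c k i j) (inv_trace c k' p l) m)"

end

theory Submission
  imports Defs
begin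

text \<open>
  All functions involved are polynomials in the entries of the Stokes matrix \<open>S\<close>, and the proof
  compares two brackets on them.

  The first one is the quadratic bracket \<open>stokes_bracket\<close>, with
  \<open>{S\<^sub>j\<^sub>i, S\<^sub>p\<^sub>l} = (\<epsilon>(j-p) + \<epsilon>(i-l)) S\<^sub>p\<^sub>i S\<^sub>j\<^sub>l + (\<epsilon>(i-p) + 1) S\<^sub>j\<^sub>p S\<^sub>i\<^sub>l + (\<epsilon>(j-l) - 1) S\<^sub>l\<^sub>i S\<^sub>p\<^sub>j\<close>.
  This is the part of \<open>\<DD>\<close> that involves only the constant terms of the generating series, for
  all \<open>n\<close> poles. Its Jacobi identity follows from the cyclic identity
  \<open>1 + \<epsilon>\<^sub>a\<^sub>b \<epsilon>\<^sub>b\<^sub>c + \<epsilon>\<^sub>b\<^sub>c \<epsilon>\<^sub>c\<^sub>a + \<epsilon>\<^sub>c\<^sub>a \<epsilon>\<^sub>a\<^sub>b = 0\<close> of signs, which fails only for \<open>a = b = c\<close>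
  (\<open>tri_bracket_jacobi\<close>, \<open>jacobiator_zero\<close>).

  The entries \<open>(G M\<^sub>h\<^sup>k)\<^sub>i\<^sub>j\<close> with \<open>i, j < c\<close> satisfy the relations of \<open>\<DD>\<^sub>N\<close> for this bracket
  (\<open>stokes_bracket_generators\<close>). The pencil \<open>N(x) = S + x S\<^sup>T\<close>, \<open>x = 1/\<lambda>\<close>, satisfies the
  relations of generating series for all \<open>n\<close> poles, as one sees by expanding the product
  (\<open>tri_bracket_pencil\<close>). Rows \<open>r \<ge> c\<close> of \<open>S M\<^sub>h\<close> are those of \<open>- S\<^sup>T\<close>, because the product of
  reflections \<open>M\<^sub>h\<close> turns the row \<open>r\<close> of \<open>S\<close> into minus the column \<open>r\<close>. Therefore \<open>N Z\<close>,
  with \<open>Z = (1 - x) (\<Sum>k. x\<^sup>k M\<^sub>h\<^sup>k)\<close>, vanishes in these rows, and in the columns \<open>i < c\<close> its other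
  entries are \<open>W = (1 - x) \<G>\<close>. With the corresponding left factor \<open>Y\<close> one has \<open>dW = Y dN Z\<close> in
  the rows and columns below \<open>c\<close>. As \<open>Y\<close> and \<open>Z\<close> are trivial on the indices below \<open>c\<close>, the
  relation for \<open>N\<close> is carried over to \<open>W\<close>, and the scalar factor \<open>1 - x\<close> cancels.

  The second bracket is the Korotkin--Samtleben bracket of the functions
  \<open>Tr (M\<^sub>i M\<^sub>h\<^sup>k M\<^sub>j M\<^sub>h\<^sup>-\<^sup>k) = n - 4 + (G\<^sup>(\<^sup>k\<^sup>)\<^sub>i\<^sub>j)\<^sup>2\<close>. It only depends on the commutators of the
  monodromy matrices with the gradients, apart from the terms at the pole \<open>h\<close>. For reflections
  these commutators have rank at most two, and everything reduces to products of two generators. The result is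
  \<open>G\<^sup>(\<^sup>k\<^sup>)\<^sub>i\<^sub>j G\<^sup>(\<^sup>m\<^sup>)\<^sub>p\<^sub>l {G\<^sup>(\<^sup>k\<^sup>)\<^sub>i\<^sub>j, G\<^sup>(\<^sup>m\<^sup>)\<^sub>p\<^sub>l}\<close>, with the bracket of \<open>\<DD>\<^sub>N\<close>
  (\<open>ks_bracket_reflections\<close>, \<open>level_bracket_closed_form\<close>). By the Leibniz rule a quarter of
  \<open>stokes_bracket\<close> has the same values on these functions, which gives the existence.

  Conversely, these values determine \<open>4 G\<^sup>(\<^sup>k\<^sup>)\<^sub>i\<^sub>j G\<^sup>(\<^sup>m\<^sup>)\<^sub>p\<^sub>l \<beta>(G\<^sup>(\<^sup>k\<^sup>)\<^sub>i\<^sub>j, G\<^sup>(\<^sup>m\<^sup>)\<^sub>p\<^sub>l)\<close>. The two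
  factors can be cancelled since they do not vanish identically on unitriangular matrices
  (\<open>pol_fun_cancel\<close>, \<open>decoupled_stokes_matrix\<close>), and the Leibniz rule extends the result from
  the generators to the whole algebra (\<open>induced_bracket_unique\<close>).

  Finally the monodromy matrices are unique up to conjugation, because the plane with parallel cuts is
  connected, so that any two fundamental matrices differ by a constant right factor
  (\<open>has_monodromy_unique\<close>).
\<close>

section \<open>The quadratic bracket of triangular matrices\<close>

definition ord_sign :: "'i::linorder \<Rightarrow> 'i \<Rightarrow> 'a::comm_ring_1" where
  "ord_sign a b = (if b < a then 1 else if a < b then - 1 else 0)"

lemma ord_sign_swap: "ord_sign b a = - ord_sign a b"
  by (auto simp: ord_sign_def)

lemma ord_sign_cyclic:
  "1 + ord_sign a b * ord_sign b c + ord_sign b c * ord_sign c a + ord_sign c a * ord_sign a b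
   = (if a = b \<and> b = c then 1 else 0 :: 'a::idom)"
  by (auto simp: ord_sign_def)

text \<open>
  The bracket of \<open>\<DD>\<close> on the constant terms \<open>\<A>\<^sup>(\<^sup>0\<^sup>)\<close> of the generating series: the limit
  \<open>\<lambda> \<rightarrow> \<infinity>\<close>, \<open>\<mu> \<rightarrow> \<infinity>\<close> with \<open>\<mu>/\<lambda> \<rightarrow> 0\<close> of the defining relation.
\<close>
definition tri_bracket ::
  "('i::linorder \<Rightarrow> 'i \<Rightarrow> 'a::comm_ring_1) \<Rightarrow> 'i \<Rightarrow> 'i \<Rightarrow> 'i \<Rightarrow> 'i \<Rightarrow> 'a" where
  "tri_bracket s j i p l =
     (ord_sign j p + ord_sign i l) * s p i * s j l
     + (ord_sign i p + 1) * s j p * s i l + (ord_sign j l - 1) * s l i * s p j"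

lemma tri_bracket_swap: "tri_bracket s p l j i = - tri_bracket s j i p l"
  unfolding tri_bracket_def ord_sign_swap[of p j] ord_sign_swap[of l i] ord_sign_swap[of l j]
    ord_sign_swap[of p i]
  by (simp add: algebra_simps)

text \<open>
  On upper unitriangular matrices the bracket is tangent: the entries that are constant there have
  vanishing brackets. For each of the three products either one factor is an entry below the
  diagonal or the order of the indices makes the sign coefficient zero.
\<close>
lemma tri_bracket_below:
  fixes s :: "'i::linorder \<Rightarrow> 'i \<Rightarrow> 'b::idom"
  assumes "\<And>a. s a a = 1" "\<And>a b. b < a \<Longrightarrow> s a b = 0" "i \<le> j"
  shows "tri_bracket s j i p l = 0"
proof -
  note lin = linorder_less_linear[of j p] linorder_less_linear[of i l]
    linorder_less_linear[of i p] linorder_less_linear[of j l]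
  consider "i < j" | "i = j" using assms by fastforce
  then show ?thesis
  proof cases
    case 1
    have "s p i * s j l = 0 \<or> ord_sign j p + ord_sign i l = (0::'b)"
      using 1 lin(1,2) assms(2)[of i p] assms(2)[of l j] by (auto simp: ord_sign_def)
    moreover have "s j p * s i l = 0 \<or> ord_sign i p + 1 = (0::'b)"
      using 1 lin(3,4) assms(2)[of p j] assms(2)[of l i] by (auto simp: ord_sign_def)
    moreover have "s l i * s p j = 0 \<or> ord_sign j l - 1 = (0::'b)"
      using 1 lin(3,4) assms(2)[of i l] assms(2)[of j p] by (auto simp: ord_sign_def)
    ultimately show ?thesis unfolding tri_bracket_def by (auto simp: mult.assoc)
  next
    case 2
    show ?thesis using lin(1,4) assms(1)[of j] assms(2)[of j p] assms(2)[of p j]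
      assms(2)[of j l] assms(2)[of l j]
      unfolding tri_bracket_def 2 by (auto simp: ord_sign_def)
  qed
qed

text \<open>
  \<open>\<delta> a b j i p l\<close> is \<open>{s a b, {s j i, s p l}}\<close>. After collecting the twenty monomials of degree
  three, the quadratic coefficients in the signs reduce to combinations of the cyclic expression
  \<open>t x y z\<close>. This vanishes unless its three indices coincide, and in that case the monomials it
  multiplies become equal and cancel.
\<close>
lemma tri_bracket_jacobi:
  fixes s :: "'i::linorder \<Rightarrow> 'i \<Rightarrow> 'a::idom"
  defines "\<delta> \<equiv> \<lambda>a b j i p l.
     (ord_sign j p + ord_sign i l) * (tri_bracket s a b p i * s j l + s p i * tri_bracket s a b j l)
     + (ord_sign i p + 1) * (tri_bracket s a b j p * s i l + s j p * tri_bracket s a b i l)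
     + (ord_sign j l - 1) * (tri_bracket s a b l i * s p j + s l i * tri_bracket s a b p j)"
  shows "\<delta> a b c d f g + \<delta> c d f g a b + \<delta> f g a b c d = 0"
proof -
  define t :: "'i \<Rightarrow> 'i \<Rightarrow> 'i \<Rightarrow> 'a" where "t x y z = 1 + ord_sign x y * ord_sign y z +
    ord_sign y z * ord_sign z x + ord_sign z x * ord_sign x y" for x y z
  define e :: "'i \<Rightarrow> 'i \<Rightarrow> 'a" where "e = ord_sign"
  \<comment> \<open>The three coefficients of the bracket.\<close>
  define A where "A j p i l = e j p + e i l" for j p i l
  define B where "B i p = e i p + 1" for i p
  define C where "C j l = e j l - 1" for j l
  have t: "t x y z = (if x = y \<and> y = z then 1 else 0)" for x y z
    unfolding t_def by (rule ord_sign_cyclic)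
  have self: "e x x = 0" for x by (simp add: e_def ord_sign_def)
  have sw: "e b a = - e a b" "e c a = - e a c" "e d a = - e a d" "e f a = - e a f" "e g a = - e a g"
    "e c b = - e b c" "e d b = - e b d" "e f b = - e b f" "e g b = - e b g"
    "e d c = - e c d" "e f c = - e c f" "e g c = - e c g"
    "e f d = - e d f" "e g d = - e d g" "e g f = - e f g"
    unfolding e_def by (rule ord_sign_swap)+
  have \<pi>: "tri_bracket s j i p l = A j p i l * s p i * s j l + B i p * s j p * s i l + C j l * s l i * s p j"
    for j i p l
    unfolding tri_bracket_def A_def B_def C_def e_def ..
  have \<delta>: "\<delta> a b j i p l = A j p i l * (tri_bracket s a b p i * s j l + s p i * tri_bracket s a b j l)
     + B i p * (tri_bracket s a b j p * s i l + s j p * tri_bracket s a b i l)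
     + C j l * (tri_bracket s a b l i * s p j + s l i * tri_bracket s a b p j)" for a b j i p l
    unfolding \<delta>_def A_def B_def C_def e_def ..
  have "\<delta> a b c d f g + \<delta> c d f g a b + \<delta> f g a b c d =
    (B d f * B b c + B b c * C f d) * (s a c * s b f * s d g)
    + (A c f d g * B b c + C f b * C c f + B b c * A f b g d) * (s a c * s b g * s f d)
    + (C c g * A a f b c + A f a g b * C c g + B b c * B g b) * (s a c * s f b * s g d)
    + (B d f * B b d + C f b * A c a d f + A a c b d * C f b) * (s a d * s b g * s c f)
    + (A c f d g * A a f b d + A f a g b * A c a d g + A a c b d * A f c g b) * (s a d * s c g * s f b)
    + (C c g * A a g b d + B g a * C c a + A a c b d * B g c) * (s a d * s f c * s g b)
    + (C c g * B b f + C f b * C c g) * (s a f * s b c * s g d)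
    + (A c f d g * B b f + C f b * A c b d g + B b c * C f c) * (s a f * s b d * s c g)
    + (B d f * A a c b f + C f b * B d b + A a c b d * C f d) * (s a f * s c b * s d g)
    + (C c g * B b g + A f a g b * C c b + B b c * A f a g c) * (s a g * s b d * s f c)
    + (A c f d g * A a c b g + A f a g b * A c f d b + A a c b d * A f a g d) * (s a g * s c b * s f d)
    + (B d f * A a d b g + A f a g b * B d f + C a d * C f a) * (s a g * s c f * s d b)
    + (B g a * C c b + B b c * B g a) * (s b d * s f a * s g c)
    + (C f b * B d a + C a d * C f b) * (s b g * s c a * s d f)
    + (B d f * C a f + A f a g b * B d a + C a d * A f d g b) * (s c a * s d g * s f b)
    + (A c f d g * C a g + B g a * A c f d a + C a d * B g d) * (s c a * s f d * s g b)
    + (C c g * C a c + B g a * A c g d b + A a c b d * B g a) * (s c b * s f a * s g d)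
    + (B d f * C a g + B g a * B d f) * (s c f * s d a * s g b)
    + (A c f d g * C a d + B g a * B d g + C a d * A f c g a) * (s c g * s d b * s f a)
    + (C c g * C a d + C a d * B g c) * (s d b * s f c * s g a)"
    unfolding \<delta> \<pi> by (simp add: algebra_simps)
  also have "\<dots> = (t b c f) * (s a c * s b g * s f d)
 + (t b c g) * (s a c * s f b * s g d)
 + (t b d f) * (s a d * s b g * s c f)
 + (t b d g - t a c f) * (s a d * s c g * s f b)
 + (- t a c g) * (s a d * s f c * s g b)
 + (- t b c f) * (s a f * s b d * s c g)
 + (- t b d f) * (s a f * s c b * s d g)
 + (- t b c g) * (s a g * s b d * s f c)
 + (t a c f - t b d g) * (s a g * s c b * s f d)
 + (t a d f) * (s a g * s c f * s d b)
 + (- t a d f) * (s c a * s d g * s f b)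
 + (- t a d g) * (s c a * s f d * s g b)
 + (t a c g) * (s c b * s f a * s g d)
 + (t a d g) * (s c g * s d b * s f a)"
  proof -
    have coeff:
  "B d f * B b c + B b c * C f d = 0"
    "A c f d g * B b c + C f b * C c f + B b c * A f b g d = t b c f"
    "C c g * A a f b c + A f a g b * C c g + B b c * B g b = t b c g"
    "B d f * B b d + C f b * A c a d f + A a c b d * C f b = t b d f"
    "A c f d g * A a f b d + A f a g b * A c a d g + A a c b d * A f c g b = t b d g - t a c f"
    "C c g * A a g b d + B g a * C c a + A a c b d * B g c = - t a c g"
    "C c g * B b f + C f b * C c g = 0"
    "A c f d g * B b f + C f b * A c b d g + B b c * C f c = - t b c f"
    "B d f * A a c b f + C f b * B d b + A a c b d * C f d = - t b d f"
    "C c g * B b g + A f a g b * C c b + B b c * A f a g c = - t b c g"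
    "A c f d g * A a c b g + A f a g b * A c f d b + A a c b d * A f a g d = t a c f - t b d g"
    "B d f * A a d b g + A f a g b * B d f + C a d * C f a = t a d f"
    "B g a * C c b + B b c * B g a = 0"
    "C f b * B d a + C a d * C f b = 0"
    "B d f * C a f + A f a g b * B d a + C a d * A f d g b = - t a d f"
    "A c f d g * C a g + B g a * A c f d a + C a d * B g d = - t a d g"
    "C c g * C a c + B g a * A c g d b + A a c b d * B g a = t a c g"
    "B d f * C a g + B g a * B d f = 0"
    "A c f d g * C a d + B g a * B d g + C a d * A f c g a = t a d g"
    "C c g * C a d + C a d * B g c = 0"
      unfolding A_def B_def C_def t_def e_def[symmetric] sw self by (simp_all add: algebra_simps)
    show ?thesis unfolding coeff by (simp only: mult_zero_left add_0_left add_0_right)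
  qed
  also have "\<dots> = 0"
  proof -
    \<comment> \<open>If the three indices of \<open>t\<close> coincide, both monomials are the same.\<close>
    have merge:
      "t b c f * (s a f * s b d * s c g) = t b c f * (s a c * s b g * s f d)"
      "t b c g * (s a g * s b d * s f c) = t b c g * (s a c * s f b * s g d)"
      "t b d f * (s a f * s c b * s d g) = t b d f * (s a d * s b g * s c f)"
      "t b d g * (s a g * s c b * s f d) = t b d g * (s a d * s c g * s f b)"
      "t a c f * (s a g * s c b * s f d) = t a c f * (s a d * s c g * s f b)"
      "t a c g * (s c b * s f a * s g d) = t a c g * (s a d * s f c * s g b)"
      "t a d f * (s c a * s d g * s f b) = t a d f * (s a g * s c f * s d b)"
      "t a d g * (s c g * s d b * s f a) = t a d g * (s c a * s f d * s g b)"
      unfolding t by (simp_all split: if_split)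
    show ?thesis
      by (simp only: left_diff_distrib mult_minus_left merge) simp
  qed
  finally show ?thesis .
qed

text \<open>
  The pencil \<open>N z = s + z s\<^sup>T\<close> satisfies the relation of generating series for an arbitrary matrix
  \<open>s\<close>, with \<open>x = 1/\<lambda>\<close>, \<open>y = 1/\<mu>\<close> and cleared denominators: it is an identity of polynomials.
\<close>
lemma tri_bracket_pencil:
  fixes s :: "'i::linorder \<Rightarrow> 'i \<Rightarrow> 'a::idom" and x y :: 'a
  defines "N \<equiv> \<lambda>z a b. s a b + z * s b a"
  shows "(y - x) * (1 - x * y) * (tri_bracket s j i p l + x * tri_bracket s i j p l
       + y * tri_bracket s j i l p + x * y * tri_bracket s i j l p) =
     ((y - x) * (1 - x * y) * ord_sign j p - (y + x) * (1 - x * y)) * N x p i * N y j l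
   + ((y - x) * (1 - x * y) * ord_sign i l + (y + x) * (1 - x * y)) * N y p i * N x j l
   + ((y - x) * (1 - x * y) * ord_sign i p + (y - x) * (1 + x * y)) * N x j p * N y i l
   + ((y - x) * (1 - x * y) * ord_sign j l - (y - x) * (1 + x * y)) * N x l i * N y p j"
proof -
  define e :: "'i \<Rightarrow> 'i \<Rightarrow> 'a" where "e = ord_sign"
  have sw: "e p j = - e j p" "e l i = - e i l" "e p i = - e i p" "e l j = - e j l"
    unfolding e_def by (rule ord_sign_swap)+
  show ?thesis
    unfolding N_def tri_bracket_def e_def[symmetric] sw by algebra
qed

section \<open>The polynomial algebra of the generators\<close>

definition monom_eval :: "('x \<Rightarrow> complex) \<Rightarrow> ('x \<Rightarrow>\<^sub>0 nat) \<Rightarrow> complex" where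
  "monom_eval f m = (\<Prod>x\<in>Poly_Mapping.keys m. f x ^ Poly_Mapping.lookup m x)"

lemma monom_eval_superset:
  assumes "finite X" "Poly_Mapping.keys m \<subseteq> X"
  shows "monom_eval f m = (\<Prod>x\<in>X. f x ^ Poly_Mapping.lookup m x)"
  unfolding monom_eval_def
  using assms by (intro prod.mono_neutral_left) (auto simp: in_keys_iff)

lemma monom_eval_add: "monom_eval f (m + m') = monom_eval f m * monom_eval f m'"
proof -
  let ?X = "Poly_Mapping.keys m \<union> Poly_Mapping.keys m'"
  have "Poly_Mapping.keys (m + m') \<subseteq> ?X" by (rule Poly_Mapping.keys_add)
  then show ?thesis
    by (simp add: monom_eval_superset[of ?X] lookup_add power_add prod.distrib)
qed

lemma poly_eval_superset:
  assumes "finite K" "Poly_Mapping.keys p \<subseteq> K"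
  shows "poly_eval f p = (\<Sum>m\<in>K. Poly_Mapping.lookup p m * monom_eval f m)"
  unfolding poly_eval_def monom_eval_def[symmetric]
  using assms by (intro sum.mono_neutral_left) (auto simp: in_keys_iff)

lemma poly_eval_add: "poly_eval f (p + q) = poly_eval f p + poly_eval f q"
proof -
  let ?K = "Poly_Mapping.keys p \<union> Poly_Mapping.keys q"
  have "Poly_Mapping.keys (p + q) \<subseteq> ?K" by (rule Poly_Mapping.keys_add)
  then show ?thesis
    by (simp add: poly_eval_superset[of ?K] lookup_add ring_distribs sum.distrib)
qed

lemma poly_eval_single: "poly_eval f (Poly_Mapping.single m c) = c * monom_eval f m"
  by (simp add: poly_eval_def monom_eval_def)

lemma poly_eval_zero [simp]: "poly_eval f 0 = 0"
  by (simp add: poly_eval_def)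

lemma poly_eval_sum: "poly_eval f (\<Sum>i\<in>A. p i) = (\<Sum>i\<in>A. poly_eval f (p i))"
  by (induction A rule: infinite_finite_induct) (auto simp: poly_eval_add)

lemma sum_single_lookup:
  fixes p :: "'a \<Rightarrow>\<^sub>0 'b::comm_monoid_add"
  assumes "finite K" "Poly_Mapping.keys p \<subseteq> K"
  shows "(\<Sum>m\<in>K. Poly_Mapping.single m (Poly_Mapping.lookup p m)) = p"
proof (rule poly_mapping_eqI)
  fix k
  have "(\<Sum>m\<in>K. Poly_Mapping.lookup (Poly_Mapping.single m (Poly_Mapping.lookup p m)) k)
      = (\<Sum>m\<in>K. if m = k then Poly_Mapping.lookup p k else 0)"
    by (intro sum.cong) (auto simp: lookup_single when_def)
  also have "\<dots> = Poly_Mapping.lookup p k"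
    using assms by (auto simp: in_keys_iff)
  finally show "Poly_Mapping.lookup (\<Sum>m\<in>K. Poly_Mapping.single m (Poly_Mapping.lookup p m)) k
      = Poly_Mapping.lookup p k"
    by (simp add: lookup_sum)
qed

lemma poly_eval_mult: "poly_eval f (p * q) = poly_eval f p * poly_eval f q"
proof -
  have p: "p = (\<Sum>m\<in>Poly_Mapping.keys p. Poly_Mapping.single m (Poly_Mapping.lookup p m))"
    and q: "q = (\<Sum>m\<in>Poly_Mapping.keys q. Poly_Mapping.single m (Poly_Mapping.lookup q m))"
    by (simp_all add: sum_single_lookup)
  show ?thesis
    by (subst p, subst q, subst (3) p, subst (3) q)
      (simp add: sum_product poly_eval_sum poly_eval_single mult_single monom_eval_add mult_ac
        del: sum_distrib_left sum_distrib_right)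
qed

lemma poly_eval_const: "poly_eval f (Poly_Mapping.single 0 c) = c"
  by (simp add: poly_eval_single monom_eval_def)

lemma poly_eval_one [simp]: "poly_eval f 1 = 1"
  using poly_eval_const[of f 1] by simp

lemma poly_eval_uminus: "poly_eval f (- p) = - poly_eval f p"
  using poly_eval_add[of f p "- p"] by (simp add: eq_neg_iff_add_eq_0 add.commute)

lemma poly_eval_diff: "poly_eval f (p - q) = poly_eval f p - poly_eval f q"
  using poly_eval_add[of f p "- q"] by (simp add: poly_eval_uminus)

lemma poly_eval_two [simp]: "poly_eval f 2 = 2"
  using poly_eval_const[of f 2] by simp

definition gen_var :: "'i dvar \<Rightarrow> 'i dalg" where
  "gen_var x = Poly_Mapping.single (Poly_Mapping.single x 1) 1"

lemma poly_eval_var: "poly_eval f (gen_var x) = f x"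
  by (simp add: gen_var_def poly_eval_single monom_eval_def)

lemmas poly_eval_simps = poly_eval_add poly_eval_mult poly_eval_uminus poly_eval_diff
  poly_eval_sum poly_eval_const poly_eval_var

lemma finite_poly_vars: "finite (poly_vars p)"
  by (simp add: poly_vars_def)

lemma poly_vars_add: "poly_vars (p + q) \<subseteq> poly_vars p \<union> poly_vars q"
  using Poly_Mapping.keys_add[of p q] by (auto simp: poly_vars_def)

lemma poly_vars_mult: "poly_vars (p * q) \<subseteq> poly_vars p \<union> poly_vars q"
proof
  fix x assume "x \<in> poly_vars (p * q)"
  then obtain m where m: "m \<in> Poly_Mapping.keys (p * q)" "x \<in> Poly_Mapping.keys m"
    by (auto simp: poly_vars_def)
  then obtain a b where ab: "m = a + b" "a \<in> Poly_Mapping.keys p" "b \<in> Poly_Mapping.keys q"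
    using Poly_Mapping.keys_mult[of p q] by blast
  then have "x \<in> Poly_Mapping.keys a \<or> x \<in> Poly_Mapping.keys b"
    using m Poly_Mapping.keys_add[of a b] by blast
  then show "x \<in> poly_vars p \<union> poly_vars q"
    using ab by (auto simp: poly_vars_def)
qed

lemma poly_vars_uminus: "poly_vars (- p) = poly_vars p"
  by (simp add: poly_vars_def keys_def)

lemma poly_vars_single: "poly_vars (Poly_Mapping.single m c) \<subseteq> Poly_Mapping.keys m"
  by (auto simp: poly_vars_def)

lemma D_alg_const: "Poly_Mapping.single 0 c \<in> D_alg I"
  using poly_vars_single[of 0 c] by (auto simp: D_alg_def)

lemma D_alg_one: "1 \<in> D_alg I"
  using D_alg_const[of 1] by simp

lemma D_alg_two: "2 \<in> D_alg I"
  using D_alg_const[of 2] by simp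

lemma D_alg_zero: "0 \<in> D_alg I"
  by (simp add: D_alg_def poly_vars_def)

lemma D_alg_add: "p \<in> D_alg I \<Longrightarrow> q \<in> D_alg I \<Longrightarrow> p + q \<in> D_alg I"
  using poly_vars_add[of p q] by (auto simp: D_alg_def)

lemma D_alg_mult: "p \<in> D_alg I \<Longrightarrow> q \<in> D_alg I \<Longrightarrow> p * q \<in> D_alg I"
  using poly_vars_mult[of p q] by (auto simp: D_alg_def)

lemma D_alg_uminus: "p \<in> D_alg I \<Longrightarrow> - p \<in> D_alg I"
  by (auto simp: D_alg_def poly_vars_uminus)

lemma D_alg_diff: "p \<in> D_alg I \<Longrightarrow> q \<in> D_alg I \<Longrightarrow> p - q \<in> D_alg I"
  using D_alg_add[of p I "- q"] by (simp add: D_alg_uminus)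

lemma D_alg_sum: "(\<And>i. i \<in> A \<Longrightarrow> p i \<in> D_alg I) \<Longrightarrow> (\<Sum>i\<in>A. p i) \<in> D_alg I"
  by (induction A rule: infinite_finite_induct) (auto intro: D_alg_add D_alg_zero)

lemma D_alg_var: "x \<in> D_vars I \<Longrightarrow> gen_var x \<in> D_alg I"
  using poly_vars_single[of "Poly_Mapping.single x 1" 1] by (auto simp: D_alg_def gen_var_def)

lemmas D_alg_intros = D_alg_const D_alg_one D_alg_two D_alg_zero D_alg_add D_alg_mult
  D_alg_uminus D_alg_diff D_alg_sum

lemma D_gen_in_D_alg: "i \<in> I \<Longrightarrow> j \<in> I \<Longrightarrow> D_gen k i j \<in> D_alg I"
  by (auto simp: D_gen_def D_var_def D_vars_def D_alg_two gen_var_def[symmetric] simp del: One_nat_def intro!: D_alg_var)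

lemma D_coeff_in_D_alg: "i \<in> I \<Longrightarrow> j \<in> I \<Longrightarrow> D_coeff i j k \<in> D_alg I"
  by (auto simp: D_coeff_def D_alg_one D_alg_zero intro!: D_gen_in_D_alg)

lemma D_bracket_coeff_in_D_alg:
  "i \<in> I \<Longrightarrow> j \<in> I \<Longrightarrow> p \<in> I \<Longrightarrow> l \<in> I \<Longrightarrow> D_bracket_coeff j i k p l m \<in> D_alg I"
  unfolding D_bracket_coeff_def Let_def eps_def
  by (intro D_alg_intros D_coeff_in_D_alg) (auto intro!: D_alg_intros)

lemma poly_deriv_superset:
  assumes "finite K" "Poly_Mapping.keys p \<subseteq> K"
  shows "poly_deriv x p = (\<Sum>m\<in>K. Poly_Mapping.single (m - Poly_Mapping.single x 1)
        (of_nat (Poly_Mapping.lookup m x) * Poly_Mapping.lookup p m))"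
  unfolding poly_deriv_def
  using assms by (intro sum.mono_neutral_left) (auto simp: in_keys_iff)

lemma poly_deriv_add: "poly_deriv x (p + q) = poly_deriv x p + poly_deriv x q"
proof -
  let ?K = "Poly_Mapping.keys p \<union> Poly_Mapping.keys q"
  have "Poly_Mapping.keys (p + q) \<subseteq> ?K" by (rule Poly_Mapping.keys_add)
  then show ?thesis
    by (simp add: poly_deriv_superset[of ?K] lookup_add ring_distribs sum.distrib single_add)
qed

lemma poly_deriv_single:
  "poly_deriv x (Poly_Mapping.single m c) =
     Poly_Mapping.single (m - Poly_Mapping.single x 1) (of_nat (Poly_Mapping.lookup m x) * c)"
  by (simp add: poly_deriv_def)

lemma poly_deriv_zero [simp]: "poly_deriv x 0 = 0"
  by (simp add: poly_deriv_def)

lemma poly_deriv_sum: "poly_deriv x (\<Sum>i\<in>A. p i) = (\<Sum>i\<in>A. poly_deriv x (p i))"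
  by (induction A rule: infinite_finite_induct) (auto simp: poly_deriv_add)

lemma poly_deriv_const: "poly_deriv x (Poly_Mapping.single 0 c) = 0"
  by (simp add: poly_deriv_single)

lemma poly_deriv_mult_var_single:
  "poly_deriv y (Poly_Mapping.single m c * gen_var x) =
     poly_deriv y (Poly_Mapping.single m c) * gen_var x
     + (if x = y then Poly_Mapping.single m c else 0)"
proof (cases "Poly_Mapping.lookup m y = 0")
  case True
  then show ?thesis
    by (auto simp: gen_var_def poly_deriv_single mult_single lookup_add lookup_single when_def)
next
  case False
  have eq: "m - Poly_Mapping.single y 1 + Poly_Mapping.single x 1
    = m + Poly_Mapping.single x 1 - Poly_Mapping.single y 1"
    using False by (intro poly_mapping_eqI) (auto simp: lookup_add lookup_minus lookup_single when_def)
  have eq2: "m + Poly_Mapping.single x 1 - Poly_Mapping.single x 1 = m"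
    by simp
  show ?thesis
    using eq2
    by (auto simp: gen_var_def poly_deriv_single mult_single eq lookup_add lookup_single when_def
        ring_distribs single_add simp del: One_nat_def)
qed

lemma poly_deriv_mult_var:
  "poly_deriv y (p * gen_var x) = poly_deriv y p * gen_var x + (if x = y then p else 0)"
proof -
  have p: "p = (\<Sum>m\<in>Poly_Mapping.keys p. Poly_Mapping.single m (Poly_Mapping.lookup p m))"
    by (simp add: sum_single_lookup)
  have "poly_deriv y ((\<Sum>m\<in>Poly_Mapping.keys p. Poly_Mapping.single m (Poly_Mapping.lookup p m)) * gen_var x)
    = poly_deriv y (\<Sum>m\<in>Poly_Mapping.keys p. Poly_Mapping.single m (Poly_Mapping.lookup p m)) * gen_var x
      + (if x = y then (\<Sum>m\<in>Poly_Mapping.keys p. Poly_Mapping.single m (Poly_Mapping.lookup p m)) else 0)"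
    by (simp only: sum_distrib_right poly_deriv_sum poly_deriv_mult_var_single) (simp add: sum.distrib)
  then show ?thesis unfolding p[symmetric] .
qed

text \<open>
  The multiplication is restricted to variables, since this is the form in which the Leibniz rule
  is used below.
\<close>
lemma poly_vars_induct [consumes 1, case_names const add mult_var]:
  assumes "poly_vars p \<subseteq> V"
    and "\<And>c. P (Poly_Mapping.single 0 c)"
    and "\<And>a b. P a \<Longrightarrow> P b \<Longrightarrow> poly_vars a \<subseteq> V \<Longrightarrow> poly_vars b \<subseteq> V \<Longrightarrow> P (a + b)"
    and "\<And>a x. P a \<Longrightarrow> poly_vars a \<subseteq> V \<Longrightarrow> x \<in> V \<Longrightarrow> P (a * gen_var x)"
  shows "P (p :: 'i dalg)"
proof -
  have mono: "P (Poly_Mapping.single m c)" if "Poly_Mapping.keys m \<subseteq> V" for m c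
    using that
  proof (induction "\<Sum>x\<in>Poly_Mapping.keys m. Poly_Mapping.lookup m x" arbitrary: m)
    case 0
    then have "m = 0"
      by (intro poly_mapping_eqI) (auto simp: in_keys_iff)
    then show ?case using assms(2) by simp
  next
    case (Suc n)
    then obtain x where x: "x \<in> Poly_Mapping.keys m"
      by (metis nat.distinct(1) sum.empty ex_in_conv)
    define m' where "m' = m - Poly_Mapping.single x 1"
    have m: "m = m' + Poly_Mapping.single x 1"
      unfolding m'_def using x
      by (intro poly_mapping_eqI) (auto simp: lookup_add lookup_minus lookup_single when_def in_keys_iff)
    have lk: "Poly_Mapping.lookup m y = Poly_Mapping.lookup m' y + (if y = x then 1 else 0)" for y
      unfolding m by (simp add: lookup_add lookup_single when_def)
    have sub: "Poly_Mapping.keys m' \<subseteq> Poly_Mapping.keys m"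
      unfolding m'_def by (auto simp: in_keys_iff lookup_minus)
    have "(\<Sum>y\<in>Poly_Mapping.keys m. Poly_Mapping.lookup m y)
        = (\<Sum>y\<in>Poly_Mapping.keys m. Poly_Mapping.lookup m' y + (if y = x then 1 else 0))"
      unfolding lk ..
    also have "\<dots> = (\<Sum>y\<in>Poly_Mapping.keys m. Poly_Mapping.lookup m' y) + 1"
      using x by (simp add: sum.distrib)
    also have "(\<Sum>y\<in>Poly_Mapping.keys m. Poly_Mapping.lookup m' y)
        = (\<Sum>y\<in>Poly_Mapping.keys m'. Poly_Mapping.lookup m' y)"
      using sub by (intro sum.mono_neutral_right) (auto simp: in_keys_iff)
    finally have "n = (\<Sum>y\<in>Poly_Mapping.keys m'. Poly_Mapping.lookup m' y)"
      using Suc.hyps(2) by simp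
    then have "P (Poly_Mapping.single m' c)"
      using Suc sub by blast
    then have "P (Poly_Mapping.single m' c * gen_var x)"
      using assms(4) sub Suc.prems x poly_vars_single[of m' c] by blast
    then show ?case by (simp add: gen_var_def mult_single m)
  qed
  have "P (\<Sum>m\<in>K. Poly_Mapping.single m (Poly_Mapping.lookup p m))
      \<and> poly_vars (\<Sum>m\<in>K. Poly_Mapping.single m (Poly_Mapping.lookup p m)) \<subseteq> V"
    if "finite K" "K \<subseteq> Poly_Mapping.keys p" for K
    using that
  proof (induction K)
    case empty
    show ?case using assms(2)[of 0] by (simp add: poly_vars_def)
  next
    case (insert m K)
    have k: "Poly_Mapping.keys m \<subseteq> V"
      using insert.prems assms(1) by (auto simp: poly_vars_def)
    then have "poly_vars (Poly_Mapping.single m (Poly_Mapping.lookup p m)) \<subseteq> V"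
      using poly_vars_single by blast
    with k insert show ?case
      using assms(3) mono poly_vars_add by (simp, blast)
  qed
  from this[of "Poly_Mapping.keys p"] show ?thesis
    by (simp add: sum_single_lookup)
qed

text \<open>
  \<open>d\<close> is a derivation along the evaluation homomorphism at \<open>f\<close>. Its laws are required only on
  polynomials in the variables \<open>V\<close>, because a bracket on \<open>monodromy_algebra c\<close> is subject to conditions
  only for the images of such polynomials.
\<close>
lemma derivation_chain_rule:
  fixes d :: "'i dalg \<Rightarrow> complex"
  assumes "finite V" "poly_vars a \<subseteq> V"
    and "\<And>c. d (Poly_Mapping.single 0 c) = 0"
    and "\<And>p q. poly_vars p \<subseteq> V \<Longrightarrow> poly_vars q \<subseteq> V \<Longrightarrow> d (p + q) = d p + d q"
    and "\<And>p x. poly_vars p \<subseteq> V \<Longrightarrow> x \<in> V \<Longrightarrow>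
           d (p * gen_var x) = poly_eval f p * d (gen_var x) + f x * d p"
  shows "d a = (\<Sum>x\<in>V. poly_eval f (poly_deriv x a) * d (gen_var x))"
  using assms(2)
proof (induction rule: poly_vars_induct)
  case (const c)
  then show ?case using assms(3) by (simp add: poly_deriv_const)
next
  case (add a b)
  then show ?case using assms(4)
    by (simp add: poly_deriv_add poly_eval_add ring_distribs sum.distrib)
next
  case (mult_var a x)
  have "(\<Sum>y\<in>V. poly_eval f (poly_deriv y (a * gen_var x)) * d (gen_var y))
     = (\<Sum>y\<in>V. f x * (poly_eval f (poly_deriv y a) * d (gen_var y))
          + (if y = x then poly_eval f a * d (gen_var x) else 0))"
    by (intro sum.cong) (auto simp: poly_deriv_mult_var poly_eval_simps algebra_simps)
  also have "\<dots> = f x * d a + poly_eval f a * d (gen_var x)"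
    using mult_var assms(1) by (simp add: sum.distrib sum_distrib_left)
  finally show ?case using assms(5) mult_var by simp
qed

lemma poly_vars_deriv: "poly_vars (poly_deriv x p) \<subseteq> poly_vars p"
proof -
  have "poly_vars (\<Sum>m\<in>K. Poly_Mapping.single (m - Poly_Mapping.single x 1) (c m)) \<subseteq> poly_vars p"
    if "finite K" "K \<subseteq> Poly_Mapping.keys p" for K c
    using that
  proof (induction K)
    case empty
    then show ?case by (simp add: poly_vars_def)
  next
    case (insert m K)
    have "Poly_Mapping.keys (m - Poly_Mapping.single x 1) \<subseteq> Poly_Mapping.keys m"
      by (auto simp: in_keys_iff lookup_minus)
    then have "poly_vars (Poly_Mapping.single (m - Poly_Mapping.single x 1) (c m)) \<subseteq> poly_vars p"
      using insert.prems poly_vars_single[of "m - Poly_Mapping.single x 1" "c m"]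
      by (auto simp: poly_vars_def)
    then show ?case
      using insert poly_vars_add by (simp, blast)
  qed
  then show ?thesis unfolding poly_deriv_def by simp
qed

lemma D_bracket_in_D_alg:
  assumes "a \<in> D_alg I" "b \<in> D_alg I"
  shows "D_bracket a b \<in> D_alg I"
proof -
  have deriv: "poly_deriv x p \<in> D_alg I" if "p \<in> D_alg I" for x p
    using poly_vars_deriv[of x p] that by (auto simp: D_alg_def)
  have vars: "i \<in> I \<and> j \<in> I" if "(k, i, j) \<in> poly_vars p" "p \<in> D_alg I" for k i j p
    using that by (auto simp: D_alg_def D_vars_def)
  show ?thesis
    unfolding D_bracket_def case_prod_unfold using assms
    by (intro D_alg_sum D_alg_mult deriv D_bracket_coeff_in_D_alg)
      (auto dest: vars[rotated])
qed

section \<open>Matrix algebra\<close>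

lemma matrix_mult_distribs:
  fixes A B C :: "'a::comm_ring_1^'n^'n"
  shows "(A + B) ** C = A ** C + B ** C" "C ** (A + B) = C ** A + C ** B"
    "(A - B) ** C = A ** C - B ** C" "C ** (A - B) = C ** A - C ** B"
    "(- A) ** C = - (A ** C)" "C ** (- A) = - (C ** A)"
    "0 ** C = 0" "C ** 0 = 0"
  by (simp_all add: vec_eq_iff matrix_matrix_mult_def sum.distrib sum_subtractf sum_negf algebra_simps)

lemma matrix_mult_sums:
  fixes C :: "'a::comm_ring_1^'n^'n"
  shows "(\<Sum>i\<in>I. F i) ** C = (\<Sum>i\<in>I. F i ** C)" "C ** (\<Sum>i\<in>I. F i) = (\<Sum>i\<in>I. C ** F i)"
  by (induction I rule: infinite_finite_induct) (simp_all add: matrix_mult_distribs)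

lemma matrix_inv_right: "invertible A \<Longrightarrow> A ** matrix_inv A = mat 1"
  and matrix_inv_left: "invertible A \<Longrightarrow> matrix_inv A ** A = mat 1"
  for A :: "'a::semiring_1^'n^'n"
  unfolding invertible_def matrix_inv_def by (metis (mono_tags, lifting) someI_ex)+

lemma matrix_inv_eqI:
  fixes A B :: "('a::field)^'n^'n"
  assumes "A ** B = mat 1" shows "matrix_inv A = B"
proof -
  have "B ** A = mat 1" using assms matrix_left_right_inverse by blast
  then have "invertible A" using assms invertible_def by blast
  then have "matrix_inv A ** (A ** B) = B"
    by (simp add: matrix_mul_assoc matrix_inv_left)
  then show ?thesis by (simp add: assms)
qed

lemma invertible_rightI: "A ** B = mat 1 \<Longrightarrow> invertible A"
  for A B :: "('a::field)^'n^'n"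
  using invertible_right_inverse by blast

lemma mat_mult_nth: "(mat x ** A) $ i $ j = x * A $ i $ j"
  for A :: "'a::semiring_1^'m^'n"
  by (simp add: matrix_matrix_mult_def mat_def if_distrib[of "\<lambda>x. x * _"] cong: if_cong)

lemma matrix_vector_axis: "(A *v axis j 1) $ i = A $ i $ j"
  for A :: "'a::semiring_1^'n^'m"
  by (simp add: matrix_vector_mult_def axis_def if_distrib[of "\<lambda>x. _ * x"] cong: if_cong)

lemma mat_pow_0 [simp]: "mat_pow A 0 = mat 1"
  and mat_pow_Suc: "mat_pow A (Suc k) = A ** mat_pow A k"
  by (simp_all add: mat_pow_def)

lemma mat_pow_Suc_right: "mat_pow A (Suc k) = mat_pow A k ** A"
  by (induction k) (auto simp: mat_pow_Suc matrix_mul_assoc)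

lemma mat_powi_nat: "mat_powi A (int k) = mat_pow A k"
  by (simp add: mat_powi_def)

lemma mat_powi_0 [simp]: "mat_powi A 0 = mat 1"
  by (simp add: mat_powi_def)

lemma mat_powi_plus1:
  assumes "invertible A" shows "mat_powi A (k + 1) = A ** mat_powi A k"
proof (cases "k \<ge> 0")
  case True
  then have "nat (k + 1) = Suc (nat k)" by simp
  then show ?thesis using True by (simp add: mat_powi_def mat_pow_Suc)
next
  case False
  then have "nat (- k) = Suc (nat (- (k + 1)))" by simp
  then have "A ** mat_powi A k = mat_pow (matrix_inv A) (nat (- (k + 1)))"
    using False assms by (simp add: mat_powi_def mat_pow_Suc matrix_mul_assoc matrix_inv_right)
  also have "\<dots> = mat_powi A (k + 1)"
    using False by (cases "k = - 1") (simp_all add: mat_powi_def)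
  finally show ?thesis by simp
qed

lemma mat_powi_minus1:
  assumes "invertible A" shows "mat_powi A (k - 1) = matrix_inv A ** mat_powi A k"
proof -
  have "matrix_inv A ** mat_powi A k = (matrix_inv A ** A) ** mat_powi A (k - 1)"
    using mat_powi_plus1[OF assms, of "k - 1"] by (simp add: matrix_mul_assoc)
  then show ?thesis using assms by (simp add: matrix_inv_left)
qed

lemma mat_powi_add:
  assumes "invertible A" shows "mat_powi A (a + b) = mat_powi A a ** mat_powi A b"
proof (induction a rule: int_induct[where k = 0])
  case base
  then show ?case by simp
next
  case (step1 i)
  have "mat_powi A (i + 1 + b) = mat_powi A ((i + b) + 1)" by (simp add: add_ac)
  then show ?case using step1 by (simp only: mat_powi_plus1[OF assms] matrix_mul_assoc)
next
  case (step2 i)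
  have "mat_powi A (i - 1 + b) = mat_powi A ((i + b) - 1)" by (simp add: algebra_simps)
  then show ?case using step2 by (simp only: mat_powi_minus1[OF assms] matrix_mul_assoc)
qed

lemma mat_powi_1: "invertible A \<Longrightarrow> mat_powi A 1 = A"
  using mat_powi_plus1[of A 0] by simp

lemma mat_powi_uminus:
  assumes "invertible A" shows "mat_powi A (- k) ** mat_powi A k = mat 1"
    "mat_powi A k ** mat_powi A (- k) = mat 1"
  using mat_powi_add[OF assms, of "- k" k] mat_powi_add[OF assms, of k "- k"] by simp_all

lemma mat_powi_conj:
  fixes A P :: "'n::finite cmat"
  assumes "invertible A" "invertible P"
  shows "mat_powi (matrix_inv P ** A ** P) k = matrix_inv P ** mat_powi A k ** P"
    and "invertible (matrix_inv P ** A ** P)"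
proof -
  let ?B = "matrix_inv P ** A ** P"
  have PP: "X ** P ** matrix_inv P = X" for X
    using assms by (simp add: matrix_mul_assoc[symmetric] matrix_inv_right)
  have AA: "X ** A ** matrix_inv A = X" for X
    using assms by (simp add: matrix_mul_assoc[symmetric] matrix_inv_right)
  have inv: "?B ** (matrix_inv P ** matrix_inv A ** P) = mat 1"
    using assms by (simp add: matrix_mul_assoc PP AA matrix_inv_left)
  then show B: "invertible ?B" by (rule invertible_rightI)
  have mi: "matrix_inv ?B = matrix_inv P ** matrix_inv A ** P"
    using inv by (rule matrix_inv_eqI)
  show "mat_powi ?B k = matrix_inv P ** mat_powi A k ** P"
  proof (induction k rule: int_induct[where k = 0])
    case base
    then show ?case using assms by (simp add: matrix_inv_left)
  next
    case (step1 i)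
    then show ?case
      by (simp add: mat_powi_plus1[OF B] mat_powi_plus1[OF assms(1)] matrix_mul_assoc PP)
  next
    case (step2 i)
    then show ?case
      by (simp add: mat_powi_minus1[OF B] mat_powi_minus1[OF assms(1)] matrix_mul_assoc PP mi)
  qed
qed

section \<open>Reflections\<close>

lemma gram_nth: "gram S $ i $ j = S $ i $ j + S $ j $ i"
  by (simp add: gram_def transpose_def)

lemma transpose_gram: "transpose (gram S) = gram S"
  by (simp add: vec_eq_iff transpose_def gram_nth add.commute)

lemma refl_mat_nth: "refl_mat S k $ i $ j = (if i = j then 1 else 0) - (if i = k then gram S $ k $ j else 0)"
proof -
  have "(elem_mat k k ** gram S) $ i $ j = (\<Sum>a\<in>UNIV. if a = k then (if i = k then gram S $ k $ j else 0) else 0)"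
    unfolding matrix_matrix_mult_def elem_mat_def vec_lambda_beta by (rule sum.cong) auto
  also have "\<dots> = (if i = k then gram S $ k $ j else 0)"
    by simp
  finally show ?thesis by (simp add: refl_mat_def mat_def)
qed

lemma vec_refl_mat: "(v v* refl_mat S k) $ j = v $ j - v $ k * gram S $ k $ j"
proof -
  have "(v v* refl_mat S k) $ j = (\<Sum>i\<in>UNIV. (if i = j then v $ j else 0) - (if i = k then v $ k * gram S $ k $ j else 0))"
    unfolding vector_matrix_mult_def refl_mat_nth by (auto intro!: sum.cong simp: algebra_simps)
  then show ?thesis by (simp add: sum_subtractf)
qed

definition refl_prod :: "'n cmat \<Rightarrow> 'n list \<Rightarrow> ('n::{finite,linorder}) cmat" where
  "refl_prod S ks = foldr (\<lambda>k P. refl_mat S k ** P) ks (mat 1)"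

lemma refl_prod_Nil [simp]: "refl_prod S [] = mat 1"
  and refl_prod_Cons [simp]: "refl_prod S (k # ks) = refl_mat S k ** refl_prod S ks"
  by (simp_all add: refl_prod_def)

lemma M_h_refl_prod: "M_h c S = refl_prod S (sorted_list_of_set {c..})"
  by (simp add: M_h_def refl_prod_def)

lemma vec_refl_prod_fixed:
  assumes "\<And>k. k \<in> set ks \<Longrightarrow> v $ k = 0" shows "v v* refl_prod S ks = v"
  using assms
proof (induction ks)
  case (Cons k ks)
  have "v v* refl_mat S k = v"
    using Cons.prems by (simp add: vec_eq_iff vec_refl_mat)
  then show ?case using Cons by (simp add: vector_matrix_mul_assoc[symmetric])
qed simp

lemma row_matrix_mult: "(A ** B) $ i = A $ i v* B"
  by (simp add: vec_eq_iff matrix_matrix_mult_def vector_matrix_mult_def mult.commute)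

lemma refl_prod_row:
  assumes "i \<notin> set ks" shows "refl_prod S ks $ i $ j = mat 1 $ i $ j"
proof -
  have "(mat 1 $ i) v* refl_prod S ks = mat 1 $ i"
    using assms by (intro vec_refl_prod_fixed) (auto simp: mat_def)
  then show ?thesis by (metis matrix_mul_lid row_matrix_mult)
qed

text \<open>
  The row \<open>r\<close> of \<open>S\<close> vanishes to the left of \<open>r\<close>, the reflection with number \<open>r\<close> turns it into
  minus the column \<open>r\<close>, and this vanishes to the right of \<open>r\<close>.
\<close>
lemma refl_prod_stokes:
  assumes S: "upper_unitriangular S" and "sorted ks" "distinct ks" "r \<in> set ks"
  shows "(S ** refl_prod S ks) $ r $ j = - S $ j $ r"
proof -
  have "S $ r v* refl_prod S ks = - column r S" using assms(2-)
  proof (induction ks)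
    case (Cons k ks)
    show ?case
    proof (cases "r = k")
      case True
      have "S $ r v* refl_mat S k = - column r S"
        using S by (simp add: True vec_eq_iff vec_refl_mat column_def gram_nth upper_unitriangular_def)
      moreover have "- column r S v* refl_prod S ks = - column r S"
        using Cons.prems True S
        by (intro vec_refl_prod_fixed) (auto simp: column_def upper_unitriangular_def order.order_iff_strict)
      ultimately show ?thesis by (simp add: vector_matrix_mul_assoc[symmetric])
    next
      case False
      then have "r \<in> set ks" using Cons.prems by auto
      then have "k < r" using Cons.prems False by (auto simp: order.order_iff_strict)
      then have "S $ r v* refl_mat S k = S $ r"
        using S by (simp add: vec_eq_iff vec_refl_mat upper_unitriangular_def)
      then show ?thesis using Cons \<open>r \<in> set ks\<close>
        by (simp add: vector_matrix_mul_assoc[symmetric])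
    qed
  qed simp
  then show ?thesis by (simp add: row_matrix_mult column_def)
qed

lemma refl_mat_square:
  assumes "upper_unitriangular S" shows "refl_mat S k ** refl_mat S k = mat 1"
proof -
  have "(v v* refl_mat S k) v* refl_mat S k = v" for v
    using assms by (simp add: vec_eq_iff vec_refl_mat gram_nth upper_unitriangular_def algebra_simps)
  then show ?thesis
    by (metis (no_types) row_matrix_mult matrix_mul_lid vec_eq_iff vector_matrix_mul_assoc)
qed

lemma refl_mat_orthogonal:
  assumes "upper_unitriangular S"
  shows "transpose (refl_mat S k) ** gram S ** refl_mat S k = gram S"
proof -
  have kk: "gram S $ k $ k = 2"
    using assms by (simp add: gram_nth upper_unitriangular_def)
  have sym: "gram S $ a $ b = gram S $ b $ a" for a b by (simp add: gram_nth add.commute)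
  have "(gram S ** refl_mat S k) $ a $ b = gram S $ a $ b - gram S $ a $ k * gram S $ k $ b" for a b
    by (simp add: row_matrix_mult vec_refl_mat)
  moreover have "(transpose (refl_mat S k) ** X) $ a $ b = X $ a $ b - gram S $ k $ a * X $ k $ b" for X :: "'a cmat" and a b
  proof -
    have "(transpose (refl_mat S k) ** X) $ a $ b
        = (\<Sum>i\<in>UNIV. (if i = a then X $ a $ b else 0) - (if i = k then gram S $ k $ a * X $ k $ b else 0))"
      unfolding matrix_matrix_mult_def transpose_def
      by (auto intro!: sum.cong simp: refl_mat_nth algebra_simps)
    then show ?thesis by (simp add: sum_subtractf)
  qed
  ultimately have "(transpose (refl_mat S k) ** (gram S ** refl_mat S k)) $ a $ b = gram S $ a $ b" for a b
    using kk sym[of a k] by simp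
  then show ?thesis
    by (simp add: vec_eq_iff matrix_mul_assoc)
qed

text \<open>
  Each factor is a reflection for the symmetric form \<open>G\<close>, in the direction of a basis vector.
\<close>
lemma refl_prod_orthogonal:
  assumes "upper_unitriangular S"
  shows "transpose (refl_prod S ks) ** gram S ** refl_prod S ks = gram S"
proof (induction ks)
  case (Cons k ks)
  have "transpose (refl_prod S (k # ks)) ** gram S ** refl_prod S (k # ks)
     = transpose (refl_prod S ks) ** (transpose (refl_mat S k) ** gram S ** refl_mat S k) ** refl_prod S ks"
    by (simp add: matrix_transpose_mul matrix_mul_assoc)
  then show ?case using Cons assms by (simp add: refl_mat_orthogonal)
qed simp

lemma refl_prod_invertible:
  assumes "upper_unitriangular S" shows "invertible (refl_prod S ks)"
proof (induction ks)
  case (Cons k ks)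
  have "invertible (refl_mat S k)"
    using refl_mat_square[OF assms] by (rule invertible_rightI)
  then show ?case using Cons by (simp add: invertible_mult)
qed (simp add: invertible_def)

lemma M_h_row: "i < c \<Longrightarrow> M_h c S $ i $ j = mat 1 $ i $ j"
  unfolding M_h_refl_prod by (rule refl_prod_row) simp

lemma M_h_stokes:
  "upper_unitriangular S \<Longrightarrow> c \<le> r \<Longrightarrow> (S ** M_h c S) $ r $ j = - S $ j $ r"
  unfolding M_h_refl_prod by (rule refl_prod_stokes) auto

lemma M_h_orthogonal:
  "upper_unitriangular S \<Longrightarrow> transpose (M_h c S) ** gram S ** M_h c S = gram S"
  unfolding M_h_refl_prod by (rule refl_prod_orthogonal)

lemma M_h_invertible: "upper_unitriangular S \<Longrightarrow> invertible (M_h c S)"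
  unfolding M_h_refl_prod by (rule refl_prod_invertible)

lemma gram_mat_powi:
  assumes M: "transpose M ** gram S ** M = gram S" "invertible M"
  shows "transpose (mat_powi M k) ** gram S ** mat_powi M k = gram S"
proof (induction k rule: int_induct[where k = 0])
  case (step1 i)
  have "transpose (mat_powi M (i + 1)) ** gram S ** mat_powi M (i + 1)
     = transpose (mat_powi M i) ** (transpose M ** gram S ** M) ** mat_powi M i"
    by (simp add: mat_powi_plus1[OF M(2)] matrix_transpose_mul matrix_mul_assoc)
  then show ?case using step1 M by simp
next
  case (step2 i)
  have "transpose (matrix_inv M) ** gram S ** matrix_inv M
     = transpose (matrix_inv M) ** (transpose M ** gram S ** M) ** matrix_inv M"
    using M by simp
  also have "\<dots> = transpose (M ** matrix_inv M) ** gram S ** (M ** matrix_inv M)"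
    by (simp add: matrix_transpose_mul matrix_mul_assoc)
  also have "\<dots> = gram S" using M by (simp add: matrix_inv_right)
  finally have inv: "transpose (matrix_inv M) ** gram S ** matrix_inv M = gram S" .
  have "transpose (mat_powi M (i - 1)) ** gram S ** mat_powi M (i - 1)
     = transpose (mat_powi M i) ** (transpose (matrix_inv M) ** gram S ** matrix_inv M) ** mat_powi M i"
    by (simp add: mat_powi_minus1[OF M(2)] matrix_transpose_mul matrix_mul_assoc)
  then show ?case using step2 inv by simp
qed simp

text \<open>
  This is the relation \<open>G(-k) j i = G(k) i j\<close>: \<open>M\<^sub>h\<close> preserves the form \<open>G\<close>, so that \<open>G M\<^sub>h\<^sup>-\<^sup>k\<close>
  is the transpose of \<open>G M\<^sub>h\<^sup>k\<close>.
\<close>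
lemma realized_gen_swap:
  assumes "upper_unitriangular S"
  shows "realized_gen c S (- k) j i = realized_gen c S k i j"
proof -
  let ?M = "M_h c S"
  note M = M_h_orthogonal[OF assms, of c] M_h_invertible[OF assms, of c]
  have "transpose (mat_powi ?M k) ** gram S ** mat_powi ?M k ** mat_powi ?M (- k)
      = gram S ** mat_powi ?M (- k)"
    using gram_mat_powi[OF M] by simp
  then have "gram S ** mat_powi ?M (- k) = transpose (mat_powi ?M k) ** gram S"
    by (simp add: matrix_mul_assoc[symmetric] mat_powi_uminus[OF M(2)])
  also have "\<dots> = transpose (gram S ** mat_powi ?M k)"
    by (simp add: matrix_transpose_mul transpose_gram)
  finally show ?thesis by (simp add: realized_gen_def transpose_def)
qed

lemma realized_gen_0: "realized_gen c S 0 i j = S $ i $ j + S $ j $ i"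
  by (simp add: realized_gen_def gram_nth)

lemma M_h_column:
  assumes "\<And>k. c \<le> k \<Longrightarrow> gram S $ k $ j = 0" "j < c"
  shows "mat_pow (M_h c S) k *v axis j 1 = axis j 1"
proof -
  have "refl_prod S ks *v axis j 1 = axis j 1" if "set ks \<subseteq> {c..}" for ks
    using that
  proof (induction ks)
    case (Cons k ks)
    have "refl_mat S k *v axis j 1 = axis j 1"
      using assms Cons.prems by (auto simp: vec_eq_iff matrix_vector_axis refl_mat_nth) (auto simp: axis_def)
    then show ?case using Cons by (simp add: matrix_vector_mul_assoc[symmetric])
  qed simp
  then have "M_h c S *v axis j 1 = axis j 1" by (simp add: M_h_refl_prod)
  then show ?thesis
    by (induction k) (simp_all add: mat_pow_Suc matrix_vector_mul_assoc[symmetric])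
qed

text \<open>
  If the form \<open>G\<close> does not couple the direction \<open>j\<close> with those of the clashed poles, then all
  reflections in \<open>M\<^sub>h\<close> fix the basis vector \<open>j\<close>.
\<close>
lemma realized_gen_decoupled:
  assumes "\<And>k. c \<le> k \<Longrightarrow> gram S $ k $ j = 0" "j < c"
  shows "realized_gen c S (int k) i j = gram S $ i $ j"
proof -
  have "realized_gen c S (int k) i j = ((gram S ** mat_pow (M_h c S) k) *v axis j 1) $ i"
    by (simp add: realized_gen_def mat_powi_nat matrix_vector_axis)
  also have "\<dots> = gram S $ i $ j"
    using M_h_column[OF assms, of k]
    by (simp add: matrix_vector_mul_assoc[symmetric] matrix_vector_axis)
  finally show ?thesis .
qed

section \<open>Entrywise derivatives\<close>

definition has_mat_derivative ::
  "(complex \<Rightarrow> 'n::finite cmat) \<Rightarrow> 'n cmat \<Rightarrow> complex \<Rightarrow> bool" where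
  "has_mat_derivative F D z \<longleftrightarrow>
     (\<forall>i j. ((\<lambda>x. F x $ i $ j) has_field_derivative D $ i $ j) (at z))"

lemma has_mat_derivative_const: "has_mat_derivative (\<lambda>x. A) 0 z"
  by (simp add: has_mat_derivative_def)

lemma has_mat_derivative_line: "has_mat_derivative (\<lambda>x. A + mat x ** E) E z"
proof -
  have "(A + mat x ** E) $ i $ j = A $ i $ j + x * E $ i $ j" for x i j
    by (simp add: mat_mult_nth)
  then show ?thesis
    unfolding has_mat_derivative_def by (auto intro!: DERIV_cong[OF DERIV_add[OF DERIV_const DERIV_cmult_right[OF DERIV_ident]]])
qed

lemma has_mat_derivative_mult:
  assumes "has_mat_derivative F F' z" "has_mat_derivative G G' z"
  shows "has_mat_derivative (\<lambda>x. F x ** G x) (F' ** G z + F z ** G') z"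
  unfolding has_mat_derivative_def
proof (intro allI)
  fix i j
  have "((\<lambda>x. \<Sum>k\<in>UNIV. F x $ i $ k * G x $ k $ j) has_field_derivative
      (\<Sum>k\<in>UNIV. F' $ i $ k * G z $ k $ j + F z $ i $ k * G' $ k $ j)) (at z)"
    using assms unfolding has_mat_derivative_def
    by (intro DERIV_sum) (subst add.commute, rule DERIV_mult', auto)
  then show "((\<lambda>x. (F x ** G x) $ i $ j) has_field_derivative (F' ** G z + F z ** G') $ i $ j) (at z)"
    by (simp add: matrix_matrix_mult_def sum.distrib)
qed

lemma has_mat_derivative_pow:
  assumes "has_mat_derivative F F' z"
  shows "has_mat_derivative (\<lambda>x. mat_pow (F x) k)
    (\<Sum>q<k. mat_pow (F z) q ** F' ** mat_pow (F z) (k - 1 - q)) z"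
proof (induction k)
  case 0
  then show ?case using has_mat_derivative_const by simp
next
  case (Suc k)
  have "has_mat_derivative (\<lambda>x. F x ** mat_pow (F x) k)
     (F' ** mat_pow (F z) k + F z ** (\<Sum>q<k. mat_pow (F z) q ** F' ** mat_pow (F z) (k - 1 - q))) z"
    by (intro has_mat_derivative_mult assms Suc)
  moreover have "F z ** (\<Sum>q<k. mat_pow (F z) q ** F' ** mat_pow (F z) (k - 1 - q))
      = (\<Sum>q<k. mat_pow (F z) (Suc q) ** F' ** mat_pow (F z) (Suc k - 1 - Suc q))"
    by (simp add: matrix_mult_sums matrix_mul_assoc mat_pow_Suc)
  ultimately show ?case
    unfolding mat_pow_Suc[of _ k] sum.lessThan_Suc_shift by simp
qed

lemma det_differentiable:
  assumes "\<And>i j. (\<lambda>x. F x $ i $ j) field_differentiable (at z)"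
  shows "(\<lambda>x. det (F x :: 'n::finite cmat)) field_differentiable (at z)"
proof -
  have prod: "(\<lambda>x. \<Prod>i\<in>I. F x $ i $ p i) field_differentiable (at z)" for I p
    by (induction I rule: infinite_finite_induct)
      (auto intro: field_differentiable_mult assms field_differentiable_const)
  show ?thesis
    unfolding det_def
    by (intro field_differentiable_sum field_differentiable_mult field_differentiable_const prod)
qed

lemma has_mat_derivative_unique:
  assumes "has_mat_derivative F D z" "has_mat_derivative F E z" shows "D = E"
  using assms unfolding has_mat_derivative_def vec_eq_iff by (blast intro: DERIV_unique)

lemma has_mat_derivative_cong:
  assumes "eventually (\<lambda>x. F x = G x) (nhds z)"
  shows "has_mat_derivative F D z \<longleftrightarrow> has_mat_derivative G D z"
proof -
  have "((\<lambda>x. F x $ i $ j) has_field_derivative D $ i $ j) (at z) \<longleftrightarrow>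
        ((\<lambda>x. G x $ i $ j) has_field_derivative D $ i $ j) (at z)" for i j
    by (rule DERIV_cong_ev) (use assms in \<open>auto elim: eventually_mono\<close>)
  then show ?thesis by (simp add: has_mat_derivative_def)
qed

text \<open>
  Cramer's rule makes the entries of the inverse differentiable. The derivative then follows by
  differentiating \<open>F F\<^sup>-\<^sup>1 = 1\<close>.
\<close>
lemma has_mat_derivative_inv:
  fixes F :: "complex \<Rightarrow> 'n::finite cmat"
  assumes F: "has_mat_derivative F F' z" and inv: "invertible (F z)"
  shows "has_mat_derivative (\<lambda>x. matrix_inv (F x)) (- (matrix_inv (F z) ** F' ** matrix_inv (F z))) z"
    and "eventually (\<lambda>x. invertible (F x)) (nhds z)"
proof -
  have diff: "(\<lambda>x. F x $ i $ j) field_differentiable (at z)" for i j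
    using F unfolding has_mat_derivative_def field_differentiable_def by blast
  have d: "(\<lambda>x. det (F x)) field_differentiable (at z)"
    by (rule det_differentiable) (rule diff)
  have "isCont (\<lambda>x. det (F x)) z"
    using d field_differentiable_imp_continuous_at by blast
  then have "((\<lambda>x. det (F x)) \<longlongrightarrow> det (F z)) (at z)"
    by (rule isContD)
  then have "eventually (\<lambda>x. det (F x) \<noteq> 0) (at z)"
    by (rule tendsto_imp_eventually_ne) (use inv in \<open>simp add: invertible_det_nz\<close>)
  then have ev: "eventually (\<lambda>x. det (F x) \<noteq> 0) (nhds z)"
    using inv by (simp add: invertible_det_nz eventually_nhds_conv_at)
  then show ev_inv: "eventually (\<lambda>x. invertible (F x)) (nhds z)"
    by (simp add: invertible_det_nz)
  \<comment> \<open>The entries of the inverse according to Cramer's rule.\<close>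
  define R where "R k b x = det (\<chi> i j. if j = k then axis b 1 $ i else F x $ i $ j) / det (F x)" for k b x
  have "(\<lambda>x. (\<chi> i j. if j = k then axis b 1 $ i else F x $ i $ j) $ i $ j) field_differentiable (at z)"
    for k b i j by (cases "j = k") (simp_all add: diff)
  then have "(\<lambda>x. R k b x) field_differentiable (at z)" for k b
    unfolding R_def using inv
    by (intro field_differentiable_divide d det_differentiable) (auto simp: invertible_det_nz)
  then have R: "(R k b has_field_derivative deriv (R k b) z) (at z)" for k b
    by (simp add: DERIV_deriv_iff_field_differentiable)
  have eq: "matrix_inv A = (\<chi> k b. det (\<chi> i j. if j = k then axis b 1 $ i else A $ i $ j) / det A)"
    if "det A \<noteq> 0" for A :: "'n cmat"
  proof -
    have "A *v (matrix_inv A *v axis b 1) = axis b 1" for b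
      using that by (simp add: matrix_vector_mul_assoc matrix_inv_right invertible_det_nz)
    then have "matrix_inv A *v axis b 1
       = (\<chi> k. det (\<chi> i j. if j = k then axis b 1 $ i else A $ i $ j) / det A)" for b
      using cramer[OF that] by blast
    then show ?thesis
      by (simp add: matrix_vector_axis vec_eq_iff)
  qed
  define D :: "'n cmat" where "D = (\<chi> k b. deriv (R k b) z)"
  have "has_mat_derivative (\<lambda>x. \<chi> k b. R k b x) D z"
    using R by (simp add: has_mat_derivative_def D_def)
  moreover have "eventually (\<lambda>x. matrix_inv (F x) = (\<chi> k b. R k b x)) (nhds z)"
    using ev by eventually_elim (simp add: R_def eq)
  ultimately have D: "has_mat_derivative (\<lambda>x. matrix_inv (F x)) D z"
    by (simp add: has_mat_derivative_cong)
  have "has_mat_derivative (\<lambda>x. F x ** matrix_inv (F x)) (F' ** matrix_inv (F z) + F z ** D) z"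
    by (intro has_mat_derivative_mult F D)
  moreover have "has_mat_derivative (\<lambda>x. F x ** matrix_inv (F x)) 0 z"
    by (subst has_mat_derivative_cong[where G = "\<lambda>x. mat 1"])
      (use ev_inv in \<open>auto elim: eventually_mono simp: matrix_inv_right has_mat_derivative_const\<close>)
  ultimately have "F' ** matrix_inv (F z) + F z ** D = 0"
    by (rule has_mat_derivative_unique)
  then have "matrix_inv (F z) ** (F' ** matrix_inv (F z) + F z ** D) = 0"
    by (simp add: matrix_mult_distribs)
  then have "matrix_inv (F z) ** F' ** matrix_inv (F z) + D = 0"
    using inv by (simp add: matrix_mult_distribs matrix_mul_assoc matrix_inv_left)
  then have "D = - (matrix_inv (F z) ** F' ** matrix_inv (F z))"
    by (metis add.commute eq_neg_iff_add_eq_0)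
  with D show "has_mat_derivative (\<lambda>x. matrix_inv (F x)) (- (matrix_inv (F z) ** F' ** matrix_inv (F z))) z"
    by simp
qed

section \<open>Uniqueness of the monodromy\<close>

lemma cis_cancel: "cis \<phi> * (u * cis (- \<phi>)) = u"
  by (simp add: cis_mult mult.left_commute[of "cis \<phi>" u])

lemma branch_cut_iff:
  "z \<in> branch_cut \<phi> p \<longleftrightarrow> Re (cis \<phi> * (z - p)) = 0 \<and> Im (cis \<phi> * (z - p)) \<le> 0"
proof
  assume "z \<in> branch_cut \<phi> p"
  then obtain \<rho> where "0 \<le> \<rho>" and z: "z - p = - \<i> * cis (- \<phi>) * of_real \<rho>"
    by (auto simp: branch_cut_def)
  have c: "cis \<phi> * (z - p) = - \<i> * of_real \<rho>"
    unfolding z using cis_cancel[of \<phi> "- \<i> * of_real \<rho>"] by (simp only: mult_ac)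
  show "Re (cis \<phi> * (z - p)) = 0 \<and> Im (cis \<phi> * (z - p)) \<le> 0"
    unfolding c using \<open>0 \<le> \<rho>\<close> by simp
next
  assume *: "Re (cis \<phi> * (z - p)) = 0 \<and> Im (cis \<phi> * (z - p)) \<le> 0"
  have "z - p = cis (- \<phi>) * (cis \<phi> * (z - p))"
    by (simp add: cis_mult mult.assoc[symmetric])
  also have "cis \<phi> * (z - p) = - \<i> * of_real (- Im (cis \<phi> * (z - p)))"
    using * by (simp add: complex_eq_iff)
  finally have "z = p - \<i> * cis (- \<phi>) * of_real (- Im (cis \<phi> * (z - p)))"
    by (simp add: algebra_simps)
  then show "z \<in> branch_cut \<phi> p"
    unfolding branch_cut_def using * by (metis (mono_tags, lifting) mem_Collect_eq neg_0_le_iff_le)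
qed

lemma closed_branch_cut: "closed (branch_cut \<phi> p)"
proof -
  have "branch_cut \<phi> p = {z. Re (cis \<phi> * (z - p)) = 0} \<inter> {z. Im (cis \<phi> * (z - p)) \<le> 0}"
    by (auto simp: branch_cut_iff)
  moreover have "closed {z. Re (cis \<phi> * (z - p)) = 0}"
    by (intro closed_Collect_eq continuous_intros)
  moreover have "closed {z. Im (cis \<phi> * (z - p)) \<le> 0}"
    by (intro closed_Collect_le continuous_intros)
  ultimately show ?thesis by auto
qed

text \<open>From every point outside of the cuts one can go straight up into a half plane above all poles.\<close>
lemma connected_cut_plane:
  assumes "finite K" shows "connected (- (\<Union>k\<in>K. branch_cut \<phi> (w k)))" (is "connected ?X")
proof -
  obtain b where b: "\<And>k. k \<in> K \<Longrightarrow> Im (cis \<phi> * w k) \<le> b"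
  proof (cases "K = {}")
    case False
    then show ?thesis
      using assms that[of "Max ((\<lambda>k. Im (cis \<phi> * w k)) ` K)"] by auto
  qed (auto intro: that)
  define H where "H = {z. Im (cis \<phi> * z) > b}"
  define ray where "ray z = (\<lambda>\<rho>. z + \<i> * cis (- \<phi>) * of_real \<rho>) ` {0..}" for z :: complex
  have rot: "cis \<phi> * (z + \<i> * cis (- \<phi>) * of_real \<rho> - p) = cis \<phi> * (z - p) + \<i> * of_real \<rho>" for z \<rho> p
    using cis_cancel[of \<phi> "\<i> * of_real \<rho>"] by (simp only: ring_distribs mult_ac) simp
  have H: "connected H"
  proof (rule convex_connected)
    have "H = {z. Complex (sin \<phi>) (cos \<phi>) \<bullet> z > b}"
      by (simp add: H_def inner_complex_def algebra_simps)
    then show "convex H" by (simp only: convex_halfspace_gt)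
  qed
  have HX: "H \<subseteq> ?X"
  proof
    fix z assume "z \<in> H"
    then have "Im (cis \<phi> * (z - w k)) > 0" if "k \<in> K" for k
      using b[OF that] by (simp add: H_def right_diff_distrib)
    then show "z \<in> ?X" by (auto simp: branch_cut_iff) (meson not_le)
  qed
  have ray: "ray z \<subseteq> ?X" if "z \<in> ?X" for z
  proof
    fix y assume "y \<in> ray z"
    then obtain \<rho> where "0 \<le> \<rho>" and y: "y = z + \<i> * cis (- \<phi>) * of_real \<rho>" by (auto simp: ray_def)
    then show "y \<in> ?X"
      using that by (auto simp: branch_cut_iff y rot)
  qed
  have ray_conn: "connected (ray z)" for z
    unfolding ray_def by (intro connected_continuous_image continuous_intros) simp
  have ray_H: "ray z \<inter> H \<noteq> {}" for z
  proof -
    define \<rho> where "\<rho> = max 0 (b - Im (cis \<phi> * z) + 1)"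
    have "Im (cis \<phi> * (z + \<i> * cis (- \<phi>) * of_real \<rho> - 0)) > b"
      unfolding rot by (simp add: \<rho>_def)
    then have "z + \<i> * cis (- \<phi>) * of_real \<rho> \<in> ray z \<inter> H"
      by (auto simp: H_def ray_def \<rho>_def)
    then show ?thesis by blast
  qed
  have "H \<noteq> {}" using ray_H by blast
  have "z \<in> ray z" for z unfolding ray_def by (rule image_eqI[of _ _ 0]) auto
  then have "?X = (\<Union>z\<in>?X. H \<union> ray z)"
    using HX ray by blast
  moreover have "connected (\<Union>z\<in>?X. H \<union> ray z)"
    using ray_H H ray_conn \<open>H \<noteq> {}\<close>
    by (intro connected_Union) (auto intro!: connected_Un)
  ultimately show ?thesis by simp
qed

text \<open>The quotient \<open>Y\<^sup>-\<^sup>1 Z\<close> has derivative zero.\<close>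
lemma fundamental_solutions_proportional:
  assumes "open X" "connected X" and Y: "solves_on X A Y" and Z: "solves_on X A Z"
  shows "\<exists>P. invertible P \<and> (\<forall>z\<in>X. Z z = Y z ** P)"
proof (cases "X = {}")
  case True
  then show ?thesis by (intro exI[of _ "mat 1"]) (auto simp: invertible_def)
next
  case False
  then obtain z0 where "z0 \<in> X" by blast
  define W where "W z = matrix_inv (Y z) ** Z z" for z
  have inv: "invertible (Y z)" "invertible (Z z)" if "z \<in> X" for z
    using that Y Z by (auto simp: solves_on_def)
  have "has_mat_derivative W 0 z" if "z \<in> X" for z
  proof -
    have Y': "has_mat_derivative Y (A z ** Y z) z" and Z': "has_mat_derivative Z (A z ** Z z) z"
      using that Y Z by (auto simp: solves_on_def has_mat_derivative_def)
    have "has_mat_derivative W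
       (- (matrix_inv (Y z) ** (A z ** Y z) ** matrix_inv (Y z)) ** Z z
         + matrix_inv (Y z) ** (A z ** Z z)) z"
      unfolding W_def by (intro has_mat_derivative_mult has_mat_derivative_inv Y' Z' inv that)
    moreover have "matrix_inv (Y z) ** (A z ** Y z) ** matrix_inv (Y z) = matrix_inv (Y z) ** A z"
      using inv[OF that] by (simp add: matrix_mul_assoc[symmetric] matrix_inv_right)
    ultimately show ?thesis by (simp add: matrix_mult_distribs matrix_mul_assoc)
  qed
  then have W': "((\<lambda>z. W z $ i $ j) has_field_derivative 0) (at z)" if "z \<in> X" for z i j
    using that by (simp add: has_mat_derivative_def)
  have "\<exists>c. \<forall>z\<in>X. W z $ i $ j = c" for i j
    using has_field_derivative_0_imp_constant_on[OF W' assms(2,1), of i j]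
    by (simp add: constant_on_def)
  then have "W z = W z0" if "z \<in> X" for z
    using that \<open>z0 \<in> X\<close> unfolding vec_eq_iff by metis
  then have "Z z = Y z ** W z0" if "z \<in> X" for z
    using that inv[OF that] by (metis W_def matrix_mul_assoc matrix_inv_right matrix_mul_lid)
  moreover have "invertible (W z0)"
    unfolding W_def using inv \<open>z0 \<in> X\<close>
    by (intro invertible_mult) (auto simp: invertible_def matrix_inv_left matrix_inv_right
      intro: exI[of _ "Y z0"])
  ultimately show ?thesis by blast
qed

lemma tendsto_matrix_mult_const:
  fixes P :: "'n::finite cmat"
  assumes "(F \<longlongrightarrow> L) net" shows "((\<lambda>z. F z ** P) \<longlongrightarrow> L ** P) net"
  unfolding matrix_matrix_mult_def
  by (intro tendsto_vec_lambda tendsto_intros tendsto_vec_nth assms)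

text \<open>
  Conjugate monodromy matrices come from two fundamental matrices \<open>\<Phi> = \<Psi> P\<close>. It is enough to
  compare their boundary values at one point of each cut. Since the cuts are disjoint, a small
  half disc on either side of that point lies in the cut plane, so that the limits are determined.
\<close>
lemma has_monodromy_unique:
  fixes w :: "'n::{finite,linorder} cvec"
  assumes sep: "\<And>i j. i < j \<Longrightarrow> j \<le> c \<Longrightarrow> Re (cis \<phi> * (w $ i - w $ j)) < 0"
    and m: "has_monodromy \<phi> c w A m" and m': "has_monodromy \<phi> c w A m'"
  shows "\<exists>P. invertible P \<and> (\<forall>k\<le>c. m k = matrix_inv P ** m' k ** P)"
proof -
  let ?X = "- (\<Union>k\<in>{..c}. branch_cut \<phi> (w $ k))"
  let ?A = "\<lambda>z. \<Sum>k\<in>{..c}. mat (1 / (z - w $ k)) ** A k"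
  obtain \<Phi> where \<Phi>: "solves_on ?X ?A \<Phi>" and \<Phi>_jump: "\<And>k p. k \<le> c \<Longrightarrow> p \<in> branch_cut \<phi> (w $ k) - {w $ k} \<Longrightarrow>
     \<exists>L. invertible L \<and> (\<Phi> \<longlongrightarrow> L) (at p within {z. Re (cis \<phi> * (z - p)) < 0}) \<and>
              (\<Phi> \<longlongrightarrow> L ** m k) (at p within {z. Re (cis \<phi> * (z - p)) > 0})"
    using m unfolding has_monodromy_def by blast
  obtain \<Psi> where \<Psi>: "solves_on ?X ?A \<Psi>" and \<Psi>_jump: "\<And>k p. k \<le> c \<Longrightarrow> p \<in> branch_cut \<phi> (w $ k) - {w $ k} \<Longrightarrow>
     \<exists>L. invertible L \<and> (\<Psi> \<longlongrightarrow> L) (at p within {z. Re (cis \<phi> * (z - p)) < 0}) \<and>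
              (\<Psi> \<longlongrightarrow> L ** m' k) (at p within {z. Re (cis \<phi> * (z - p)) > 0})"
    using m' unfolding has_monodromy_def by blast
  have "open ?X" by (intro open_Compl closed_UN) (auto intro: closed_branch_cut)
  moreover have "connected ?X" by (rule connected_cut_plane) simp
  ultimately obtain P where P: "invertible P" and \<Phi>\<Psi>: "\<And>z. z \<in> ?X \<Longrightarrow> \<Phi> z = \<Psi> z ** P"
    using fundamental_solutions_proportional[OF _ _ \<Psi> \<Phi>] by blast
  have "m k = matrix_inv P ** m' k ** P" if k: "k \<le> c" for k
  proof -
    \<comment> \<open>An arbitrary point of the cut other than its end.\<close>
    define p where "p = w $ k - \<i> * cis (- \<phi>) * of_real 1"
    have p: "p \<in> branch_cut \<phi> (w $ k) - {w $ k}"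
      unfolding branch_cut_def p_def by (auto intro!: exI[of _ 1])
    have side: "F \<noteq> bot \<and> eventually (\<lambda>z. \<Phi> z = \<Psi> z ** P) F"
      if F: "F = at p within {z. s * Re (cis \<phi> * (z - p)) > 0}" and s: "\<bar>s\<bar> = 1" for F s
    proof
      have "p islimpt {z. s * Re (cis \<phi> * (z - p)) > 0}"
        unfolding islimpt_approachable
      proof (intro allI impI)
        fix e :: real assume e: "0 < e"
        let ?z = "p + of_real (s * e / 2) * cis (- \<phi>)"
        have "cis \<phi> * (?z - p) = of_real (s * e / 2)"
          using cis_cancel[of \<phi> "of_real (s * e / 2)"] by simp
        then have "s * Re (cis \<phi> * (?z - p)) = s * (s * e / 2)"
          by (simp only: Re_complex_of_real)
        also have "\<dots> = (s * s) * (e / 2)" by simp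
        also have "s * s = 1" using s by (metis abs_mult_self_eq mult_1)
        finally have eq: "s * Re (cis \<phi> * (?z - p)) = 1 * (e / 2)" .
        have "?z \<in> {z. s * Re (cis \<phi> * (z - p)) > 0}"
          unfolding mem_Collect_eq eq using e by simp
        moreover have "dist ?z p = e / 2"
          using e s by (simp add: dist_norm norm_mult)
        ultimately show "\<exists>x'\<in>{z. s * Re (cis \<phi> * (z - p)) > 0}. x' \<noteq> p \<and> dist x' p < e"
          using e by (intro bexI[of _ ?z]) auto
      qed
      then show "F \<noteq> bot" unfolding F by (simp add: trivial_limit_within)
      have other: "eventually (\<lambda>z. z \<notin> branch_cut \<phi> (w $ j)) F" if "j \<le> c" for j
      proof (cases "j = k")
        case True
        have "Re (cis \<phi> * (z - w $ k)) = Re (cis \<phi> * (z - p))" for z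
        proof -
          have "cis \<phi> * (z - w $ k) = cis \<phi> * (z - p) + cis \<phi> * (p - w $ k)"
            by (simp add: algebra_simps)
          then show ?thesis using p by (simp add: branch_cut_iff)
        qed
        then show ?thesis
          unfolding True F eventually_at_filter branch_cut_iff
          by (auto intro!: always_eventually)
      next
        case False
        have "Re (cis \<phi> * (w $ k - w $ j)) \<noteq> 0"
        proof (cases "j < k")
          case True
          then show ?thesis using sep[of j k] k by (simp add: algebra_simps)
        next
          case F: False
          then have "k < j" using False by simp
          then show ?thesis using sep[of k j] \<open>j \<le> c\<close> by (simp add: algebra_simps)
        qed
        moreover have "cis \<phi> * (p - w $ j) = cis \<phi> * (p - w $ k) + cis \<phi> * (w $ k - w $ j)"
          by (simp add: algebra_simps)
        ultimately have "p \<notin> branch_cut \<phi> (w $ j)"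
          using p by (simp add: branch_cut_iff)
        then have "eventually (\<lambda>z. z \<in> - branch_cut \<phi> (w $ j)) (nhds p)"
          using closed_branch_cut by (intro eventually_nhds_in_open) auto
        then show ?thesis
          unfolding F eventually_at_filter by (auto elim: eventually_mono)
      qed
      have "eventually (\<lambda>z. \<forall>j\<in>{..c}. z \<notin> branch_cut \<phi> (w $ j)) F"
        by (intro eventually_ball_finite) (auto intro: other)
      then show "eventually (\<lambda>z. \<Phi> z = \<Psi> z ** P) F"
        by eventually_elim (auto intro: \<Phi>\<Psi>)
    qed
    define lower where "lower = at p within {z. Re (cis \<phi> * (z - p)) < 0}"
    define upper where "upper = at p within {z. Re (cis \<phi> * (z - p)) > 0}"
    have lower: "lower \<noteq> bot \<and> eventually (\<lambda>z. \<Phi> z = \<Psi> z ** P) lower"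
      by (rule side[of _ "- 1"]) (simp_all add: lower_def)
    have upper: "upper \<noteq> bot \<and> eventually (\<lambda>z. \<Phi> z = \<Psi> z ** P) upper"
      by (rule side[of _ 1]) (simp_all add: upper_def)
    obtain L where L: "(\<Phi> \<longlongrightarrow> L) lower" "(\<Phi> \<longlongrightarrow> L ** m k) upper"
      using \<Phi>_jump[OF k p] unfolding lower_def upper_def by blast
    obtain L' where L': "invertible L'" "(\<Psi> \<longlongrightarrow> L') lower" "(\<Psi> \<longlongrightarrow> L' ** m' k) upper"
      using \<Psi>_jump[OF k p] unfolding lower_def upper_def by blast
    have "(\<Phi> \<longlongrightarrow> L' ** P) lower"
      using tendsto_cong[of \<Phi> "\<lambda>z. \<Psi> z ** P" lower] lower tendsto_matrix_mult_const[OF L'(2)] by blast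
    then have "L = L' ** P"
      using tendsto_unique L(1) lower by blast
    have "(\<Phi> \<longlongrightarrow> L' ** m' k ** P) upper"
      using tendsto_cong[of \<Phi> "\<lambda>z. \<Psi> z ** P" upper] upper tendsto_matrix_mult_const[OF L'(3)] by blast
    then have "L ** m k = L' ** m' k ** P"
      using tendsto_unique L(2) upper by blast
    with \<open>L = L' ** P\<close> have "matrix_inv L' ** (L' ** (P ** m k)) = matrix_inv L' ** (L' ** (m' k ** P))"
      by (simp add: matrix_mul_assoc)
    then have "P ** m k = m' k ** P"
      using L'(1) by (simp only: matrix_mul_assoc matrix_inv_left matrix_mul_lid)
    then have "matrix_inv P ** (P ** m k) = matrix_inv P ** (m' k ** P)" by simp
    then show ?thesis
      using P by (simp only: matrix_mul_assoc matrix_inv_left matrix_mul_lid)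
  qed
  with P show ?thesis by blast
qed

section \<open>Polynomial functions of the Stokes matrix\<close>

text \<open>
  Polynomial functions are introduced on all matrices, rather than on the unitriangular ones, in order to
  have partial derivatives with respect to all entries and unrestricted lines.
\<close>
inductive_set pol_fun :: "('n::finite cmat \<Rightarrow> complex) set" where
  pol_const: "(\<lambda>S. a) \<in> pol_fun"
| pol_entry: "(\<lambda>S. S $ i $ j) \<in> pol_fun"
| pol_add: "F \<in> pol_fun \<Longrightarrow> G \<in> pol_fun \<Longrightarrow> (\<lambda>S. F S + G S) \<in> pol_fun"
| pol_mult: "F \<in> pol_fun \<Longrightarrow> G \<in> pol_fun \<Longrightarrow> (\<lambda>S. F S * G S) \<in> pol_fun"

lemma pol_uminus: "F \<in> pol_fun \<Longrightarrow> (\<lambda>S. - F S) \<in> pol_fun"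
  using pol_mult[OF pol_const[of "- 1"]] by fastforce

lemma pol_diff: "F \<in> pol_fun \<Longrightarrow> G \<in> pol_fun \<Longrightarrow> (\<lambda>S. F S - G S) \<in> pol_fun"
  using pol_add[OF _ pol_uminus] by fastforce

lemma pol_sum: "(\<And>i. i \<in> I \<Longrightarrow> F i \<in> pol_fun) \<Longrightarrow> (\<lambda>S. \<Sum>i\<in>I. F i S) \<in> pol_fun"
  by (induction I rule: infinite_finite_induct) (auto intro: pol_fun.intros)

lemma pol_prod: "(\<And>i. i \<in> I \<Longrightarrow> F i \<in> pol_fun) \<Longrightarrow> (\<lambda>S. \<Prod>i\<in>I. F i S) \<in> pol_fun"
  by (induction I rule: infinite_finite_induct) (auto intro: pol_fun.intros)

lemmas pol_intros = pol_fun.intros pol_uminus pol_diff pol_sum pol_prod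

lemma pol_matrix_mult:
  assumes "\<And>i j. (\<lambda>S. A S $ i $ j) \<in> pol_fun" "\<And>i j. (\<lambda>S. B S $ i $ j) \<in> pol_fun"
  shows "(\<lambda>S. (A S ** B S) $ i $ j) \<in> pol_fun"
  unfolding matrix_matrix_mult_def using assms by (auto intro!: pol_intros)

lemma pol_gram: "(\<lambda>S. gram S $ i $ j) \<in> pol_fun"
  unfolding gram_nth by (intro pol_intros)

lemma pol_M_h: "(\<lambda>S. M_h c S $ i $ j) \<in> pol_fun"
proof -
  have "(\<lambda>S. refl_mat S k $ i $ j) \<in> pol_fun" for k and i j :: 'a
    unfolding refl_mat_nth by (cases "i = k") (auto intro!: pol_intros pol_gram)
  then have "(\<lambda>S. refl_prod S ks $ i $ j) \<in> pol_fun" for ks :: "'a list"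
    by (induction ks arbitrary: i j) (auto intro: pol_matrix_mult pol_intros)
  then show ?thesis by (simp add: M_h_refl_prod)
qed

lemma pol_M_h_pow: "(\<lambda>S. mat_pow (M_h c S) k $ i $ j) \<in> pol_fun"
  by (induction k arbitrary: i j) (auto simp: mat_pow_Suc intro: pol_intros pol_matrix_mult pol_M_h)

lemma pol_realized_gen: "(\<lambda>S. realized_gen c S (int k) i j) \<in> pol_fun"
  unfolding realized_gen_def mat_powi_nat by (intro pol_matrix_mult pol_gram pol_M_h_pow)

lemma pol_det_gram: "(\<lambda>S. det (gram S)) \<in> pol_fun"
  unfolding det_def by (intro pol_intros pol_gram)

definition gen_value :: "'n \<Rightarrow> ('n::{finite,linorder}) cmat \<Rightarrow> 'n dvar \<Rightarrow> complex" where
  "gen_value c S = (\<lambda>(k, i, j). realized_gen c S (int k) i j)"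

lemma realization_eq: "realization c a = on_stokes (\<lambda>S. poly_eval (gen_value c S) a)"
  by (simp add: realization_def gen_value_def)

lemma pol_poly_eval: "(\<lambda>S. poly_eval (gen_value c S) a) \<in> pol_fun"
proof -
  have "poly_vars a \<subseteq> poly_vars a" ..
  then show ?thesis
    by (induction rule: poly_vars_induct)
      (auto simp: poly_eval_simps gen_value_def split: prod.splits intro!: pol_intros pol_realized_gen)
qed

text \<open>
  On lines polynomial functions are polynomials in one variable. This reduces statements on zeros
  to the fact that such a polynomial has only finitely many of them.
\<close>
lemma pol_fun_on_line:
  assumes "F \<in> pol_fun" shows "\<exists>q. \<forall>t. F (S + mat t ** D) = poly q t"
  using assms
proof induction
  case (pol_const a)
  show ?case by (rule exI[of _ "[:a:]"]) simp
next
  case (pol_entry i j)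
  show ?case by (rule exI[of _ "[:S $ i $ j, D $ i $ j:]"]) (simp add: mat_mult_nth)
next
  case (pol_add F G)
  then show ?case by (metis poly_add)
next
  case (pol_mult F G)
  then show ?case by (metis poly_mult)
qed

definition dir_deriv :: "'n \<times> 'n \<Rightarrow> ('n::finite cmat \<Rightarrow> complex) \<Rightarrow> 'n cmat \<Rightarrow> complex" where
  "dir_deriv p F S = deriv (\<lambda>z. F (S + mat z ** elem_mat (fst p) (snd p))) 0"

lemma pol_fun_differentiable:
  assumes "F \<in> pol_fun" shows "(\<lambda>z. F (S + mat z ** D)) field_differentiable (at z)"
proof -
  obtain q where "\<And>t. F (S + mat t ** D) = poly q t"
    using pol_fun_on_line[OF assms] by blast
  then have "(\<lambda>t. F (S + mat t ** D)) = poly q" by blast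
  then show ?thesis using poly_DERIV field_differentiable_def by metis
qed

lemma line_0 [simp]: "S + mat 0 ** D = S" for S D :: "'n::finite cmat"
  by (simp add: vec_eq_iff mat_mult_nth)

lemma dir_deriv_const [simp]: "dir_deriv p (\<lambda>S. a) S = 0"
  by (simp add: dir_deriv_def)

lemma dir_deriv_entry: "dir_deriv p (\<lambda>S. S $ i $ j) S = (if p = (i, j) then 1 else 0)"
proof -
  have "((\<lambda>z. S $ i $ j + z * elem_mat (fst p) (snd p) $ i $ j) has_field_derivative
      elem_mat (fst p) (snd p) $ i $ j) (at 0)"
    by (auto intro!: derivative_eq_intros)
  then show ?thesis
    unfolding dir_deriv_def by (auto simp: mat_mult_nth elem_mat_def dest!: DERIV_imp_deriv)
qed

lemma dir_deriv_add:
  "F \<in> pol_fun \<Longrightarrow> G \<in> pol_fun \<Longrightarrow>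
    dir_deriv p (\<lambda>S. F S + G S) S = dir_deriv p F S + dir_deriv p G S"
  by (simp add: dir_deriv_def deriv_add pol_fun_differentiable)

lemma dir_deriv_mult:
  "F \<in> pol_fun \<Longrightarrow> G \<in> pol_fun \<Longrightarrow>
    dir_deriv p (\<lambda>S. F S * G S) S = F S * dir_deriv p G S + G S * dir_deriv p F S"
  by (simp add: dir_deriv_def deriv_mult pol_fun_differentiable)

lemma dir_deriv_diff:
  "F \<in> pol_fun \<Longrightarrow> G \<in> pol_fun \<Longrightarrow>
    dir_deriv p (\<lambda>S. F S - G S) S = dir_deriv p F S - dir_deriv p G S"
  by (simp add: dir_deriv_def deriv_diff pol_fun_differentiable)

lemma dir_deriv_sum:
  "(\<And>i. i \<in> I \<Longrightarrow> F i \<in> pol_fun) \<Longrightarrow>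
    dir_deriv p (\<lambda>S. \<Sum>i\<in>I. F i S) S = (\<Sum>i\<in>I. dir_deriv p (F i) S)"
  by (induction I rule: infinite_finite_induct) (auto simp: dir_deriv_add pol_sum)

lemma pol_dir_deriv: "F \<in> pol_fun \<Longrightarrow> dir_deriv p F \<in> pol_fun"
proof (induction rule: pol_fun.induct)
  case (pol_add F G)
  then show ?case by (subst ext[OF dir_deriv_add]) (auto intro: pol_intros)
next
  case (pol_mult F G)
  then show ?case by (subst ext[OF dir_deriv_mult]) (auto intro: pol_intros)
next
  case (pol_entry i j)
  then show ?case by (subst ext[OF dir_deriv_entry]) (auto intro: pol_intros)
next
  case (pol_const a)
  then show ?case by (subst ext[OF dir_deriv_const]) (auto intro: pol_intros)
qed

section \<open>The Poisson bracket on Stokes matrices\<close>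

definition upper_pairs :: "('n::{finite,linorder} \<times> 'n) set" where
  "upper_pairs = {p. fst p < snd p}"

definition stokes_tensor :: "'n \<times> 'n \<Rightarrow> 'n \<times> 'n \<Rightarrow> ('n::{finite,linorder}) cmat \<Rightarrow> complex" where
  "stokes_tensor p q S = tri_bracket (\<lambda>i j. S $ i $ j) (fst p) (snd p) (fst q) (snd q)"

text \<open>
  Only the entries above the diagonal are coordinates on the unitriangular matrices. The values of
  \<open>stokes_bracket\<close> there depend only on the restrictions of the two functions.
\<close>
definition stokes_bracket ::
  "('n cmat \<Rightarrow> complex) \<Rightarrow> ('n cmat \<Rightarrow> complex) \<Rightarrow> ('n::{finite,linorder}) cmat \<Rightarrow> complex" where
  "stokes_bracket F G S =
     (\<Sum>p\<in>upper_pairs. \<Sum>q\<in>upper_pairs. dir_deriv p F S * dir_deriv q G S * stokes_tensor p q S)"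

lemma stokes_tensor_swap: "stokes_tensor q p S = - stokes_tensor p q S"
  unfolding stokes_tensor_def by (rule tri_bracket_swap)

lemma pol_stokes_tensor: "stokes_tensor p q \<in> pol_fun"
  unfolding stokes_tensor_def[abs_def] tri_bracket_def by (intro pol_intros)

lemma pol_stokes_bracket:
  "F \<in> pol_fun \<Longrightarrow> G \<in> pol_fun \<Longrightarrow> stokes_bracket F G \<in> pol_fun"
  unfolding stokes_bracket_def[abs_def]
  by (intro pol_intros pol_dir_deriv pol_stokes_tensor) (auto simp: pol_dir_deriv pol_stokes_tensor)

lemma stokes_bracket_swap: "stokes_bracket G F S = - stokes_bracket F G S"
proof -
  have "stokes_bracket G F S =
      (\<Sum>q\<in>upper_pairs. \<Sum>p\<in>upper_pairs. dir_deriv p G S * dir_deriv q F S * stokes_tensor p q S)"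
    unfolding stokes_bracket_def by (rule sum.swap)
  also have "\<dots> = (\<Sum>q\<in>upper_pairs. \<Sum>p\<in>upper_pairs. - (dir_deriv q F S * dir_deriv p G S * stokes_tensor q p S))"
  proof (intro sum.cong refl)
    fix p q :: "'a \<times> 'a"
    show "dir_deriv p G S * dir_deriv q F S * stokes_tensor p q S
        = - (dir_deriv q F S * dir_deriv p G S * stokes_tensor q p S)"
      by (subst stokes_tensor_swap) simp
  qed
  finally show ?thesis by (simp add: stokes_bracket_def sum_negf)
qed

lemma stokes_bracket_const [simp]: "stokes_bracket (\<lambda>S. a) G S = 0"
  by (simp add: stokes_bracket_def)

lemma stokes_bracket_add:
  "F \<in> pol_fun \<Longrightarrow> G \<in> pol_fun \<Longrightarrow>
    stokes_bracket (\<lambda>S. F S + G S) H S = stokes_bracket F H S + stokes_bracket G H S"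
  by (simp add: stokes_bracket_def dir_deriv_add ring_distribs sum.distrib)

lemma stokes_bracket_mult:
  "F \<in> pol_fun \<Longrightarrow> G \<in> pol_fun \<Longrightarrow>
    stokes_bracket (\<lambda>S. F S * G S) H S = F S * stokes_bracket G H S + G S * stokes_bracket F H S"
  by (simp add: stokes_bracket_def dir_deriv_mult ring_distribs sum.distrib sum_distrib_left mult_ac)

lemma stokes_bracket_add_right:
  "F \<in> pol_fun \<Longrightarrow> G \<in> pol_fun \<Longrightarrow>
    stokes_bracket H (\<lambda>S. F S + G S) S = stokes_bracket H F S + stokes_bracket H G S"
  by (simp add: stokes_bracket_swap[of H] stokes_bracket_add)

lemma stokes_bracket_mult_right:
  "F \<in> pol_fun \<Longrightarrow> G \<in> pol_fun \<Longrightarrow>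
    stokes_bracket H (\<lambda>S. F S * G S) S = F S * stokes_bracket H G S + G S * stokes_bracket H F S"
  by (simp add: stokes_bracket_swap[of H] stokes_bracket_mult)

lemma stokes_bracket_diff:
  "F \<in> pol_fun \<Longrightarrow> G \<in> pol_fun \<Longrightarrow>
    stokes_bracket (\<lambda>S. F S - G S) H S = stokes_bracket F H S - stokes_bracket G H S"
  by (simp add: stokes_bracket_def dir_deriv_diff left_diff_distrib sum_subtractf)

lemma stokes_bracket_diff_right:
  "F \<in> pol_fun \<Longrightarrow> G \<in> pol_fun \<Longrightarrow>
    stokes_bracket H (\<lambda>S. F S - G S) S = stokes_bracket H F S - stokes_bracket H G S"
  by (simp add: stokes_bracket_swap[of H] stokes_bracket_diff)

lemma stokes_bracket_const_right [simp]: "stokes_bracket G (\<lambda>S. a) S = 0"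
  by (simp add: stokes_bracket_swap[of G])

lemma stokes_bracket_entries:
  "stokes_bracket (\<lambda>S. S $ j $ i) (\<lambda>S. S $ p $ l) S =
     (if j < i \<and> p < l then stokes_tensor (j, i) (p, l) S else 0)"
proof -
  have pick: "(\<Sum>q\<in>upper_pairs. (if q = x then 1 else 0) * f q) = (if x \<in> upper_pairs then f x else (0::complex))"
    for x :: "'a \<times> 'a" and f
  proof -
    have "(\<Sum>q\<in>upper_pairs. (if q = x then 1 else 0) * f q) = (\<Sum>q\<in>upper_pairs. if q = x then f x else 0)"
      by (intro sum.cong) auto
    then show ?thesis by simp
  qed
  have "stokes_bracket (\<lambda>S. S $ j $ i) (\<lambda>S. S $ p $ l) S =
     (\<Sum>a\<in>upper_pairs. (if a = (j, i) then 1 else 0) *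
        (\<Sum>b\<in>upper_pairs. (if b = (p, l) then 1 else 0) * stokes_tensor a b S))"
    unfolding stokes_bracket_def dir_deriv_entry by (simp only: mult.assoc sum_distrib_left)
  then show ?thesis by (simp add: pick) (simp add: upper_pairs_def)
qed

text \<open>
  On unitriangular matrices the quadratic formula also holds for the entries on and below the
  diagonal. This makes it possible to differentiate the formula for the bracket once more, in
  the Jacobi identity, without case distinctions on its right-hand side.
\<close>
lemma stokes_bracket_entries_unitriangular:
  assumes "upper_unitriangular S"
  shows "stokes_bracket (\<lambda>S. S $ j $ i) (\<lambda>S. S $ p $ l) S = stokes_tensor (j, i) (p, l) S"
proof -
  have S: "S $ a $ a = 1" "b < a \<Longrightarrow> S $ a $ b = 0" for a b
    using assms by (auto simp: upper_unitriangular_def)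
  have "stokes_tensor (j, i) (p, l) S = 0" if "i \<le> j" for j i p l
    unfolding stokes_tensor_def using that S by (simp add: tri_bracket_below)
  moreover have "stokes_tensor (j, i) (p, l) S = - stokes_tensor (p, l) (j, i) S" for j i p l
    by (rule stokes_tensor_swap)
  ultimately show ?thesis
    unfolding stokes_bracket_entries by (metis neg_0_equal_iff_equal not_le)
qed

text \<open>
  The Jacobi expression of a skew biderivation is a derivation in each of its arguments, so that it
  vanishes when it vanishes on the entries.
\<close>
definition jacobiator ::
  "('n cmat \<Rightarrow> complex) \<Rightarrow> ('n cmat \<Rightarrow> complex) \<Rightarrow> ('n cmat \<Rightarrow> complex) \<Rightarrow> ('n::{finite,linorder}) cmat \<Rightarrow> complex" where
  "jacobiator F G H S = stokes_bracket F (stokes_bracket G H) S +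
     stokes_bracket G (stokes_bracket H F) S + stokes_bracket H (stokes_bracket F G) S"

lemma jacobiator_cycle: "jacobiator F G H S = jacobiator G H F S"
  by (simp add: jacobiator_def)

lemma jacobiator_add:
  assumes "F \<in> pol_fun" "F' \<in> pol_fun" "G \<in> pol_fun" "H \<in> pol_fun"
  shows "jacobiator (\<lambda>S. F S + F' S) G H S = jacobiator F G H S + jacobiator F' G H S"
proof -
  have 1: "stokes_bracket H (\<lambda>S. F S + F' S) = (\<lambda>S. stokes_bracket H F S + stokes_bracket H F' S)"
    using assms by (simp add: fun_eq_iff stokes_bracket_add_right)
  have 2: "stokes_bracket (\<lambda>S. F S + F' S) G = (\<lambda>S. stokes_bracket F G S + stokes_bracket F' G S)"
    using assms by (simp add: fun_eq_iff stokes_bracket_add)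
  show ?thesis
    unfolding jacobiator_def 1 2 using assms
    by (simp add: stokes_bracket_add stokes_bracket_add_right pol_stokes_bracket)
qed

lemma jacobiator_mult:
  assumes "F \<in> pol_fun" "F' \<in> pol_fun" "G \<in> pol_fun" "H \<in> pol_fun"
  shows "jacobiator (\<lambda>S. F S * F' S) G H S = F S * jacobiator F' G H S + F' S * jacobiator F G H S"
proof -
  have 1: "stokes_bracket H (\<lambda>S. F S * F' S) = (\<lambda>S. F S * stokes_bracket H F' S + F' S * stokes_bracket H F S)"
    using assms by (simp add: fun_eq_iff stokes_bracket_mult_right)
  have 2: "stokes_bracket (\<lambda>S. F S * F' S) G = (\<lambda>S. F S * stokes_bracket F' G S + F' S * stokes_bracket F G S)"
    using assms by (simp add: fun_eq_iff stokes_bracket_mult)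
  have 3: "stokes_bracket F G S = - stokes_bracket G F S" "stokes_bracket F' G S = - stokes_bracket G F' S"
    by (rule stokes_bracket_swap)+
  show ?thesis
    unfolding jacobiator_def 1 2 using assms
    by (simp add: stokes_bracket_mult stokes_bracket_add_right stokes_bracket_mult_right
        pol_stokes_bracket pol_mult 3 algebra_simps)
qed

lemma jacobiator_entries:
  assumes S: "upper_unitriangular S"
  shows "jacobiator (\<lambda>S. S $ a $ b) (\<lambda>S. S $ c $ d) (\<lambda>S. S $ f $ g) S = 0"
proof (cases "a < b \<and> c < d \<and> f < g")
  case True
  let ?s = "\<lambda>i j. S $ i $ j"
  have inner: "stokes_bracket (\<lambda>S. S $ a $ b) (\<lambda>S. S $ j $ i) = stokes_tensor (a, b) (j, i)"
    if "a < b" "j < i" for a b j i :: 'a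
    using that by (simp add: fun_eq_iff stokes_bracket_entries)
  have outer: "stokes_bracket (\<lambda>S. S $ a $ b) (stokes_tensor (j, i) (p, l)) S =
     (ord_sign j p + ord_sign i l) * (tri_bracket ?s a b p i * ?s j l + ?s p i * tri_bracket ?s a b j l)
     + (ord_sign i p + 1) * (tri_bracket ?s a b j p * ?s i l + ?s j p * tri_bracket ?s a b i l)
     + (ord_sign j l - 1) * (tri_bracket ?s a b l i * ?s p j + ?s l i * tri_bracket ?s a b p j)"
    for a b j i p l
  proof -
    have quadratic: "stokes_bracket (\<lambda>S. S $ a $ b)
        (\<lambda>S. k1 * (S $ p $ i * S $ j $ l) + k2 * (S $ j $ p * S $ i $ l) + k3 * (S $ l $ i * S $ p $ j)) S =
      k1 * (tri_bracket ?s a b p i * ?s j l + ?s p i * tri_bracket ?s a b j l)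
      + k2 * (tri_bracket ?s a b j p * ?s i l + ?s j p * tri_bracket ?s a b i l)
      + k3 * (tri_bracket ?s a b l i * ?s p j + ?s l i * tri_bracket ?s a b p j)" for k1 k2 k3
      by (simp add: stokes_bracket_add_right stokes_bracket_mult_right pol_intros
          stokes_bracket_entries_unitriangular[OF S]) (simp add: stokes_tensor_def algebra_simps)
    have "stokes_tensor (j, i) (p, l) = (\<lambda>S. (ord_sign j p + ord_sign i l) * (S $ p $ i * S $ j $ l)
      + (ord_sign i p + 1) * (S $ j $ p * S $ i $ l) + (ord_sign j l - 1) * (S $ l $ i * S $ p $ j))"
      by (simp only: fun_eq_iff stokes_tensor_def tri_bracket_def fst_conv snd_conv mult.assoc simp_thms)
    then show ?thesis by (simp only: quadratic)
  qed
  show ?thesis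
    using tri_bracket_jacobi[where s = ?s and a = a and b = b and c = c and d = d and f = f and g = g] True
    by (simp add: jacobiator_def inner outer)
next
  case False
  have zero: "stokes_bracket (\<lambda>S. S $ j $ i) G = (\<lambda>S. 0)" "stokes_bracket G (\<lambda>S. S $ j $ i) = (\<lambda>S. 0)"
    if "\<not> j < i" for j i G
    using that by (auto simp: fun_eq_iff stokes_bracket_def dir_deriv_entry upper_pairs_def intro!: sum.neutral)
  show ?thesis using False
    by (auto simp: jacobiator_def zero)
qed

text \<open>
  The three arguments are replaced one after the other by entries. The cyclic symmetry of the
  Jacobi expression brings each of them to the first place.
\<close>
lemma jacobiator_zero:
  assumes S: "upper_unitriangular S" and FGH: "F \<in> pol_fun" "G \<in> pol_fun" "H \<in> pol_fun"
  shows "jacobiator F G H S = 0"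
proof -
  have first: "jacobiator F G H S = 0"
    if GH: "G \<in> pol_fun" "H \<in> pol_fun" and e: "\<And>i j. jacobiator (\<lambda>S. S $ i $ j) G H S = 0" and F: "F \<in> pol_fun" for F G H
    using F
  proof induction
    case (pol_const a)
    have "stokes_bracket (\<lambda>S. a) G = (\<lambda>S. 0)" "stokes_bracket H (\<lambda>S. a) = (\<lambda>S. 0)"
      by (simp_all add: fun_eq_iff)
    then show ?case by (simp add: jacobiator_def)
  qed (simp_all add: e GH jacobiator_add jacobiator_mult)
  have "jacobiator (\<lambda>S. S $ i $ j) (\<lambda>S. S $ p $ l) H S = 0" if "H \<in> pol_fun" for i j p l H
    using first[OF pol_entry pol_entry jacobiator_entries[OF S] that]
    by (simp add: jacobiator_cycle[of H])
  then have "jacobiator (\<lambda>S. S $ p $ l) H (\<lambda>S. S $ i $ j) S = 0" if "H \<in> pol_fun" for i j p l H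
    using that by (subst jacobiator_cycle[symmetric])
  then have "jacobiator G H (\<lambda>S. S $ i $ j) S = 0" if "G \<in> pol_fun" "H \<in> pol_fun" for i j G H
    using first[OF that(2) pol_entry _ that(1)] that(2) by blast
  then have "jacobiator (\<lambda>S. S $ i $ j) G H S = 0" if "G \<in> pol_fun" "H \<in> pol_fun" for i j G H
    using that by (subst jacobiator_cycle)
  then show ?thesis using first FGH by blast
qed

section \<open>Restriction to the space of Stokes matrices\<close>

text \<open>This turns the condition on the rank into the nonvanishing of a polynomial.\<close>
lemma full_rank_iff_det: "rank A = CARD('n) \<longleftrightarrow> det A \<noteq> 0" for A :: "'n::finite cmat"
proof -
  have "rank A = CARD('n) \<longleftrightarrow> vec.span (rows A) = UNIV"
    unfolding row_rank_def_gen using vec.dim_eq_full[of "rows A"]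
    by (simp add: vec.dimension_def card_cart_basis)
  also have "\<dots> \<longleftrightarrow> invertible A"
    using matrix_left_invertible_span_rows_gen invertible_left_inverse by metis
  finally show ?thesis by (simp add: invertible_det_nz)
qed

lemma stokes_space_iff: "S \<in> stokes_space \<longleftrightarrow> upper_unitriangular S \<and> det (gram S) \<noteq> 0"
  by (simp add: stokes_space_def full_rank_iff_det gram_def)

lemma upper_unitriangular_line:
  assumes "upper_unitriangular S" "p \<in> upper_pairs"
  shows "upper_unitriangular (S + mat z ** elem_mat (fst p) (snd p))"
  using assms by (auto simp: upper_unitriangular_def upper_pairs_def mat_mult_nth elem_mat_def)

lemma dir_deriv_cong:
  assumes "upper_unitriangular S" "p \<in> upper_pairs"
    and "\<And>S. upper_unitriangular S \<Longrightarrow> F S = G S"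
  shows "dir_deriv p F S = dir_deriv p G S"
  unfolding dir_deriv_def using upper_unitriangular_line[OF assms(1,2)] assms(3) by simp

lemma stokes_bracket_cong:
  assumes "upper_unitriangular S"
    and "\<And>S. upper_unitriangular S \<Longrightarrow> F S = F' S"
    and "\<And>S. upper_unitriangular S \<Longrightarrow> G S = G' S"
  shows "stokes_bracket F G S = stokes_bracket F' G' S"
  unfolding stokes_bracket_def
  by (intro sum.cong refl arg_cong2[where f = "(*)"] dir_deriv_cong assms)

text \<open>
  Within the unitriangular matrices \<open>stokes_space\<close> is open, so that the extension by zero does
  not affect derivatives.
\<close>
lemma dir_deriv_on_stokes:
  assumes "S \<in> stokes_space" "p \<in> upper_pairs"
  shows "dir_deriv p (on_stokes F) S = dir_deriv p F S"
  unfolding dir_deriv_def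
proof (rule deriv_cong_ev)
  let ?L = "\<lambda>z. S + mat z ** elem_mat (fst p) (snd p)"
  have "isCont (\<lambda>z. det (gram (?L z))) 0"
    using pol_fun_differentiable[OF pol_det_gram] field_differentiable_imp_continuous_at by blast
  then have "((\<lambda>z. det (gram (?L z))) \<longlongrightarrow> det (gram S)) (at 0)"
    by (simp add: isCont_def)
  then have "eventually (\<lambda>z. det (gram (?L z)) \<noteq> 0) (at 0)"
    by (rule tendsto_imp_eventually_ne) (use assms in \<open>simp add: stokes_space_iff\<close>)
  then have "eventually (\<lambda>z. det (gram (?L z)) \<noteq> 0) (nhds 0)"
    using assms by (simp add: stokes_space_iff eventually_nhds_conv_at)
  then show "eventually (\<lambda>z. on_stokes F (?L z) = F (?L z)) (nhds 0)"
    by (rule eventually_mono)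
      (use upper_unitriangular_line[of S p] assms in \<open>simp add: on_stokes_def stokes_space_iff\<close>)
qed simp

lemma stokes_bracket_on_stokes:
  "S \<in> stokes_space \<Longrightarrow> stokes_bracket (on_stokes F) (on_stokes G) S = stokes_bracket F G S"
  unfolding stokes_bracket_def
  by (intro sum.cong refl arg_cong2[where f = "(*)"] dir_deriv_on_stokes)

lemma stokes_bracket_poly_eval:
  "stokes_bracket (\<lambda>S. poly_eval (gen_value c S) a) (\<lambda>S. poly_eval (gen_value c S) b) S =
     (\<Sum>x\<in>poly_vars a. \<Sum>y\<in>poly_vars b.
        poly_eval (gen_value c S) (poly_deriv x a) * poly_eval (gen_value c S) (poly_deriv y b) *
        stokes_bracket (\<lambda>S. gen_value c S x) (\<lambda>S. gen_value c S y) S)"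
proof -
  let ?E = "\<lambda>a S. poly_eval (gen_value c S) a"
  have left: "stokes_bracket (?E a) H S =
      (\<Sum>x\<in>poly_vars a. ?E (poly_deriv x a) S * stokes_bracket (\<lambda>S. gen_value c S x) H S)" for H a
    using derivation_chain_rule[of "poly_vars a" a "\<lambda>a. stokes_bracket (?E a) H S" "gen_value c S"]
    by (simp add: finite_poly_vars poly_eval_simps stokes_bracket_add stokes_bracket_mult pol_poly_eval
        pol_poly_eval[of _ "gen_var _", unfolded poly_eval_var])
  have right: "stokes_bracket H (?E b) S =
      (\<Sum>y\<in>poly_vars b. ?E (poly_deriv y b) S * stokes_bracket H (\<lambda>S. gen_value c S y) S)" for H
    unfolding stokes_bracket_swap[of H] left by (simp add: sum_negf)
  show ?thesis
    unfolding left right by (simp add: sum_distrib_left mult_ac)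
qed

text \<open>
  The same expression as \<open>D_bracket_coeff\<close>, for a family of elements of any ring. It is used for
  the values of the generators at a Stokes matrix.
\<close>
definition level_bracket ::
  "('i::linorder \<Rightarrow> 'i \<Rightarrow> nat \<Rightarrow> 'a::comm_ring_1) \<Rightarrow> 'i \<Rightarrow> 'i \<Rightarrow> nat \<Rightarrow> 'i \<Rightarrow> 'i \<Rightarrow> nat \<Rightarrow> 'a" where
  "level_bracket g j i k p l m =
     (let P = (\<lambda>r s. g p i s * g j l r - g p i r * g j l s);
          Q = (\<lambda>r s. g l i r * g p j s - g j p r * g i l s)
      in ord_sign j p * g p i k * g j l m + ord_sign i l * g p i m * g j l k
       + ord_sign i p * g j p k * g i l m + ord_sign j l * g l i k * g p j m
       + (P k m + 2 * (\<Sum>q=1..k. P (k - q) (m + q)))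
       - (Q k m + 2 * (\<Sum>q=1..min k m. Q (k - q) (m - q))))"

section \<open>Double power series\<close>

text \<open>
  Power series in \<open>x = 1/\<lambda>\<close> and \<open>y = 1/\<mu>\<close> are series in \<open>y\<close> whose coefficients are series in
  \<open>x\<close>. This ring is an integral domain, where \<open>y - x\<close>, \<open>1 - x y\<close> and \<open>1 - x\<close> can be cancelled.
\<close>
definition in_x :: "complex fps \<Rightarrow> complex fps fps" where "in_x f = fps_const f"

definition in_y :: "complex fps \<Rightarrow> complex fps fps" where
  "in_y f = Abs_fps (\<lambda>m. fps_const (fps_nth f m))"

definition var_x :: "complex fps fps" where "var_x = fps_const fps_X"

definition var_y :: "complex fps fps" where "var_y = fps_X"

definition double_series :: "(nat \<Rightarrow> nat \<Rightarrow> complex) \<Rightarrow> complex fps fps" where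
  "double_series F = Abs_fps (\<lambda>m. Abs_fps (\<lambda>k. F k m))"

lemma double_series_nth [simp]: "fps_nth (fps_nth (double_series F) m) k = F k m"
  by (simp add: double_series_def)

lemma double_series_eqI:
  "(\<And>k m. fps_nth (fps_nth A m) k = fps_nth (fps_nth B m) k) \<Longrightarrow> A = (B :: complex fps fps)"
  by (simp add: fps_eq_iff)

lemma in_x_nth [simp]: "fps_nth (in_x f) m = (if m = 0 then f else 0)"
  by (simp add: in_x_def)

lemma in_y_nth [simp]: "fps_nth (in_y f) m = fps_const (fps_nth f m)"
  by (simp add: in_y_def)

lemma in_x_add: "in_x (f + g) = in_x f + in_x g" and in_x_mult: "in_x (f * g) = in_x f * in_x g"
  and in_x_zero: "in_x 0 = 0" and in_x_one: "in_x 1 = 1"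
  by (simp_all add: in_x_def fps_const_add[symmetric] fps_const_mult[symmetric] del: fps_const_add fps_const_mult)

lemma in_x_X: "in_x fps_X = var_x"
  by (simp add: in_x_def var_x_def)

lemma in_y_add: "in_y (f + g) = in_y f + in_y g"
  by (simp add: fps_eq_iff)

lemma fps_const_sum: "fps_const (\<Sum>i\<in>A. f i) = (\<Sum>i\<in>A. fps_const (f i :: 'a::comm_ring_1))"
  by (induction A rule: infinite_finite_induct) (auto simp: fps_const_add[symmetric] simp del: fps_const_add)

lemma in_y_mult: "in_y (f * g) = in_y f * in_y g"
  by (rule fps_ext) (simp add: fps_mult_nth fps_const_sum fps_const_mult[symmetric] del: fps_const_mult)

lemma in_y_zero: "in_y 0 = 0" and in_y_one: "in_y 1 = 1" and in_y_X: "in_y fps_X = var_y"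
  by (auto simp: fps_eq_iff var_y_def fps_X_def)

lemma in_x_sum: "in_x (\<Sum>i\<in>A. f i) = (\<Sum>i\<in>A. in_x (f i))"
  by (induction A rule: infinite_finite_induct) (auto simp: in_x_add in_x_zero)

lemma in_y_sum: "in_y (\<Sum>i\<in>A. f i) = (\<Sum>i\<in>A. in_y (f i))"
  by (induction A rule: infinite_finite_induct) (auto simp: in_y_add in_y_zero)

lemma in_y_const: "in_y (fps_const a) = in_x (fps_const a)"
  by (auto simp: fps_eq_iff)

lemma in_x_in_y_nth: "fps_nth (fps_nth (in_x f * in_y g) m) k = fps_nth f k * fps_nth g m"
  by (simp add: in_x_def fps_mult_left_const_nth fps_mult_right_const_nth)

lemma double_series_product: "double_series (\<lambda>k m. a k * b m) = in_x (Abs_fps a) * in_y (Abs_fps b)"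
  by (rule double_series_eqI) (simp add: in_x_in_y_nth)

lemma double_series_add: "double_series (\<lambda>k m. F k m + G k m) = double_series F + double_series G"
  and double_series_diff: "double_series (\<lambda>k m. F k m - G k m) = double_series F - double_series G"
  by (auto intro!: double_series_eqI)

lemma double_series_cmult:
  "double_series (\<lambda>k m. a * F k m) = in_x (fps_const a) * double_series F"
  by (auto intro!: double_series_eqI simp: in_x_def fps_mult_left_const_nth)

lemma var_x_mult_nth: "fps_nth (fps_nth (var_x * A) m) k = (if k = 0 then 0 else fps_nth (fps_nth A m) (k - 1))"
  by (simp add: var_x_def fps_mult_left_const_nth fps_X_mult_nth)

lemma var_y_mult_nth: "fps_nth (fps_nth (var_y * A) m) k = (if m = 0 then 0 else fps_nth (fps_nth A (m - 1)) k)"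
  by (simp add: var_y_def fps_X_mult_nth)

lemma var_nth_0: "fps_nth var_x 0 = fps_X" "fps_nth var_y 0 = 0"
  by (simp_all add: var_x_def var_y_def)

lemma one_minus_var_nonzero: "1 - var_x \<noteq> 0" "1 - var_y \<noteq> 0" "1 - var_x * var_y \<noteq> 0"
proof -
  have "fps_nth (fps_nth (1 - var_x) 0) 0 = 1" "fps_nth (fps_nth (1 - var_y) 0) 0 = 1"
    "fps_nth (fps_nth (1 - var_x * var_y) 0) 0 = 1"
    by (simp_all add: var_x_def var_y_def)
  then show "1 - var_x \<noteq> 0" "1 - var_y \<noteq> 0" "1 - var_x * var_y \<noteq> 0"
    by (metis fps_zero_nth zero_neq_one)+
qed

lemma var_y_minus_var_x_nonzero: "var_y - var_x \<noteq> 0"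
proof -
  have "fps_nth (fps_nth (var_y - var_x) 1) 0 = 1" by (simp add: var_x_def var_y_def)
  then show ?thesis by auto
qed

text \<open>The antidiagonal sum of an antisymmetric family vanishes.\<close>
lemma antisymmetric_antidiagonal_sum:
  fixes P :: "nat \<Rightarrow> nat \<Rightarrow> 'a::field_char_0"
  assumes anti: "\<And>r s. P s r = - P r s"
  shows "P k 0 + 2 * (\<Sum>q=1..k. P (k - q) (0 + q)) = - P k 0"
proof -
  have "(\<Sum>q\<le>k. P (k - q) q) = (\<Sum>q\<le>k. P q (k - q))"
    by (rule sum.reindex_bij_witness[of _ "\<lambda>q. k - q" "\<lambda>q. k - q"]) auto
  also have "\<dots> = - (\<Sum>q\<le>k. P (k - q) q)"
    by (subst anti) (simp add: sum_negf)
  finally have "(\<Sum>q\<le>k. P (k - q) q) = 0" by simp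
  moreover have "(\<Sum>q\<le>k. P (k - q) q) = P k 0 + (\<Sum>q=1..k. P (k - q) q)"
    by (simp add: atMost_atLeast0 sum.atLeast_Suc_atMost)
  ultimately show ?thesis by (simp add: add_eq_0_iff2)
qed

text \<open>The expansion of \<open>(\<lambda>+\<mu>)/(\<lambda>-\<mu>) = (y+x)/(y-x)\<close> in front of a series vanishing for \<open>x = y\<close>.\<close>
lemma antisymmetric_expansion:
  fixes P :: "nat \<Rightarrow> nat \<Rightarrow> complex"
  assumes anti: "\<And>r s. P s r = - P r s"
  shows "(var_y - var_x) * double_series (\<lambda>k m. P k m + 2 * (\<Sum>q=1..k. P (k - q) (m + q)))
       = (var_y + var_x) * double_series P"
proof (rule double_series_eqI)
  fix k m
  define A where "A k m = P k m + 2 * (\<Sum>q=1..k. P (k - q) (m + q))" for k m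
  have step: "A (Suc k) m - A k (Suc m) = P (Suc k) m + P k (Suc m)" for k m
  proof -
    have "(\<Sum>q=1..Suc k. P (Suc k - q) (m + q)) = P k (Suc m) + (\<Sum>q=1..k. P (k - q) (Suc m + q))"
      by (subst sum.atLeast_Suc_atMost) (simp_all only: One_nat_def Suc_le_mono le0 sum.shift_bounds_cl_Suc_ivl diff_Suc_Suc add_Suc_right add_Suc diff_zero add_0_right)
    then show ?thesis by (simp add: A_def algebra_simps)
  qed
  have edge: "A k 0 = - P k 0" for k
    unfolding A_def by (rule antisymmetric_antidiagonal_sum) (rule anti)
  have "A 0 m = P 0 m" for m by (simp add: A_def)
  then show "fps_nth (fps_nth ((var_y - var_x) * double_series (\<lambda>k m. P k m + 2 * (\<Sum>q=1..k. P (k - q) (m + q)))) m) k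
       = fps_nth (fps_nth ((var_y + var_x) * double_series P) m) k"
    unfolding A_def[symmetric]
    using step[of "k - 1" "m - 1"] edge[of "k - 1"]
    by (cases k; cases m) (auto simp: left_diff_distrib distrib_right var_x_mult_nth var_y_mult_nth
          var_nth_0 fps_X_mult_nth algebra_simps)
qed

text \<open>The expansion of \<open>-(1+\<lambda>\<mu>)/(1-\<lambda>\<mu>) = (1+xy)/(1-xy)\<close>.\<close>
lemma diagonal_expansion:
  fixes Q :: "nat \<Rightarrow> nat \<Rightarrow> complex"
  shows "(1 - var_x * var_y) * double_series (\<lambda>k m. Q k m + 2 * (\<Sum>q=1..min k m. Q (k - q) (m - q)))
       = (1 + var_x * var_y) * double_series Q"
proof (rule double_series_eqI)
  fix k m
  define A where "A k m = Q k m + 2 * (\<Sum>q=1..min k m. Q (k - q) (m - q))" for k m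
  have step: "A (Suc k) (Suc m) - A k m = Q (Suc k) (Suc m) + Q k m" for k m
  proof -
    have "(\<Sum>q=1..Suc (min k m). Q (Suc k - q) (Suc m - q)) = Q k m + (\<Sum>q=1..min k m. Q (k - q) (m - q))"
      by (subst sum.atLeast_Suc_atMost) (simp_all only: One_nat_def Suc_le_mono le0 sum.shift_bounds_cl_Suc_ivl diff_Suc_Suc add_Suc_right add_Suc diff_zero add_0_right)
    then show ?thesis by (simp add: A_def algebra_simps)
  qed
  have "A 0 m = Q 0 m" "A k 0 = Q k 0" for k m by (simp_all add: A_def)
  then show "fps_nth (fps_nth ((1 - var_x * var_y) * double_series (\<lambda>k m. Q k m + 2 * (\<Sum>q=1..min k m. Q (k - q) (m - q)))) m) k
       = fps_nth (fps_nth ((1 + var_x * var_y) * double_series Q) m) k"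
    unfolding A_def[symmetric]
    using step[of "k - 1" "m - 1"]
    by (cases k; cases m) (auto simp: left_diff_distrib distrib_right mult.assoc var_x_mult_nth var_y_mult_nth
          var_nth_0 fps_X_mult_nth algebra_simps)
qed

text \<open>The relation of the algebra in terms of generating series, with the denominators cleared.\<close>
definition series_relation ::
  "('i::linorder \<Rightarrow> 'i \<Rightarrow> complex fps) \<Rightarrow> 'i \<Rightarrow> 'i \<Rightarrow> 'i \<Rightarrow> 'i \<Rightarrow> complex fps fps" where
  "series_relation W j i p l =
     ((var_y - var_x) * (1 - var_x * var_y) * ord_sign j p - (var_y + var_x) * (1 - var_x * var_y))
       * in_x (W p i) * in_y (W j l)
   + ((var_y - var_x) * (1 - var_x * var_y) * ord_sign i l + (var_y + var_x) * (1 - var_x * var_y))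
       * in_y (W p i) * in_x (W j l)
   + ((var_y - var_x) * (1 - var_x * var_y) * ord_sign i p + (var_y - var_x) * (1 + var_x * var_y))
       * in_x (W j p) * in_y (W i l)
   + ((var_y - var_x) * (1 - var_x * var_y) * ord_sign j l - (var_y - var_x) * (1 + var_x * var_y))
       * in_x (W l i) * in_y (W p j)"

lemma in_x_ord_sign: "in_x (fps_const (ord_sign a b)) = ord_sign a b"
  by (auto simp: ord_sign_def in_x_def fps_eq_iff)

text \<open>
  Together with the cancellation of \<open>(y - x) (1 - x y)\<close>, this makes \<open>series_relation\<close> equivalent to the relations
  between the coefficients.
\<close>
lemma series_relation_level_bracket:
  "(var_y - var_x) * (1 - var_x * var_y) * double_series (\<lambda>k m. level_bracket g j i k p l m)
     = series_relation (\<lambda>i j. Abs_fps (g i j)) j i p l"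
proof -
  define P where "P r s = g p i s * g j l r - g p i r * g j l s" for r s
  define Q where "Q r s = g l i r * g p j s - g j p r * g i l s" for r s
  let ?g = "\<lambda>i j. Abs_fps (g i j)"
  have P: "double_series P = in_x (?g j l) * in_y (?g p i) - in_x (?g p i) * in_y (?g j l)"
    unfolding double_series_product[symmetric] double_series_diff[symmetric] P_def[abs_def]
    by (simp add: mult.commute)
  have Q: "double_series Q = in_x (?g l i) * in_y (?g p j) - in_x (?g j p) * in_y (?g i l)"
    unfolding double_series_product[symmetric] double_series_diff[symmetric] Q_def[abs_def] ..
  define PP where "PP = double_series (\<lambda>k m. P k m + 2 * (\<Sum>q=1..k. P (k - q) (m + q)))"
  define QQ where "QQ = double_series (\<lambda>k m. Q k m + 2 * (\<Sum>q=1..min k m. Q (k - q) (m - q)))"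
  have PP: "(var_y - var_x) * PP = (var_y + var_x) * double_series P"
    unfolding PP_def by (rule antisymmetric_expansion) (simp add: P_def)
  have QQ: "(1 - var_x * var_y) * QQ = (1 + var_x * var_y) * double_series Q"
    unfolding QQ_def by (rule diagonal_expansion)
  have level: "(\<lambda>k m. level_bracket g j i k p l m) = (\<lambda>k m.
      ord_sign j p * (g p i k * g j l m) + ord_sign i l * (g j l k * g p i m)
      + ord_sign i p * (g j p k * g i l m) + ord_sign j l * (g l i k * g p j m)
      + (P k m + 2 * (\<Sum>q=1..k. P (k - q) (m + q)))
      - (Q k m + 2 * (\<Sum>q=1..min k m. Q (k - q) (m - q))))"
    by (simp add: fun_eq_iff level_bracket_def Let_def P_def Q_def mult_ac)
  have eq: "double_series (\<lambda>k m. level_bracket g j i k p l m) =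
      ord_sign j p * (in_x (?g p i) * in_y (?g j l)) + ord_sign i l * (in_x (?g j l) * in_y (?g p i))
      + ord_sign i p * (in_x (?g j p) * in_y (?g i l)) + ord_sign j l * (in_x (?g l i) * in_y (?g p j))
      + PP - QQ"
    unfolding level double_series_add double_series_diff double_series_cmult double_series_product
      PP_def[unfolded double_series_add] QQ_def[unfolded double_series_add] in_x_ord_sign
    by simp
  have "(var_y - var_x) * (1 - var_x * var_y) * double_series (\<lambda>k m. level_bracket g j i k p l m) =
     (var_y - var_x) * (1 - var_x * var_y) * (
      ord_sign j p * (in_x (?g p i) * in_y (?g j l)) + ord_sign i l * (in_x (?g j l) * in_y (?g p i))
      + ord_sign i p * (in_x (?g j p) * in_y (?g i l)) + ord_sign j l * (in_x (?g l i) * in_y (?g p j)))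
      + (1 - var_x * var_y) * ((var_y - var_x) * PP) - (var_y - var_x) * ((1 - var_x * var_y) * QQ)"
    unfolding eq by (simp add: algebra_simps)
  also have "\<dots> = series_relation ?g j i p l"
    unfolding PP QQ P Q series_relation_def by (simp add: algebra_simps)
  finally show ?thesis .
qed

section \<open>Contraction to the poles that are not clashed\<close>

lemma sum_perm4:
  fixes F :: "'n::finite \<Rightarrow> 'n \<Rightarrow> 'n \<Rightarrow> 'n \<Rightarrow> 'a::comm_monoid_add"
  shows "(\<Sum>a\<in>UNIV. \<Sum>b\<in>UNIV. \<Sum>u\<in>UNIV. \<Sum>v\<in>UNIV. F a b u v) = (\<Sum>a\<in>UNIV. \<Sum>u\<in>UNIV. \<Sum>b\<in>UNIV. \<Sum>v\<in>UNIV. F a b u v)"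
    and "(\<Sum>a\<in>UNIV. \<Sum>b\<in>UNIV. \<Sum>u\<in>UNIV. \<Sum>v\<in>UNIV. F a b u v) = (\<Sum>b\<in>UNIV. \<Sum>v\<in>UNIV. \<Sum>a\<in>UNIV. \<Sum>u\<in>UNIV. F a b u v)"
    and "(\<Sum>a\<in>UNIV. \<Sum>b\<in>UNIV. \<Sum>u\<in>UNIV. \<Sum>v\<in>UNIV. F a b u v) = (\<Sum>b\<in>UNIV. \<Sum>u\<in>UNIV. \<Sum>a\<in>UNIV. \<Sum>v\<in>UNIV. F a b u v)"
    and "(\<Sum>a\<in>UNIV. \<Sum>b\<in>UNIV. \<Sum>u\<in>UNIV. \<Sum>v\<in>UNIV. F a b u v) = (\<Sum>a\<in>UNIV. \<Sum>v\<in>UNIV. \<Sum>b\<in>UNIV. \<Sum>u\<in>UNIV. F a b u v)"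
proof -
  let ?U = "UNIV :: 'n set"
  have swap: "(\<Sum>a\<in>?U. \<Sum>b\<in>?U. G a b) = (\<Sum>b\<in>?U. \<Sum>a\<in>?U. G a b)" for G :: "'n \<Rightarrow> 'n \<Rightarrow> 'a"
    by (rule sum.swap)
  show 1: "(\<Sum>a\<in>?U. \<Sum>b\<in>?U. \<Sum>u\<in>?U. \<Sum>v\<in>?U. F a b u v) = (\<Sum>a\<in>?U. \<Sum>u\<in>?U. \<Sum>b\<in>?U. \<Sum>v\<in>?U. F a b u v)"
    by (intro sum.cong refl swap)
  show 3: "(\<Sum>a\<in>?U. \<Sum>b\<in>?U. \<Sum>u\<in>?U. \<Sum>v\<in>?U. F a b u v) = (\<Sum>b\<in>?U. \<Sum>u\<in>?U. \<Sum>a\<in>?U. \<Sum>v\<in>?U. F a b u v)"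
    by (subst swap) (intro sum.cong refl swap)
  have inner: "(\<Sum>u\<in>?U. \<Sum>v\<in>?U. F a b u v) = (\<Sum>v\<in>?U. \<Sum>u\<in>?U. F a b u v)" for a b
    by (rule swap)
  show 4: "(\<Sum>a\<in>?U. \<Sum>b\<in>?U. \<Sum>u\<in>?U. \<Sum>v\<in>?U. F a b u v) = (\<Sum>a\<in>?U. \<Sum>v\<in>?U. \<Sum>b\<in>?U. \<Sum>u\<in>?U. F a b u v)"
    unfolding inner by (intro sum.cong refl swap)
  show "(\<Sum>a\<in>?U. \<Sum>b\<in>?U. \<Sum>u\<in>?U. \<Sum>v\<in>?U. F a b u v) = (\<Sum>b\<in>?U. \<Sum>v\<in>?U. \<Sum>a\<in>?U. \<Sum>u\<in>?U. F a b u v)"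
    unfolding inner by (subst swap) (intro sum.cong refl swap)
qed

lemma sum_pick2:
  fixes \<phi> :: "'n::{finite,linorder} \<Rightarrow> 'n \<Rightarrow> 'a::comm_ring_1"
  assumes "\<And>a. a < c \<Longrightarrow> X a = (if a = x then 1 else 0)" "\<And>a. a < c \<Longrightarrow> Y a = (if a = y then 1 else 0)"
    and "x < c" "y < c"
  shows "(\<Sum>a\<in>UNIV. \<Sum>b\<in>UNIV. \<phi> a b * X a * Y b * ((if a < c then A a else 0) * (if b < c then B b else 0)))
     = \<phi> x y * (A x * B y)"
proof -
  have "(\<Sum>a\<in>UNIV. \<Sum>b\<in>UNIV. \<phi> a b * X a * Y b * ((if a < c then A a else 0) * (if b < c then B b else 0)))
     = (\<Sum>a\<in>UNIV. \<Sum>b\<in>UNIV. if b = y then (if a = x then \<phi> x y * (A x * B y) else 0) else 0)"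
    using assms by (intro sum.cong refl) auto
  then show ?thesis by simp
qed

text \<open>
  The relation for the pencil has terms of two types: coefficients that depend on two row
  indices, two column indices, or one of each. Multiplication by \<open>Y\<close> from the left and \<open>Z\<close> from
  the right completes each \<open>N\<close> to \<open>Y N\<close> or \<open>N Z\<close>, whose remaining index must be below \<open>c\<close>. There \<open>Y\<close>
  and \<open>Z\<close> are unit matrices, so that the remaining sums reduce to one term, with the coefficient of
  the free indices.
\<close>
lemma contraction:
  fixes Y1 Y2 Z1 Z2 N1 N2 W1 W2 f g h k :: "'n::{finite,linorder} \<Rightarrow> 'n \<Rightarrow> 'a::comm_ring_1"
  assumes ind: "j < c" "i < c" "p < c" "l < c"
    and YN: "\<And>i b. i < c \<Longrightarrow> (\<Sum>a\<in>UNIV. Y1 i a * N1 a b) = (if b < c then W1 i b else 0)"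
      "\<And>i b. i < c \<Longrightarrow> (\<Sum>a\<in>UNIV. Y2 i a * N2 a b) = (if b < c then W2 i b else 0)"
    and NZ: "\<And>a i. i < c \<Longrightarrow> (\<Sum>b\<in>UNIV. N1 a b * Z1 b i) = (if a < c then W1 a i else 0)"
      "\<And>a i. i < c \<Longrightarrow> (\<Sum>b\<in>UNIV. N2 a b * Z2 b i) = (if a < c then W2 a i else 0)"
    and Y: "\<And>i a. i < c \<Longrightarrow> a < c \<Longrightarrow> Y1 i a = (if a = i then 1 else 0)"
      "\<And>i a. i < c \<Longrightarrow> a < c \<Longrightarrow> Y2 i a = (if a = i then 1 else 0)"
    and Z: "\<And>i a. i < c \<Longrightarrow> a < c \<Longrightarrow> Z1 a i = (if a = i then 1 else 0)"
      "\<And>i a. i < c \<Longrightarrow> a < c \<Longrightarrow> Z2 a i = (if a = i then 1 else 0)"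
  shows "(\<Sum>a\<in>UNIV. \<Sum>b\<in>UNIV. \<Sum>u\<in>UNIV. \<Sum>v\<in>UNIV. Y1 j a * Z1 b i * Y2 p u * Z2 v l *
        (f a u * N1 u b * N2 a v + g b v * N2 u b * N1 a v + h b u * N1 a u * N2 b v + k a v * N1 v b * N2 u a))
     = f j p * W1 p i * W2 j l + g i l * W2 p i * W1 j l + h i p * W1 j p * W2 i l + k j l * W1 l i * W2 p j"
proof -
  let ?U = "UNIV :: 'n set"
  have t1: "(\<Sum>a\<in>?U. \<Sum>b\<in>?U. \<Sum>u\<in>?U. \<Sum>v\<in>?U. Y1 j a * Z1 b i * Y2 p u * Z2 v l * (f a u * N1 u b * N2 a v))
      = f j p * (W2 j l * W1 p i)"
  proof -
    have "(\<Sum>a\<in>?U. \<Sum>b\<in>?U. \<Sum>u\<in>?U. \<Sum>v\<in>?U. Y1 j a * Z1 b i * Y2 p u * Z2 v l * (f a u * N1 u b * N2 a v))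
      = (\<Sum>a\<in>?U. \<Sum>u\<in>?U. f a u * Y1 j a * Y2 p u * ((\<Sum>v\<in>?U. N2 a v * Z2 v l) * (\<Sum>b\<in>?U. N1 u b * Z1 b i)))"
      by (subst sum_perm4(1), intro sum.cong refl)
        (simp add: sum_distrib_left sum_distrib_right mult_ac, rule sum.swap)
    also have "\<dots> = f j p * (W2 j l * W1 p i)"
      unfolding NZ(1)[OF ind(2)] NZ(2)[OF ind(4)] by (rule sum_pick2) (use Y ind in auto)
    finally show ?thesis .
  qed
  have t2: "(\<Sum>a\<in>?U. \<Sum>b\<in>?U. \<Sum>u\<in>?U. \<Sum>v\<in>?U. Y1 j a * Z1 b i * Y2 p u * Z2 v l * (g b v * N2 u b * N1 a v))
      = g i l * (W2 p i * W1 j l)"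
  proof -
    have "(\<Sum>a\<in>?U. \<Sum>b\<in>?U. \<Sum>u\<in>?U. \<Sum>v\<in>?U. Y1 j a * Z1 b i * Y2 p u * Z2 v l * (g b v * N2 u b * N1 a v))
      = (\<Sum>b\<in>?U. \<Sum>v\<in>?U. g b v * Z1 b i * Z2 v l * ((\<Sum>u\<in>?U. Y2 p u * N2 u b) * (\<Sum>a\<in>?U. Y1 j a * N1 a v)))"
      by (subst sum_perm4(2), intro sum.cong refl)
        (simp add: sum_distrib_left sum_distrib_right mult_ac, rule sum.swap)
    also have "\<dots> = g i l * (W2 p i * W1 j l)"
      unfolding YN(1)[OF ind(1)] YN(2)[OF ind(3)] by (rule sum_pick2) (use Z ind in auto)
    finally show ?thesis .
  qed
  have t3: "(\<Sum>a\<in>?U. \<Sum>b\<in>?U. \<Sum>u\<in>?U. \<Sum>v\<in>?U. Y1 j a * Z1 b i * Y2 p u * Z2 v l * (h b u * N1 a u * N2 b v))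
      = h i p * (W2 i l * W1 j p)"
  proof -
    have "(\<Sum>a\<in>?U. \<Sum>b\<in>?U. \<Sum>u\<in>?U. \<Sum>v\<in>?U. Y1 j a * Z1 b i * Y2 p u * Z2 v l * (h b u * N1 a u * N2 b v))
      = (\<Sum>b\<in>?U. \<Sum>u\<in>?U. h b u * Z1 b i * Y2 p u * ((\<Sum>v\<in>?U. N2 b v * Z2 v l) * (\<Sum>a\<in>?U. Y1 j a * N1 a u)))"
      by (subst sum_perm4(3), intro sum.cong refl)
        (simp add: sum_distrib_left sum_distrib_right mult_ac, rule sum.swap)
    also have "\<dots> = h i p * (W2 i l * W1 j p)"
      unfolding YN(1)[OF ind(1)] NZ(2)[OF ind(4)] by (rule sum_pick2) (use Y Z ind in auto)
    finally show ?thesis .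
  qed
  have t4: "(\<Sum>a\<in>?U. \<Sum>b\<in>?U. \<Sum>u\<in>?U. \<Sum>v\<in>?U. Y1 j a * Z1 b i * Y2 p u * Z2 v l * (k a v * N1 v b * N2 u a))
      = k j l * (W2 p j * W1 l i)"
  proof -
    have "(\<Sum>a\<in>?U. \<Sum>b\<in>?U. \<Sum>u\<in>?U. \<Sum>v\<in>?U. Y1 j a * Z1 b i * Y2 p u * Z2 v l * (k a v * N1 v b * N2 u a))
      = (\<Sum>a\<in>?U. \<Sum>v\<in>?U. k a v * Y1 j a * Z2 v l * ((\<Sum>u\<in>?U. Y2 p u * N2 u a) * (\<Sum>b\<in>?U. N1 v b * Z1 b i)))"
      by (subst sum_perm4(4), intro sum.cong refl)
        (simp add: sum_distrib_left sum_distrib_right mult_ac, rule sum.swap)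
    also have "\<dots> = k j l * (W2 p j * W1 l i)"
      unfolding NZ(1)[OF ind(2)] YN(2)[OF ind(3)] by (rule sum_pick2) (use Y Z ind in auto)
    finally show ?thesis .
  qed
  have "(\<Sum>a\<in>UNIV. \<Sum>b\<in>UNIV. \<Sum>u\<in>UNIV. \<Sum>v\<in>UNIV. Y1 j a * Z1 b i * Y2 p u * Z2 v l *
        (f a u * N1 u b * N2 a v + g b v * N2 u b * N1 a v + h b u * N1 a u * N2 b v + k a v * N1 v b * N2 u a))
      = f j p * (W2 j l * W1 p i) + g i l * (W2 p i * W1 j l) + h i p * (W2 i l * W1 j p) + k j l * (W2 p j * W1 l i)"
    unfolding t1[symmetric] t2[symmetric] t3[symmetric] t4[symmetric]
    by (simp only: distrib_left sum.distrib)
  then show ?thesis by (simp add: mult_ac)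
qed

section \<open>Brackets of the generators\<close>

text \<open>
  The coefficients of \<open>\<G> i j\<close> on unitriangular matrices: the constant term \<open>\<A>\<^sup>(\<^sup>0\<^sup>)\<close> is the matrix
  \<open>S\<close> itself.
\<close>
definition stokes_coeff :: "'n \<Rightarrow> ('n::{finite,linorder}) cmat \<Rightarrow> 'n \<Rightarrow> 'n \<Rightarrow> nat \<Rightarrow> complex" where
  "stokes_coeff c S i j k = (if k = 0 then S $ i $ j else realized_gen c S (int k) i j)"

lemma pol_stokes_coeff: "(\<lambda>S. stokes_coeff c S i j k) \<in> pol_fun"
  unfolding stokes_coeff_def by (cases "k = 0") (auto intro: pol_intros pol_realized_gen)

text \<open>The coefficients of \<open>W = (1 - x) \<G>\<close>.\<close>
definition coeff_step :: "'n \<Rightarrow> nat \<Rightarrow> 'n \<Rightarrow> 'n \<Rightarrow> ('n::{finite,linorder}) cmat \<Rightarrow> complex" where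
  "coeff_step c k i j S = stokes_coeff c S i j k - (if k = 0 then 0 else stokes_coeff c S i j (k - 1))"

text \<open>The coefficients of \<open>Z = (1 - x) (\<Sum>k. x\<^sup>k M\<^sub>h\<^sup>k)\<close>.\<close>
definition right_factor :: "'n \<Rightarrow> nat \<Rightarrow> 'n cmat \<Rightarrow> ('n::{finite,linorder}) cmat" where
  "right_factor c k S =
     (if k = 0 then mat 1 else mat_pow (M_h c S) k - mat_pow (M_h c S) (k - 1))"

abbreviation contragredient :: "'n \<Rightarrow> 'n cmat \<Rightarrow> ('n::{finite,linorder}) cmat" where
  "contragredient c S \<equiv> transpose (matrix_inv (M_h c S))"

text \<open>
  The coefficients of \<open>Y = (1 - x) (\<Sum>k. x\<^sup>k L\<^sup>k\<^sup>+\<^sup>1)\<close>, where \<open>L = (M\<^sub>h\<^sup>-\<^sup>1)\<^sup>T\<close>. As \<open>G M\<^sub>h = L G\<close>, it plays for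
  rows the role that \<open>Z\<close> plays for columns.
\<close>
definition left_factor :: "'n \<Rightarrow> nat \<Rightarrow> 'n cmat \<Rightarrow> ('n::{finite,linorder}) cmat" where
  "left_factor c k S = (let L = contragredient c S
     in if k = 0 then L else mat_pow L (Suc k) - mat_pow L k)"

lemma row_zero_mult: "A $ r = 0 \<Longrightarrow> (A ** B) $ r = 0"
  for A B :: "'n::finite cmat"
  by (simp add: row_matrix_mult)

lemma column_zero_mult:
  fixes A B :: "'n::finite cmat"
  assumes "\<And>a. A $ a $ b = 0" shows "(B ** A) $ i $ b = 0"
  using assms by (simp add: matrix_matrix_mult_def)

lemma M_h_minus_1_row: "r < c \<Longrightarrow> (M_h c S - mat 1) $ r = 0"
  by (simp add: vec_eq_iff M_h_row)

lemma right_factor_row: "r < c \<Longrightarrow> right_factor c k S $ r $ i = (if k = 0 \<and> r = i then 1 else 0)"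
proof (cases k)
  case (Suc k')
  assume r: "r < c"
  have "right_factor c k S = (M_h c S - mat 1) ** mat_pow (M_h c S) k'"
    by (simp add: right_factor_def Suc mat_pow_Suc matrix_mult_distribs)
  then show ?thesis
    using row_zero_mult[OF M_h_minus_1_row[OF r]] Suc by (simp add: vec_eq_iff)
qed (simp add: right_factor_def mat_def)

context
  fixes c :: "'n::{finite,linorder}" and S :: "'n cmat"
  assumes S: "upper_unitriangular S"
begin

lemma stokes_lower_block: "i < c \<Longrightarrow> c \<le> r \<Longrightarrow> S $ r $ i = 0"
  using S by (simp add: upper_unitriangular_def)

lemma stokes_M_h_row:
  assumes "c \<le> r" shows "(S ** M_h c S + transpose S) $ r = 0"
  using M_h_stokes[OF S assms] by (simp add: vec_eq_iff transpose_def)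

lemma transpose_stokes_M_h_row:
  assumes "r < c" shows "(transpose S ** (M_h c S - mat 1)) $ r = 0"
proof -
  have "S $ b $ r * (M_h c S - mat 1) $ b $ i = 0" for b i
    using stokes_lower_block[OF assms, of b] M_h_minus_1_row[of b c S] by (cases "b < c") (auto simp: vec_eq_iff)
  then show ?thesis
    unfolding vec_eq_iff matrix_matrix_mult_def transpose_def by (auto intro!: sum.neutral)
qed

lemma gram_M_h: "gram S ** M_h c S = contragredient c S ** gram S"
proof -
  have "contragredient c S ** (transpose (M_h c S) ** gram S ** M_h c S) = transpose (M_h c S ** matrix_inv (M_h c S)) ** gram S ** M_h c S"
    by (simp add: matrix_transpose_mul matrix_mul_assoc)
  then show ?thesis
    by (simp add: M_h_orthogonal[OF S] matrix_inv_right[OF M_h_invertible[OF S]])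
qed

lemma gram_M_h_pow: "gram S ** mat_pow (M_h c S) k = mat_pow (contragredient c S) k ** gram S"
proof (induction k)
  case (Suc k)
  have "gram S ** mat_pow (M_h c S) (Suc k) = (gram S ** mat_pow (M_h c S) k) ** M_h c S"
    by (simp add: mat_pow_Suc_right matrix_mul_assoc)
  also have "\<dots> = mat_pow (contragredient c S) k ** (gram S ** M_h c S)"
    by (simp add: Suc matrix_mul_assoc)
  also have "\<dots> = mat_pow (contragredient c S) (Suc k) ** gram S"
    by (simp add: gram_M_h mat_pow_Suc_right matrix_mul_assoc)
  finally show ?case .
qed simp

lemma contragredient_minus_1_column:
  assumes "a < c" shows "(contragredient c S - mat 1) $ i $ a = 0"
proof -
  have "((M_h c S - mat 1) ** matrix_inv (M_h c S)) $ a = 0"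
    by (rule row_zero_mult) (rule M_h_minus_1_row[OF assms])
  then have "(mat 1 - matrix_inv (M_h c S)) $ a = 0"
    by (simp add: matrix_mult_distribs matrix_inv_right[OF M_h_invertible[OF S]])
  then show ?thesis
    by (auto simp: vec_eq_iff transpose_def mat_def split: if_splits)
qed

lemma contragredient_stokes_column:
  assumes "c \<le> b" shows "(contragredient c S ** S + transpose S) $ i $ b = 0"
proof -
  have "((S ** M_h c S + transpose S) ** matrix_inv (M_h c S)) $ b = 0"
    by (rule row_zero_mult) (rule stokes_M_h_row[OF assms])
  then have "(S + transpose S ** matrix_inv (M_h c S)) $ b = 0"
    by (simp add: matrix_mult_distribs matrix_mul_assoc[symmetric] matrix_inv_right[OF M_h_invertible[OF S]])
  moreover have "contragredient c S ** S = transpose (transpose S ** matrix_inv (M_h c S))"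
    by (simp add: matrix_transpose_mul)
  ultimately show ?thesis
    by (simp add: vec_eq_iff transpose_def add.commute)
qed

lemma contragredient_minus_1_stokes_column:
  assumes "b < c" shows "((contragredient c S - mat 1) ** S) $ i $ b = 0"
proof -
  have "(contragredient c S - mat 1) $ i $ a * S $ a $ b = 0" for a
    using stokes_lower_block[OF assms, of a] contragredient_minus_1_column[of a i] by (cases "a < c") auto
  then show ?thesis
    unfolding matrix_matrix_mult_def by (auto intro!: sum.neutral)
qed

lemma left_factor_column:
  assumes "a < c" shows "left_factor c k S $ i $ a = (if k = 0 \<and> a = i then 1 else 0)"
proof (cases k)
  case 0
  then show ?thesis using contragredient_minus_1_column[OF assms, of i] by (simp add: left_factor_def mat_def eq_commute[of a i])
next
  case (Suc k')
  have "left_factor c k S = mat_pow (contragredient c S) k ** (contragredient c S - mat 1)"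
    by (simp add: left_factor_def Suc Let_def mat_pow_Suc_right[of _ "Suc k'"] matrix_mult_distribs)
  then show ?thesis
    using column_zero_mult[OF contragredient_minus_1_column[OF assms]] Suc by simp
qed

text \<open>
  The coefficients of \<open>N Z = W\<close> in a column \<open>i < c\<close>. In the rows \<open>r \<ge> c\<close> they vanish, since the rows of
  \<open>S M\<^sub>h\<close> are those of \<open>- S\<^sup>T\<close>. In the rows \<open>r < c\<close> one has \<open>S\<^sup>T M\<^sub>h = S\<^sup>T\<close>, so that the differences
  of powers in \<open>Z\<close> are annihilated by \<open>S\<^sup>T\<close> and \<open>S\<close> may be replaced by \<open>G\<close>.
\<close>
lemma pencil_right_factor:
  assumes i: "i < c"
  shows "(S ** right_factor c k S) $ r $ i + (if k = 0 then 0 else (transpose S ** right_factor c (k - 1) S) $ r $ i)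
    = (if r < c then coeff_step c k r i S else 0)"
proof -
  consider "k = 0" | "k = 1" | q where "k = Suc (Suc q)"
    by (metis One_nat_def not0_implies_Suc)
  then show ?thesis
  proof cases
    case 1
    then show ?thesis using stokes_lower_block[OF i, of r]
      by (auto simp: right_factor_def coeff_step_def stokes_coeff_def)
  next
    case 2
    have "mat_pow (M_h c S) 1 = M_h c S" by (simp add: mat_pow_def)
    then have k: "right_factor c k S = M_h c S - mat 1" "right_factor c (k - 1) S = mat 1"
      using 2 by (simp_all add: right_factor_def)
    show ?thesis
    proof (cases "r < c")
      case True
      then have "(transpose S ** M_h c S) $ r $ i = transpose S $ r $ i"
        using transpose_stokes_M_h_row[OF True] by (simp add: matrix_mult_distribs vec_eq_iff)
      moreover have "mat_powi (M_h c S) 1 = M_h c S" using \<open>mat_pow (M_h c S) 1 = M_h c S\<close> by (simp add: mat_powi_def)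
      ultimately show ?thesis
        using True 2 k unfolding coeff_step_def stokes_coeff_def realized_gen_def
        by (simp add: gram_def matrix_mult_distribs)
    next
      case False
      then show ?thesis
        using stokes_M_h_row[of r] stokes_lower_block[OF i, of r] 2 unfolding k
        by (simp add: matrix_mult_distribs vec_eq_iff)
    qed
  next
    case 3
    have z: "right_factor c k S = mat_pow (M_h c S) (Suc q) ** (M_h c S - mat 1)"
      "right_factor c k S = (M_h c S - mat 1) ** mat_pow (M_h c S) (Suc q)"
      "right_factor c (k - 1) S = mat_pow (M_h c S) q ** (M_h c S - mat 1)"
      "right_factor c (k - 1) S = (M_h c S - mat 1) ** mat_pow (M_h c S) q"
      by (simp_all add: 3 right_factor_def matrix_mult_distribs mat_pow_Suc_right[of "M_h c S" "Suc q"] mat_pow_Suc_right[of "M_h c S" q])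
        (simp_all add: mat_pow_Suc[symmetric] mat_pow_Suc_right[symmetric])
    show ?thesis
    proof (cases "r < c")
      case True
      have "(transpose S ** right_factor c (k - 1) S) $ r = 0" "(transpose S ** right_factor c k S) $ r = 0"
        unfolding z(2,4) matrix_mul_assoc
        by (intro row_zero_mult transpose_stokes_M_h_row[OF True])+
      moreover have "gram S ** right_factor c k S = S ** right_factor c k S + transpose S ** right_factor c k S"
        by (simp add: gram_def matrix_mult_distribs)
      moreover have "coeff_step c k r i S = (gram S ** right_factor c k S) $ r $ i"
        by (simp add: 3 coeff_step_def stokes_coeff_def realized_gen_def mat_powi_nat right_factor_def matrix_mult_distribs
            del: of_nat_Suc)
      ultimately show ?thesis using True 3 by (simp add: vec_eq_iff)
    next
      case False
      have "((S ** M_h c S + transpose S) ** (mat_pow (M_h c S) q ** (M_h c S - mat 1))) $ r = 0"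
        using False by (intro row_zero_mult stokes_M_h_row) simp
      moreover have "(S ** M_h c S + transpose S) ** (mat_pow (M_h c S) q ** (M_h c S - mat 1))
        = S ** right_factor c k S + transpose S ** right_factor c (k - 1) S"
        unfolding z(1,3) by (simp add: matrix_mult_distribs mat_pow_Suc matrix_mul_assoc)
      ultimately show ?thesis using False 3 by (simp add: vec_eq_iff)
    qed
  qed
qed

text \<open>
  The coefficients of \<open>Y N = W\<close> in a row \<open>i < c\<close>, by the corresponding properties of the columns of \<open>L\<close>.
\<close>
lemma pencil_left_factor:
  assumes i: "i < c"
  shows "(left_factor c k S ** S) $ i $ b + (if k = 0 then 0 else (left_factor c (k - 1) S ** transpose S) $ i $ b)
    = (if b < c then coeff_step c k i b S else 0)"
proof -
  have LS: "(contragredient c S ** S) $ i $ b = (if b < c then S $ i $ b else 0)"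
    using contragredient_minus_1_stokes_column[of b i] contragredient_stokes_column[of b i] stokes_lower_block[OF i, of b]
    by (auto simp: matrix_mult_distribs transpose_def)
  consider "k = 0" | "k = 1" | q where "k = Suc (Suc q)"
    by (metis One_nat_def not0_implies_Suc)
  then show ?thesis
  proof cases
    case 1
    then show ?thesis using LS
      by (auto simp: left_factor_def coeff_step_def stokes_coeff_def)
  next
    case 2
    have pow1: "mat_pow A 1 = A" for A :: "'n cmat" by (simp add: mat_pow_def)
    then have "mat_pow (contragredient c S) (Suc (Suc 0)) = contragredient c S ** contragredient c S" by (simp add: mat_pow_Suc)
    then have k: "left_factor c k S = contragredient c S ** (contragredient c S - mat 1)" "left_factor c (k - 1) S = contragredient c S"
      using 2 pow1[of "contragredient c S"] by (simp_all add: left_factor_def Let_def matrix_mult_distribs)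
    show ?thesis
    proof (cases "b < c")
      case True
      have "(contragredient c S ** ((contragredient c S - mat 1) ** S)) $ i $ b = 0"
        by (rule column_zero_mult) (rule contragredient_minus_1_stokes_column[OF True])
      moreover have "mat_powi (M_h c S) 1 = M_h c S" using pow1 by (simp add: mat_powi_def)
      then have "coeff_step c k i b S = (contragredient c S ** gram S) $ i $ b - S $ i $ b"
        using 2 by (simp add: coeff_step_def stokes_coeff_def realized_gen_def gram_M_h)
      ultimately show ?thesis
        using True 2 k LS by (simp add: gram_def matrix_mult_distribs matrix_mul_assoc)
    next
      case False
      have "(contragredient c S ** (contragredient c S ** S + transpose S)) $ i $ b = 0"
        by (rule column_zero_mult, rule contragredient_stokes_column) (use False in simp)
      then show ?thesis
        using False 2 k LS by (simp add: matrix_mult_distribs matrix_mul_assoc)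
    qed
  next
    case 3
    have comm: "(contragredient c S - mat 1) ** contragredient c S = contragredient c S ** (contragredient c S - mat 1)"
      by (simp add: matrix_mult_distribs)
    have z: "left_factor c k S = mat_pow (contragredient c S) k ** (contragredient c S - mat 1)"
      "left_factor c (k - 1) S = mat_pow (contragredient c S) (Suc q) ** (contragredient c S - mat 1)"
      by (simp_all add: 3 left_factor_def Let_def matrix_mult_distribs mat_pow_Suc_right[of "contragredient c S" "Suc q"] mat_pow_Suc_right[of "contragredient c S" "Suc (Suc q)"])
    have z': "left_factor c k S = mat_pow (contragredient c S) (Suc q) ** (contragredient c S - mat 1) ** contragredient c S"
      using z(1) by (simp only: 3 mat_pow_Suc_right[of "contragredient c S" "Suc q"] matrix_mul_assoc[symmetric] comm)
    show ?thesis
    proof (cases "b < c")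
      case True
      have "(mat_pow (contragredient c S) k ** ((contragredient c S - mat 1) ** S)) $ i $ b = 0" "(mat_pow (contragredient c S) (Suc q) ** ((contragredient c S - mat 1) ** S)) $ i $ b = 0"
        by (rule column_zero_mult, rule contragredient_minus_1_stokes_column[OF True])+
      moreover have "coeff_step c k i b S
          = (mat_pow (contragredient c S) (Suc q) ** (contragredient c S - mat 1) ** gram S) $ i $ b"
        by (simp add: 3 coeff_step_def stokes_coeff_def realized_gen_def mat_powi_nat gram_M_h_pow z
            matrix_mult_distribs mat_pow_Suc_right[of "contragredient c S" "Suc q"] del: of_nat_Suc)
      ultimately show ?thesis
        using True 3 unfolding z gram_def by (simp add: matrix_mult_distribs matrix_mul_assoc)
    next
      case False
      have "(mat_pow (contragredient c S) (Suc q) ** (contragredient c S - mat 1) ** (contragredient c S ** S + transpose S)) $ i $ b = 0"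
        by (rule column_zero_mult, rule contragredient_stokes_column) (use False in simp)
      moreover have "mat_pow (contragredient c S) (Suc q) ** (contragredient c S - mat 1) ** (contragredient c S ** S + transpose S)
        = left_factor c k S ** S + left_factor c (k - 1) S ** transpose S"
        unfolding z' z(2) by (simp only: matrix_mult_distribs(2) matrix_mul_assoc)
      ultimately show ?thesis using False 3 by simp
    qed
  qed
qed
end

lemma pol_right_factor: "(\<lambda>S. right_factor c k S $ b $ i) \<in> pol_fun"
  unfolding right_factor_def by (cases "k = 0") (auto intro!: pol_intros pol_M_h_pow)

definition pencil :: "('n::finite \<Rightarrow> 'n \<Rightarrow> complex) \<Rightarrow> 'n \<Rightarrow> 'n \<Rightarrow> complex fps" where
  "pencil s a b = fps_const (s a b) + fps_X * fps_const (s b a)"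

lemma pencil_nth_0: "fps_nth (pencil s a b) 0 = s a b"
  by (simp add: pencil_def)

lemma pencil_mult_nth:
  "fps_nth (pencil s a b * A) k = s a b * fps_nth A k + (if k = 0 then 0 else s b a * fps_nth A (k - 1))"
  "fps_nth (A * pencil s a b) k = fps_nth A k * s a b + (if k = 0 then 0 else fps_nth A (k - 1) * s b a)"
proof -
  show 1: "fps_nth (pencil s a b * A) k = s a b * fps_nth A k + (if k = 0 then 0 else s b a * fps_nth A (k - 1))" for A
    by (simp add: pencil_def distrib_right mult.assoc fps_X_mult_nth fps_mult_left_const_nth)
  show "fps_nth (A * pencil s a b) k = fps_nth A k * s a b + (if k = 0 then 0 else fps_nth A (k - 1) * s b a)"
    using 1[of A] by (simp add: mult.commute)
qed

lemma pencil_contractions: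
  assumes S: "upper_unitriangular S" and i: "i < c"
  shows "(\<Sum>b\<in>UNIV. pencil (\<lambda>a b. S $ a $ b) r b * Abs_fps (\<lambda>k. right_factor c k S $ b $ i))
      = (if r < c then Abs_fps (\<lambda>k. coeff_step c k r i S) else 0)"
    and "(\<Sum>a\<in>UNIV. Abs_fps (\<lambda>k. left_factor c k S $ i $ a) * pencil (\<lambda>a b. S $ a $ b) a b)
      = (if b < c then Abs_fps (\<lambda>k. coeff_step c k i b S) else 0)"
proof -
  show "(\<Sum>b\<in>UNIV. pencil (\<lambda>a b. S $ a $ b) r b * Abs_fps (\<lambda>k. right_factor c k S $ b $ i))
      = (if r < c then Abs_fps (\<lambda>k. coeff_step c k r i S) else 0)"
  proof (rule fps_ext)
    fix k
    show "fps_nth (\<Sum>b\<in>UNIV. pencil (\<lambda>a b. S $ a $ b) r b * Abs_fps (\<lambda>k. right_factor c k S $ b $ i)) k = fps_nth (if r < c then Abs_fps (\<lambda>k. coeff_step c k r i S) else 0) k"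
      using pencil_right_factor[OF S i, of k r]
      by (cases "k = 0") (simp_all add: fps_sum_nth pencil_mult_nth pencil_nth_0 sum.distrib matrix_matrix_mult_def transpose_def
        if_distrib[of "\<lambda>f. fps_nth f _"] cong: if_cong)
  qed
  show "(\<Sum>a\<in>UNIV. Abs_fps (\<lambda>k. left_factor c k S $ i $ a) * pencil (\<lambda>a b. S $ a $ b) a b)
      = (if b < c then Abs_fps (\<lambda>k. coeff_step c k i b S) else 0)"
  proof (rule fps_ext)
    fix k
    show "fps_nth (\<Sum>a\<in>UNIV. Abs_fps (\<lambda>k. left_factor c k S $ i $ a) * pencil (\<lambda>a b. S $ a $ b) a b) k = fps_nth (if b < c then Abs_fps (\<lambda>k. coeff_step c k i b S) else 0) k"
      using pencil_left_factor[OF S i, of k b]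
      by (cases "k = 0") (simp_all add: fps_sum_nth pencil_mult_nth pencil_nth_0 sum.distrib matrix_matrix_mult_def transpose_def
        if_distrib[of "\<lambda>f. fps_nth f _"] cong: if_cong)
  qed
qed

text \<open>
  \<open>dW = Y dN Z\<close> in the rows and columns below \<open>c\<close>: differentiate \<open>N Z = W\<close> and multiply by \<open>Y\<close>
  from the left. The term \<open>Y N dZ\<close> vanishes, because \<open>Y N\<close> lives in the columns below \<open>c\<close>,
  whereas the rows of \<open>Z\<close> below \<open>c\<close> are constant.
\<close>
lemma dir_deriv_coeff_step:
  assumes S: "upper_unitriangular S" and p: "p \<in> upper_pairs" and ij: "i < c" "j < c"
  shows "Abs_fps (\<lambda>k. dir_deriv p (coeff_step c k j i) S) =
     (\<Sum>a\<in>UNIV. \<Sum>b\<in>UNIV. Abs_fps (\<lambda>k. left_factor c k S $ j $ a) *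
        pencil (\<lambda>a b. dir_deriv p (\<lambda>S. S $ a $ b) S) a b * Abs_fps (\<lambda>k. right_factor c k S $ b $ i))"
proof -
  let ?N = "pencil (\<lambda>a b. S $ a $ b)" and ?dN = "pencil (\<lambda>a b. dir_deriv p (\<lambda>S. S $ a $ b) S)"
  let ?Z = "\<lambda>b. Abs_fps (\<lambda>k. right_factor c k S $ b $ i)"
  let ?dZ = "\<lambda>b. Abs_fps (\<lambda>k. dir_deriv p (\<lambda>S. right_factor c k S $ b $ i) S)"
  let ?Y = "\<lambda>a. Abs_fps (\<lambda>k. left_factor c k S $ j $ a)"
  let ?dW = "\<lambda>r. Abs_fps (\<lambda>k. dir_deriv p (coeff_step c k r i) S)"
  have dZ: "?dZ b = 0" if "b < c" for b
    using that by (simp add: fps_eq_iff right_factor_row)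
  have NZ: "(\<Sum>b\<in>UNIV. ?N r b * ?dZ b + ?dN r b * ?Z b) = (if r < c then ?dW r else 0)" for r
  proof (rule fps_ext)
    fix k
    define F where "F S = (\<Sum>b\<in>UNIV. S $ r $ b * right_factor c k S $ b $ i)
      + (if k = 0 then 0 else \<Sum>b\<in>UNIV. S $ b $ r * right_factor c (k - 1) S $ b $ i)" for S :: "'a cmat"
    have "F S = (if r < c then coeff_step c k r i S else 0)" if "upper_unitriangular S" for S
      using pencil_right_factor[OF that ij(1), of k r]
      by (simp add: F_def matrix_matrix_mult_def transpose_def cong: if_cong)
    then have "dir_deriv p F S = dir_deriv p (\<lambda>S. if r < c then coeff_step c k r i S else 0) S"
      by (rule dir_deriv_cong[OF S p])
    also have "dir_deriv p F S = (\<Sum>b\<in>UNIV. S $ r $ b * dir_deriv p (\<lambda>S. right_factor c k S $ b $ i) S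
          + right_factor c k S $ b $ i * dir_deriv p (\<lambda>S. S $ r $ b) S)
        + (if k = 0 then 0 else \<Sum>b\<in>UNIV. S $ b $ r * dir_deriv p (\<lambda>S. right_factor c (k - 1) S $ b $ i) S
          + right_factor c (k - 1) S $ b $ i * dir_deriv p (\<lambda>S. S $ b $ r) S)"
      unfolding F_def[abs_def]
      by (cases "k = 0") (simp_all add: dir_deriv_add dir_deriv_sum dir_deriv_mult pol_intros pol_right_factor)
    also have "\<dots> = fps_nth (\<Sum>b\<in>UNIV. ?N r b * ?dZ b + ?dN r b * ?Z b) k"
      by (simp add: fps_sum_nth pencil_mult_nth pencil_nth_0 sum.distrib mult_ac)
    finally show "fps_nth (\<Sum>b\<in>UNIV. ?N r b * ?dZ b + ?dN r b * ?Z b) k = fps_nth (if r < c then ?dW r else 0) k"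
      by (cases "r < c") auto
  qed
  have "(\<Sum>a\<in>UNIV. ?Y a * (\<Sum>b\<in>UNIV. ?N a b * ?dZ b + ?dN a b * ?Z b)) = (\<Sum>a\<in>UNIV. if a = j then ?dW j else 0)"
    unfolding NZ
  proof (intro sum.cong refl)
    fix a
    have "?Y a = (if a = j then 1 else 0)" if "a < c"
      using left_factor_column[OF S that] by (auto simp: fps_eq_iff)
    then show "?Y a * (if a < c then ?dW a else 0) = (if a = j then ?dW j else 0)"
      using ij by auto
  qed
  also have "\<dots> = ?dW j" by simp
  finally have "?dW j = (\<Sum>a\<in>UNIV. ?Y a * (\<Sum>b\<in>UNIV. ?N a b * ?dZ b)) + (\<Sum>a\<in>UNIV. ?Y a * (\<Sum>b\<in>UNIV. ?dN a b * ?Z b))"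
    by (simp add: sum.distrib distrib_left)
  also have "(\<Sum>a\<in>UNIV. ?Y a * (\<Sum>b\<in>UNIV. ?N a b * ?dZ b)) = (\<Sum>b\<in>UNIV. (\<Sum>a\<in>UNIV. ?Y a * ?N a b) * ?dZ b)"
    by (simp add: sum_distrib_left sum_distrib_right mult.assoc) (rule sum.swap)
  also have "\<dots> = 0"
    unfolding pencil_contractions(2)[OF S ij(2)] by (intro sum.neutral) (auto simp: dZ)
  finally show ?thesis by (simp add: sum_distrib_left mult.assoc)
qed

lemma tri_bracket_hom:
  fixes \<kappa> :: "'a::comm_ring_1 \<Rightarrow> 'b::comm_ring_1"
  assumes "\<And>a b. \<kappa> (a + b) = \<kappa> a + \<kappa> b" "\<And>a b. \<kappa> (a * b) = \<kappa> a * \<kappa> b" "\<kappa> 0 = 0" "\<kappa> 1 = 1"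
  shows "\<kappa> (tri_bracket s j i p l) = tri_bracket (\<lambda>a b. \<kappa> (s a b)) j i p l"
proof -
  have minus: "\<kappa> (- a) = - \<kappa> a" for a
    using assms(1)[of a "- a"] assms(3) by (simp add: eq_neg_iff_add_eq_0 add.commute)
  have "\<kappa> (ord_sign a b) = ord_sign a b" for a b :: "'c"
    by (auto simp: ord_sign_def assms minus)
  then show ?thesis
    using assms(1)[of "ord_sign j l" "- 1"]
    by (simp add: tri_bracket_def assms minus)
qed

definition scalar :: "complex \<Rightarrow> complex fps fps" where "scalar a = in_x (fps_const a)"

lemma scalar_hom: "scalar (a + b) = scalar a + scalar b" "scalar (a * b) = scalar a * scalar b"
    "scalar 0 = 0" "scalar 1 = 1"
  by (simp_all add: scalar_def in_x_add[symmetric] in_x_mult[symmetric] in_x_zero in_x_one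
      fps_const_add[symmetric] fps_const_mult[symmetric] del: fps_const_add fps_const_mult)

lemma scalar_sum: "scalar (\<Sum>i\<in>A. f i) = (\<Sum>i\<in>A. scalar (f i))"
  by (induction A rule: infinite_finite_induct) (auto simp: scalar_hom)

lemma in_x_pencil: "in_x (pencil s a b) = scalar (s a b) + var_x * scalar (s b a)"
  and in_y_pencil: "in_y (pencil s a b) = scalar (s a b) + var_y * scalar (s b a)"
  by (simp_all add: pencil_def scalar_def in_x_add in_x_mult in_x_X in_y_add in_y_mult in_y_X in_y_const)

text \<open>
  The bracket of \<open>N(x)\<^sub>a\<^sub>b\<close> and \<open>N(y)\<^sub>u\<^sub>v\<close>, written as the double sum over the coordinates that
  arises from the products \<open>Y dN Z\<close>.
\<close>
lemma pencil_bracket: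
  assumes S: "upper_unitriangular S"
  defines "s \<equiv> \<lambda>a b. scalar (S $ a $ b)"
  shows "(\<Sum>p\<in>upper_pairs. \<Sum>q\<in>upper_pairs.
        in_x (pencil (\<lambda>a b. dir_deriv p (\<lambda>S. S $ a $ b) S) a b) *
        in_y (pencil (\<lambda>a b. dir_deriv q (\<lambda>S. S $ a $ b) S) u v) * scalar (stokes_tensor p q S))
     = tri_bracket s a b u v + var_x * tri_bracket s b a u v
       + var_y * tri_bracket s a b v u + var_x * var_y * tri_bracket s b a v u"
proof -
  define T where "T a b u v = (\<Sum>p\<in>upper_pairs. \<Sum>q\<in>upper_pairs.
        scalar (dir_deriv p (\<lambda>S. S $ a $ b) S) * scalar (dir_deriv q (\<lambda>S. S $ u $ v) S) * scalar (stokes_tensor p q S))"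
    for a b u v
  have "T a b u v = tri_bracket s a b u v" for a b u v
  proof -
    have "T a b u v = scalar (stokes_bracket (\<lambda>S. S $ a $ b) (\<lambda>S. S $ u $ v) S)"
      by (simp add: T_def stokes_bracket_def scalar_sum scalar_hom)
    also have "\<dots> = tri_bracket s a b u v"
      unfolding stokes_bracket_entries_unitriangular[OF S] stokes_tensor_def s_def
      by (simp add: tri_bracket_hom[of scalar] scalar_hom)
    finally show ?thesis .
  qed
  moreover have "(\<Sum>p\<in>upper_pairs. \<Sum>q\<in>upper_pairs.
        in_x (pencil (\<lambda>a b. dir_deriv p (\<lambda>S. S $ a $ b) S) a b) *
        in_y (pencil (\<lambda>a b. dir_deriv q (\<lambda>S. S $ a $ b) S) u v) * scalar (stokes_tensor p q S))
     = T a b u v + var_x * T b a u v + var_y * T a b v u + var_x * var_y * T b a v u"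
    unfolding in_x_pencil in_y_pencil T_def
    by (simp add: distrib_left distrib_right sum.distrib sum_distrib_left mult_ac)
  ultimately show ?thesis by simp
qed

text \<open>
  By \<open>dW = Y dN Z\<close> the bracket of two entries of \<open>W\<close> is a contraction of the brackets of
  the entries of \<open>N\<close>, to which the relation for the pencil applies.
\<close>
lemma coeff_step_series_relation:
  assumes S: "upper_unitriangular S" and ind: "j < c" "i < c" "p < c" "l < c"
  shows "(var_y - var_x) * (1 - var_x * var_y) *
      double_series (\<lambda>k m. stokes_bracket (coeff_step c k j i) (coeff_step c m p l) S)
     = series_relation (\<lambda>a b. Abs_fps (\<lambda>k. coeff_step c k a b S)) j i p l"
proof -
  let ?\<Delta> = "(var_y - var_x) * (1 - var_x * var_y)"
  let ?Y = "\<lambda>i a. Abs_fps (\<lambda>k. left_factor c k S $ i $ a)"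
  let ?Z = "\<lambda>b i. Abs_fps (\<lambda>k. right_factor c k S $ b $ i)"
  let ?N = "pencil (\<lambda>a b. S $ a $ b)"
  let ?dN = "\<lambda>p. pencil (\<lambda>a b. dir_deriv p (\<lambda>S. S $ a $ b) S)"
  let ?W = "\<lambda>a b. Abs_fps (\<lambda>k. coeff_step c k a b S)"
  let ?dW = "\<lambda>p a b. Abs_fps (\<lambda>k. dir_deriv p (coeff_step c k a b) S)"
  let ?s = "\<lambda>a b. scalar (S $ a $ b)"
  let ?B = "\<lambda>a b u v. tri_bracket ?s a b u v + var_x * tri_bracket ?s b a u v
       + var_y * tri_bracket ?s a b v u + var_x * var_y * tri_bracket ?s b a v u"
  have "double_series (\<lambda>k m. stokes_bracket (coeff_step c k j i) (coeff_step c m p l) S)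
     = (\<Sum>u\<in>upper_pairs. \<Sum>v\<in>upper_pairs. in_x (?dW u j i) * in_y (?dW v p l) * scalar (stokes_tensor u v S))"
  proof (rule double_series_eqI)
    fix k m
    have "fps_nth (fps_nth (in_x f * in_y g * scalar t) m) k = fps_nth f k * fps_nth g m * t" for f g t
      unfolding scalar_def in_y_const[symmetric] mult.assoc in_y_mult[symmetric] in_x_in_y_nth
      by (simp add: fps_mult_right_const_nth)
    then show "fps_nth (fps_nth (double_series (\<lambda>k m. stokes_bracket (coeff_step c k j i) (coeff_step c m p l) S)) m) k
       = fps_nth (fps_nth (\<Sum>u\<in>upper_pairs. \<Sum>v\<in>upper_pairs.
           in_x (?dW u j i) * in_y (?dW v p l) * scalar (stokes_tensor u v S)) m) k"
      by (simp add: stokes_bracket_def fps_sum_nth)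
  qed
  also have "\<dots> = (\<Sum>u\<in>upper_pairs. \<Sum>v\<in>upper_pairs.
      (\<Sum>a\<in>UNIV. \<Sum>b\<in>UNIV. in_x (?Y j a) * in_x (?dN u a b) * in_x (?Z b i)) *
      (\<Sum>a\<in>UNIV. \<Sum>b\<in>UNIV. in_y (?Y p a) * in_y (?dN v a b) * in_y (?Z b l)) * scalar (stokes_tensor u v S))"
    by (intro sum.cong refl)
      (simp only: dir_deriv_coeff_step[OF S _ ind(2,1)] dir_deriv_coeff_step[OF S _ ind(4,3)]
        in_x_sum in_y_sum in_x_mult in_y_mult)
  also have "\<dots> = (\<Sum>a\<in>UNIV. \<Sum>b\<in>UNIV. \<Sum>a'\<in>UNIV. \<Sum>b'\<in>UNIV.
      in_x (?Y j a) * in_x (?Z b i) * in_y (?Y p a') * in_y (?Z b' l) *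
      (\<Sum>u\<in>upper_pairs. \<Sum>v\<in>upper_pairs. in_x (?dN u a b) * in_y (?dN v a' b') * scalar (stokes_tensor u v S)))"
  proof -
    have eq: "(\<Sum>u\<in>U. \<Sum>v\<in>U. (\<Sum>x\<in>X. f x * g u x) * (\<Sum>y\<in>X. f' y * g' v y) * t u v)
       = (\<Sum>x\<in>X. \<Sum>y\<in>X. f x * f' y * (\<Sum>u\<in>U. \<Sum>v\<in>U. g u x * g' v y * t u v))"
      for U :: "('n \<times> 'n) set" and X :: "('n \<times> 'n) set" and f f' :: "'n \<times> 'n \<Rightarrow> complex fps fps"
        and g g' :: "'n \<times> 'n \<Rightarrow> 'n \<times> 'n \<Rightarrow> complex fps fps" and t
    proof -
      have "(\<Sum>u\<in>U. \<Sum>v\<in>U. (\<Sum>x\<in>X. f x * g u x) * (\<Sum>y\<in>X. f' y * g' v y) * t u v)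
        = (\<Sum>u\<in>U. \<Sum>v\<in>U. \<Sum>x\<in>X. \<Sum>y\<in>X. f x * f' y * (g u x * g' v y * t u v))"
        unfolding sum_product unfolding sum_distrib_right by (intro sum.cong refl) (simp only: mult_ac)
      also have "\<dots> = (\<Sum>u\<in>U. \<Sum>x\<in>X. \<Sum>y\<in>X. \<Sum>v\<in>U. f x * f' y * (g u x * g' v y * t u v))"
        by (rule sum.cong[OF refl], rule trans[OF sum.swap], rule sum.cong[OF refl], rule sum.swap)
      also have "\<dots> = (\<Sum>x\<in>X. \<Sum>y\<in>X. \<Sum>u\<in>U. \<Sum>v\<in>U. f x * f' y * (g u x * g' v y * t u v))"
        by (rule trans[OF sum.swap], rule sum.cong[OF refl], rule sum.swap)
      finally show ?thesis by (simp add: sum_distrib_left)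
    qed
    have pairs: "(\<Sum>a\<in>UNIV. \<Sum>b\<in>UNIV. F a b) = (\<Sum>x\<in>UNIV. F (fst x) (snd x))"
      for F :: "'n \<Rightarrow> 'n \<Rightarrow> complex fps fps"
      by (simp add: sum.cartesian_product case_prod_unfold)
    have rearr: "in_x (?Y j a) * in_x (?dN u a b) * in_x (?Z b i) = (in_x (?Y j a) * in_x (?Z b i)) * in_x (?dN u a b)"
      "in_y (?Y p a) * in_y (?dN v a b) * in_y (?Z b l) = (in_y (?Y p a) * in_y (?Z b l)) * in_y (?dN v a b)" for a b u v
      by (simp_all only: mult_ac)
    show ?thesis
      unfolding rearr pairs eq by (simp only: mult.assoc)
  qed
  also have "\<dots> = (\<Sum>a\<in>UNIV. \<Sum>b\<in>UNIV. \<Sum>u\<in>UNIV. \<Sum>v\<in>UNIV.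
      in_x (?Y j a) * in_x (?Z b i) * in_y (?Y p u) * in_y (?Z v l) * ?B a b u v)"
    unfolding pencil_bracket[OF S] ..
  finally have "?\<Delta> * double_series (\<lambda>k m. stokes_bracket (coeff_step c k j i) (coeff_step c m p l) S)
     = (\<Sum>a\<in>UNIV. \<Sum>b\<in>UNIV. \<Sum>u\<in>UNIV. \<Sum>v\<in>UNIV.
      in_x (?Y j a) * in_x (?Z b i) * in_y (?Y p u) * in_y (?Z v l) * (?\<Delta> * ?B a b u v))"
    by (simp only: sum_distrib_left mult.left_commute[of ?\<Delta>])
  also have "\<dots> = (\<Sum>a\<in>UNIV. \<Sum>b\<in>UNIV. \<Sum>u\<in>UNIV. \<Sum>v\<in>UNIV.
      in_x (?Y j a) * in_x (?Z b i) * in_y (?Y p u) * in_y (?Z v l) *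
     ((?\<Delta> * ord_sign a u - (var_y + var_x) * (1 - var_x * var_y)) * in_x (?N u b) * in_y (?N a v)
    + (?\<Delta> * ord_sign b v + (var_y + var_x) * (1 - var_x * var_y)) * in_y (?N u b) * in_x (?N a v)
    + (?\<Delta> * ord_sign b u + (var_y - var_x) * (1 + var_x * var_y)) * in_x (?N a u) * in_y (?N b v)
    + (?\<Delta> * ord_sign a v - (var_y - var_x) * (1 + var_x * var_y)) * in_x (?N v b) * in_y (?N u a)))"
    unfolding tri_bracket_pencil in_x_pencil in_y_pencil ..
  also have "\<dots> = series_relation ?W j i p l"
    unfolding series_relation_def
  proof (rule contraction[OF ind])
    fix i b assume i: "i < c"
    show "(\<Sum>a\<in>UNIV. in_x (?Y i a) * in_x (?N a b)) = (if b < c then in_x (?W i b) else 0)"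
      "(\<Sum>a\<in>UNIV. in_y (?Y i a) * in_y (?N a b)) = (if b < c then in_y (?W i b) else 0)"
      unfolding in_x_mult[symmetric] in_x_sum[symmetric] in_y_mult[symmetric] in_y_sum[symmetric]
        pencil_contractions(2)[OF S i]
      by (simp_all add: in_x_zero in_y_zero)
    show "(\<Sum>a\<in>UNIV. in_x (?N b a) * in_x (?Z a i)) = (if b < c then in_x (?W b i) else 0)"
      "(\<Sum>a\<in>UNIV. in_y (?N b a) * in_y (?Z a i)) = (if b < c then in_y (?W b i) else 0)"
      unfolding in_x_mult[symmetric] in_x_sum[symmetric] in_y_mult[symmetric] in_y_sum[symmetric]
        pencil_contractions(1)[OF S i]
      by (simp_all add: in_x_zero in_y_zero)
    assume b: "b < c"
    have "?Y i b = (if b = i then 1 else 0)" "?Z b i = (if b = i then 1 else 0)"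
      using left_factor_column[OF S b, of _ i] right_factor_row[OF b, of _ S i] by (auto simp: fps_eq_iff)
    then show "in_x (?Y i b) = (if b = i then 1 else 0)" "in_y (?Y i b) = (if b = i then 1 else 0)"
      "in_x (?Z b i) = (if b = i then 1 else 0)" "in_y (?Z b i) = (if b = i then 1 else 0)"
      by (simp_all add: in_x_zero in_x_one in_y_zero in_y_one)
  qed
  finally show ?thesis .
qed

text \<open>
  The relation for \<open>W = (1 - x) \<G>\<close> differs from that for \<open>\<G>\<close> by the factor \<open>(1 - x) (1 - y)\<close>,
  which is not a zero divisor.
\<close>
lemma stokes_bracket_generators:
  assumes S: "upper_unitriangular S" and ind: "j < c" "i < c" "p < c" "l < c"
  shows "stokes_bracket (\<lambda>S. stokes_coeff c S j i k) (\<lambda>S. stokes_coeff c S p l m) S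
     = level_bracket (stokes_coeff c S) j i k p l m"
proof -
  define C where "C k m = stokes_bracket (\<lambda>S. stokes_coeff c S j i k) (\<lambda>S. stokes_coeff c S p l m) S" for k m
  let ?g = "\<lambda>a b. Abs_fps (stokes_coeff c S a b)"
  let ?\<Delta> = "(var_y - var_x) * (1 - var_x * var_y)"
  have W: "Abs_fps (\<lambda>k. coeff_step c k a b S) = (1 - fps_X) * ?g a b" for a b
    by (rule fps_ext) (simp add: coeff_step_def left_diff_distrib fps_X_mult_nth)
  have WX: "in_x ((1 - fps_X) * f) = (1 - var_x) * in_x f" "in_y ((1 - fps_X) * f) = (1 - var_y) * in_y f" for f
  proof -
    have "in_x (1 - fps_X) = 1 - var_x" "in_y (1 - fps_X) = 1 - var_y"
      using in_x_add[of "1 - fps_X" fps_X] in_y_add[of "1 - fps_X" fps_X]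
      by (simp_all add: in_x_one in_y_one in_x_X in_y_X eq_diff_eq)
    then show "in_x ((1 - fps_X) * f) = (1 - var_x) * in_x f" "in_y ((1 - fps_X) * f) = (1 - var_y) * in_y f"
      by (simp_all add: in_x_mult in_y_mult)
  qed
  have "series_relation (\<lambda>a b. Abs_fps (\<lambda>k. coeff_step c k a b S)) j i p l
      = (1 - var_x) * (1 - var_y) * series_relation ?g j i p l"
    unfolding series_relation_def W WX by (simp only: distrib_left mult_ac)
  moreover have "double_series (\<lambda>k m. stokes_bracket (coeff_step c k j i) (coeff_step c m p l) S)
      = (1 - var_x) * (1 - var_y) * double_series C"
  proof (rule double_series_eqI)
    fix k m
    have step: "coeff_step c k a b = (if k = 0 then (\<lambda>S. stokes_coeff c S a b 0)
        else (\<lambda>S. stokes_coeff c S a b k - stokes_coeff c S a b (k - 1)))" for k a b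
      by (auto simp: fun_eq_iff coeff_step_def)
    have "stokes_bracket (coeff_step c k j i) (coeff_step c m p l) S
      = C k m - (if k = 0 then 0 else C (k - 1) m) - (if m = 0 then 0 else C k (m - 1))
        + (if k = 0 \<or> m = 0 then 0 else C (k - 1) (m - 1))"
      by (cases "k = 0"; cases "m = 0")
        (simp_all add: step C_def stokes_bracket_diff stokes_bracket_diff_right pol_stokes_coeff pol_diff)
    then show "fps_nth (fps_nth (double_series (\<lambda>k m. stokes_bracket (coeff_step c k j i) (coeff_step c m p l) S)) m) k
       = fps_nth (fps_nth ((1 - var_x) * (1 - var_y) * double_series C) m) k"
      by (auto simp: left_diff_distrib mult.assoc var_x_mult_nth var_y_mult_nth)
  qed
  ultimately have "(1 - var_x) * (1 - var_y) * (?\<Delta> * double_series C)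
      = (1 - var_x) * (1 - var_y) * (?\<Delta> * double_series (\<lambda>k m. level_bracket (stokes_coeff c S) j i k p l m))"
    using coeff_step_series_relation[OF S ind] unfolding series_relation_level_bracket
    by (simp add: mult_ac)
  then have "double_series C = double_series (\<lambda>k m. level_bracket (stokes_coeff c S) j i k p l m)"
    using one_minus_var_nonzero var_y_minus_var_x_nonzero by simp
  then have "fps_nth (fps_nth (double_series C) m) k
      = fps_nth (fps_nth (double_series (\<lambda>k m. level_bracket (stokes_coeff c S) j i k p l m)) m) k"
    by simp
  then show ?thesis by (simp add: C_def)
qed

section \<open>The bracket coefficients in closed form\<close>

definition double_step_sum :: "nat \<Rightarrow> nat \<Rightarrow> (int \<Rightarrow> complex) \<Rightarrow> complex" where
  "double_step_sum k m f = (\<Sum>q<k. \<Sum>r<m. f (int q + int r) - f (int q + int r + 2))"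

lemma sum_two_step: "(\<Sum>r<m. f (a + int r) - f (a + int r + 2)) = f a + f (a + 1) - f (a + int m) - f (a + int m + 1)"
  for f :: "int \<Rightarrow> complex"
  by (induction m) (simp_all add: algebra_simps)

lemma sum_adjacent:
  fixes f :: "int \<Rightarrow> complex"
  shows "(\<Sum>q<Suc k. f (int q) + f (int q + 1)) = f 0 + 2 * (\<Sum>q=1..k. f (int q)) + f (int (Suc k))"
  by (induction k) (simp_all add: algebra_simps)

lemma double_step_sum_commute: "double_step_sum k m f = double_step_sum m k f"
  unfolding double_step_sum_def by (subst sum.swap) (simp add: add.commute)

text \<open>The inner sum telescopes with step two, and leaves two adjacent terms at either end.\<close>
lemma double_step_sum_eq:
  "double_step_sum (Suc k) m f =
     f 0 + 2 * (\<Sum>q=1..k. f (int q)) + f (int (Suc k))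
     - (f (int m) + 2 * (\<Sum>q=1..k. f (int m + int q)) + f (int m + int (Suc k)))"
proof -
  have "double_step_sum (Suc k) m f = (\<Sum>q<Suc k. f (int q) + f (int q + 1))
      - (\<Sum>q<Suc k. f (int m + int q) + f (int m + (int q + 1)))"
    unfolding double_step_sum_def sum_two_step sum_subtractf[symmetric]
    by (intro sum.cong refl) (simp add: algebra_simps)
  also have "(\<Sum>q<Suc k. f (int m + int q) + f (int m + (int q + 1)))
     = f (int m) + 2 * (\<Sum>q=1..k. f (int m + int q)) + f (int m + int (Suc k))"
    using sum_adjacent[of "\<lambda>s. f (int m + s)" k] by simp
  finally show ?thesis unfolding sum_adjacent .
qed

text \<open>
  The left-hand side is the form in which the bracket coefficient arises from the
  Korotkin--Samtleben bracket: the terms with signs come from pairs of reflections, the double sums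
  from the pole \<open>h\<close>. In terms of \<open>U\<close> and \<open>V\<close> one has \<open>P r s = U r - U s\<close> and
  \<open>Q r s = V (- s) - V r\<close> as long as \<open>r\<close> and \<open>s\<close> are positive, so that the sums in \<open>level_bracket\<close>
  are the telescoped double sums. At the ends of the sums and for \<open>k = 0\<close> or \<open>m = 0\<close> there occur constant
  terms \<open>g a b 0 = (1 - \<epsilon>(a-b))/2 \<gamma> a b 0\<close>, whose signs supply the missing terms. For \<open>k = 0\<close> and
  \<open>m = 0\<close> the coefficients agree by the order of \<open>i, j\<close> and of \<open>p, l\<close>.
\<close>
lemma level_bracket_closed_form:
  fixes \<gamma> :: "'i::linorder \<Rightarrow> 'i \<Rightarrow> int \<Rightarrow> complex"
  assumes swap: "\<And>a b s. a \<in> {i, j, p, l} \<Longrightarrow> b \<in> {i, j, p, l} \<Longrightarrow> \<gamma> b a (- s) = \<gamma> a b s"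
    and diag: "\<And>a. a \<in> {i, j, p, l} \<Longrightarrow> \<gamma> a a 0 = 2"
    and k0: "k = 0 \<Longrightarrow> i < j" and m0: "m = 0 \<Longrightarrow> p < l"
  defines "U \<equiv> \<lambda>s. \<gamma> i l s * \<gamma> p j (int k + int m - s)"
    and "V \<equiv> \<lambda>s. \<gamma> i p s * \<gamma> j l (s + int m - int k)"
    and "g \<equiv> \<lambda>a b q. if q = 0 then (if a < b then \<gamma> a b 0 else if a = b then 1 else 0) else \<gamma> a b (int q)"
  shows "ord_sign i p * (U (int m) - V 0) + ord_sign i l * (V (- int m) - U 0)
       + ord_sign j p * (V (int k) - U (int k + int m)) + ord_sign j l * (U (int k) - V (int k - int m))
       + double_step_sum k m U - double_step_sum k m (\<lambda>s. V (s - int m))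
     = level_bracket g i j k p l m"
proof -
  have g0: "g a b 0 = (1 - ord_sign a b) / 2 * \<gamma> a b 0" if "a \<in> {i, j, p, l}" "b \<in> {i, j, p, l}" for a b
    using diag[OF that(1)] by (auto simp: g_def ord_sign_def)
  have gS: "g a b q = \<gamma> a b (int q)" if "0 < q" for a b q
    using that by (simp add: g_def)
  define P where "P r s = g p j s * g i l r - g p j r * g i l s" for r s
  define Q where "Q r s = g l j r * g p i s - g i p r * g j l s" for r s
  have level: "level_bracket g i j k p l m =
      ord_sign i p * g p j k * g i l m + ord_sign j l * g p j m * g i l k
      + ord_sign j p * g i p k * g j l m + ord_sign i l * g l j k * g p i m
      + (P k m + 2 * (\<Sum>q=1..k. P (k - q) (m + q))) - (Q k m + 2 * (\<Sum>q=1..min k m. Q (k - q) (m - q)))"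
    by (simp add: level_bracket_def Let_def P_def Q_def)
  have osw: "ord_sign p j = - ord_sign j p" "ord_sign l j = - ord_sign j l" "ord_sign p i = - ord_sign i p"
    "ord_sign l i = - ord_sign i l"
    by (rule ord_sign_swap)+
  have sw0: "\<gamma> j p 0 = \<gamma> p j 0" "\<gamma> l j 0 = \<gamma> j l 0" "\<gamma> p i 0 = \<gamma> i p 0" "\<gamma> l i 0 = \<gamma> i l 0"
    using swap[of p j 0] swap[of j l 0] swap[of i p 0] swap[of i l 0] by auto
  have Uval: "U 0 = \<gamma> i l 0 * \<gamma> p j (int k + int m)" "U (int k + int m) = \<gamma> i l (int k + int m) * \<gamma> p j 0"
      "U (int k) = \<gamma> i l (int k) * \<gamma> p j (int m)" "U (int m) = \<gamma> i l (int m) * \<gamma> p j (int k)"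
    by (simp_all add: U_def)
  have Vval: "V 0 = \<gamma> i p 0 * \<gamma> j l (int m - int k)" "V (int k - int m) = \<gamma> i p (int k - int m) * \<gamma> j l 0"
      "V (int k) = \<gamma> i p (int k) * \<gamma> j l (int m)" "V (- int m) = \<gamma> p i (int m) * \<gamma> l j (int k)"
    using swap[of p i "int m"] swap[of l j "int k"] by (simp_all add: V_def)
  have g0s: "g i l 0 = (1 - ord_sign i l) / 2 * \<gamma> i l 0" "g p j 0 = (1 + ord_sign j p) / 2 * \<gamma> p j 0"
      "g i p 0 = (1 - ord_sign i p) / 2 * \<gamma> i p 0" "g j l 0 = (1 - ord_sign j l) / 2 * \<gamma> j l 0"
      "g l j 0 = (1 + ord_sign j l) / 2 * \<gamma> j l 0" "g p i 0 = (1 + ord_sign i p) / 2 * \<gamma> i p 0"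
    by (simp_all add: g0 osw sw0)
  consider "k = 0" | "0 < k" "m = 0" | "0 < k" "0 < m" by blast
  then show ?thesis
  proof cases
    case 1
    have order: "(ord_sign i x - 1) * (1 + ord_sign j x) / 2 = (ord_sign i x - ord_sign j x :: complex)" for x
      using k0[OF 1] by (auto simp: ord_sign_def)
    have sums: "double_step_sum k m f = 0" for f by (simp add: 1 double_step_sum_def)
    have "(ord_sign i p - 1) * g p j 0 = (ord_sign i p - 1) * (1 + ord_sign j p) / 2 * \<gamma> p j 0"
      "(ord_sign j l + 1) * g i l 0 = - ((ord_sign i l - 1) * (1 + ord_sign j l) / 2) * \<gamma> i l 0"
      "(ord_sign j p + 1) * g i p 0 = - ((ord_sign i p - 1) * (1 + ord_sign j p) / 2) * \<gamma> i p 0"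
      "(ord_sign i l - 1) * g l j 0 = (ord_sign i l - 1) * (1 + ord_sign j l) / 2 * \<gamma> j l 0"
      unfolding g0s by (simp_all add: field_simps)
    then have prods: "(ord_sign i p - 1) * g p j 0 = (ord_sign i p - ord_sign j p) * \<gamma> p j 0"
      "(ord_sign j l + 1) * g i l 0 = - (ord_sign i l - ord_sign j l) * \<gamma> i l 0"
      "(ord_sign j p + 1) * g i p 0 = - (ord_sign i p - ord_sign j p) * \<gamma> i p 0"
      "(ord_sign i l - 1) * g l j 0 = (ord_sign i l - ord_sign j l) * \<gamma> j l 0"
      unfolding order by simp_all
    have "level_bracket g i j k p l m = ((ord_sign i p - 1) * g p j 0) * g i l m + ((ord_sign j l + 1) * g i l 0) * g p j m
      + ((ord_sign j p + 1) * g i p 0) * g j l m + ((ord_sign i l - 1) * g l j 0) * g p i m"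
      unfolding level P_def Q_def by (simp add: 1 algebra_simps)
    also have "\<dots> = (ord_sign i p - ord_sign j p) * (\<gamma> p j 0 * g i l m - \<gamma> i p 0 * g j l m)
      + (ord_sign i l - ord_sign j l) * (\<gamma> j l 0 * g p i m - \<gamma> i l 0 * g p j m)"
      unfolding prods by (simp add: algebra_simps)
    finally have lev: "level_bracket g i j k p l m = \<dots>" .
    show ?thesis
    proof (cases "m = 0")
      case True
      have coeff: "(ord_sign i p - ord_sign j p) * (1 - ord_sign i l) / 2 - (ord_sign i l - ord_sign j l) * (1 + ord_sign j p) / 2
            = (ord_sign i p - ord_sign j p - ord_sign i l + ord_sign j l :: complex)"
          "(ord_sign i p - ord_sign j p) * (1 - ord_sign j l) / 2 - (ord_sign i l - ord_sign j l) * (1 + ord_sign i p) / 2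
            = (ord_sign i p - ord_sign j p - ord_sign i l + ord_sign j l :: complex)"
        using k0[OF 1] m0[OF True] by (auto simp: ord_sign_def)
      have "level_bracket g i j k p l m =
         ((ord_sign i p - ord_sign j p) * (1 - ord_sign i l) / 2 - (ord_sign i l - ord_sign j l) * (1 + ord_sign j p) / 2)
           * (\<gamma> i l 0 * \<gamma> p j 0)
        - ((ord_sign i p - ord_sign j p) * (1 - ord_sign j l) / 2 - (ord_sign i l - ord_sign j l) * (1 + ord_sign i p) / 2)
           * (\<gamma> i p 0 * \<gamma> j l 0)"
        unfolding lev unfolding True g0s by (simp add: field_simps)
      then show ?thesis
        unfolding coeff sums Uval Vval by (simp add: 1 True sw0 algebra_simps)
    next
      case False
      then have m: "0 < m" by simp
      show ?thesis
        using swap[of p i "int m"]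
        unfolding lev sums Uval Vval by (simp add: 1 gS[OF m] sw0 algebra_simps)
    qed
  next
    case 2
    have order: "(1 + ord_sign x p) * (1 - ord_sign x l) / 2 = (ord_sign x p - ord_sign x l :: complex)" for x
      using m0[OF 2(2)] by (auto simp: ord_sign_def)
    have sums: "double_step_sum k m f = 0" for f by (simp add: 2 double_step_sum_def)
    have anti: "P k 0 + 2 * (\<Sum>q=1..k. P (k - q) (0 + q)) = - P k 0"
      by (rule antisymmetric_antidiagonal_sum) (simp add: P_def)
    have "(ord_sign i p + 1) * g i l 0 = (1 + ord_sign i p) * (1 - ord_sign i l) / 2 * \<gamma> i l 0"
      "(ord_sign j l - 1) * g p j 0 = - ((1 + ord_sign j p) * (1 - ord_sign j l) / 2) * \<gamma> p j 0"
      "(ord_sign j p + 1) * g j l 0 = (1 + ord_sign j p) * (1 - ord_sign j l) / 2 * \<gamma> j l 0"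
      "(ord_sign i l - 1) * g p i 0 = - ((1 + ord_sign i p) * (1 - ord_sign i l) / 2) * \<gamma> i p 0"
      unfolding g0s by (simp_all add: field_simps)
    then have prods: "(ord_sign i p + 1) * g i l 0 = (ord_sign i p - ord_sign i l) * \<gamma> i l 0"
      "(ord_sign j l - 1) * g p j 0 = - (ord_sign j p - ord_sign j l) * \<gamma> p j 0"
      "(ord_sign j p + 1) * g j l 0 = (ord_sign j p - ord_sign j l) * \<gamma> j l 0"
      "(ord_sign i l - 1) * g p i 0 = - (ord_sign i p - ord_sign i l) * \<gamma> i p 0"
      unfolding order by simp_all
    have "level_bracket g i j k p l m = ((ord_sign i p + 1) * g i l 0) * g p j k + ((ord_sign j l - 1) * g p j 0) * g i l k
      + ((ord_sign j p + 1) * g j l 0) * g i p k + ((ord_sign i l - 1) * g p i 0) * g l j k"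
      unfolding level unfolding 2(2) anti unfolding P_def Q_def by (simp add: algebra_simps)
    also have "\<dots> = (ord_sign i p - ord_sign i l) * (\<gamma> i l 0 * g p j k - \<gamma> i p 0 * g l j k)
      + (ord_sign j p - ord_sign j l) * (\<gamma> j l 0 * g i p k - \<gamma> p j 0 * g i l k)"
      unfolding prods by (simp add: algebra_simps)
    finally show ?thesis
      using swap[of j l "int k"] swap[of l j "int k"] unfolding sums Uval Vval
      by (simp add: 2 gS[OF 2(1)] sw0 algebra_simps)
  next
    case 3
    obtain k' where k': "k = Suc k'" using 3 gr0_implies_Suc by blast
    obtain m' where m': "m = Suc m'" using 3 gr0_implies_Suc by blast
    define SU where "SU = (\<Sum>q=1..k'. U (int q))"
    define SUm where "SUm = (\<Sum>q=1..k'. U (int m + int q))"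
    have Pgen: "P r s = U (int r) - U (int s)" if "0 < r" "0 < s" "r + s = k + m" for r s
    proof -
      have e: "int k + int m - int r = int s" "int k + int m - int s = int r" using that by linarith+
      show ?thesis unfolding P_def U_def e using that(1,2) by (simp add: gS)
    qed
    have Psum: "P k m + 2 * (\<Sum>q=1..k. P (k - q) (m + q)) = U (int k) - U (int m) + 2 * (SU - SUm) + 2 * P 0 (m + k)"
    proof -
      have "(\<Sum>q=1..k'. P (k - q) (m + q)) = (\<Sum>q=1..k'. U (int (k - q)) - U (int m + int q))"
        using 3 by (intro sum.cong refl) (auto simp: Pgen k')
      also have "\<dots> = SU - SUm"
        unfolding SU_def SUm_def sum_subtractf
        by (intro arg_cong2[where f = "(-)"] refl sum.reindex_bij_witness[of _ "\<lambda>q. k - q" "\<lambda>q. k - q"]) (auto simp: k')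
      finally have sum: "(\<Sum>q=1..k. P (k - q) (m + q)) = SU - SUm + P 0 (m + k)"
        by (simp add: k')
      have "P k m = U (int k) - U (int m)" using 3 by (simp add: Pgen)
      then show ?thesis unfolding sum by (simp add: algebra_simps)
    qed
    have Usum: "double_step_sum k m U = U 0 + 2 * SU + U (int k) - (U (int m) + 2 * SUm + U (int k + int m))"
      unfolding k' double_step_sum_eq by (simp add: SU_def SUm_def k' add_ac)
    have P0: "P 0 (m + k) = \<gamma> p j (int k + int m) * g i l 0 - g p j 0 * \<gamma> i l (int k + int m)"
      using 3 by (simp add: P_def gS add.commute)
    have Qgen: "Q r s = V (- int s) - V (int r)" if "0 < r" "0 < s" "r + m = s + k" for r s
    proof -
      have e: "- int s + int m - int k = - int r" "int r + int m - int k = int s" using that by linarith+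
      show ?thesis
        unfolding Q_def V_def e using that(1,2) swap[of p i "int s"] swap[of l j "int r"] by (simp add: gS)
    qed
    have Q: "- (Q k m + 2 * (\<Sum>q=1..min k m. Q (k - q) (m - q)))
       = - double_step_sum k m (\<lambda>s. V (s - int m)) - ord_sign i p * V 0 - ord_sign j l * V (int k - int m)"
    proof (cases "k \<le> m")
      case True
      define SV where "SV = (\<Sum>q=1..k'. V (int q))"
      define SVm where "SVm = (\<Sum>q=1..k'. V (int q - int m))"
      have "(\<Sum>q=1..k'. Q (k - q) (m - q)) = (\<Sum>q=1..k'. V (int q - int m) - V (int (k - q)))"
        using True 3 by (intro sum.cong refl) (auto simp: Qgen k' of_nat_diff)
      also have "\<dots> = SVm - SV"
        unfolding SV_def SVm_def sum_subtractf
        by (intro arg_cong2[where f = "(-)"] refl sum.reindex_bij_witness[of _ "\<lambda>q. k - q" "\<lambda>q. k - q"]) (auto simp: k')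
      finally have sum: "(\<Sum>q=1..k. Q (k - q) (m - q)) = SVm - SV + Q 0 (m - k)"
        by (simp add: k')
      have step: "double_step_sum k m (\<lambda>s. V (s - int m))
          = V (- int m) + 2 * SVm + V (int k - int m) - (V 0 + 2 * SV + V (int k))"
        unfolding k' double_step_sum_eq by (simp add: SV_def SVm_def k')
      have "- 2 * Q 0 (m - k) = V 0 - V (int k - int m) - ord_sign i p * V 0 - ord_sign j l * V (int k - int m)"
      proof (cases "m = k")
        case True
        then show ?thesis unfolding Q_def Vval by (simp add: g0s sw0 field_simps)
      next
        case False
        then have "0 < m - k" "int (m - k) = int m - int k" using True by auto
        then show ?thesis
          using swap[of p i "int m - int k"] unfolding Q_def Vval
          by (simp add: gS g0s field_simps)
      qed
      moreover have Qkm: "Q k m = V (- int m) - V (int k)" using 3 by (simp add: Qgen)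
      moreover have min: "min k m = k" using True by simp
      ultimately show ?thesis
        unfolding min sum step Qkm by (simp add: algebra_simps)
    next
      case False
      define SV where "SV = (\<Sum>q=1..m'. V (int k - int m + int q))"
      define SVm where "SVm = (\<Sum>q=1..m'. V (int q - int m))"
      have "(\<Sum>q=1..m'. Q (k - q) (m - q)) = (\<Sum>q=1..m'. V (int q - int m) - V (int (k - q)))"
        using False 3 by (intro sum.cong refl) (auto simp: Qgen m' of_nat_diff)
      also have "\<dots> = SVm - SV"
        unfolding SV_def SVm_def sum_subtractf using False
        by (intro arg_cong2[where f = "(-)"] refl sum.reindex_bij_witness[of _ "\<lambda>q. m - q" "\<lambda>q. m - q"])
          (auto simp: m' of_nat_diff)
      finally have sum: "(\<Sum>q=1..m. Q (k - q) (m - q)) = SVm - SV + Q (k - m) 0"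
        by (simp add: m')
      have step: "double_step_sum k m (\<lambda>s. V (s - int m))
          = V (- int m) + 2 * SVm + V 0 - (V (int k - int m) + 2 * SV + V (int k))"
        unfolding double_step_sum_commute[of k m] unfolding m' double_step_sum_eq
        by (simp add: SV_def SVm_def m' algebra_simps)
      have "- 2 * Q (k - m) 0 = V (int k - int m) - V 0 - ord_sign i p * V 0 - ord_sign j l * V (int k - int m)"
      proof -
        have "0 < k - m" "int (k - m) = int k - int m" using False by auto
        then show ?thesis
          using swap[of l j "int k - int m"] unfolding Q_def Vval
          by (simp add: gS g0s field_simps)
      qed
      moreover have Qkm: "Q k m = V (- int m) - V (int k)" using 3 by (simp add: Qgen)
      moreover have min: "min k m = m" using False by simp
      ultimately show ?thesis
        unfolding min sum step Qkm by (simp add: algebra_simps)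
    qed
    have "2 * P 0 (m + k) = U 0 - U (int k + int m) - ord_sign i l * U 0 - ord_sign j p * U (int k + int m)"
      unfolding P0 Uval g0s by (simp add: field_simps)
    then have "P k m + 2 * (\<Sum>q=1..k. P (k - q) (m + q))
        = double_step_sum k m U - ord_sign i l * U 0 - ord_sign j p * U (int k + int m)"
      unfolding Psum Usum by (simp add: algebra_simps)
    then show ?thesis
      unfolding level diff_conv_add_uminus Q unfolding Uval(3,4) Vval(3,4)
      using 3 by (simp add: gS algebra_simps)
  qed
qed

section \<open>The Korotkin--Samtleben bracket in terms of traces\<close>

lemma sum_UNIV_pairs: "(\<Sum>q\<in>UNIV. F q) = (\<Sum>a\<in>UNIV. \<Sum>b\<in>UNIV. F (a, b))"
  for F :: "'a::finite \<times> 'b::finite \<Rightarrow> 'c::comm_monoid_add"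
  by (simp add: sum.cartesian_product)

lemma kron_nth: "kron A B $ (i, k) $ (j, l) = A $ i $ j * B $ k $ l"
  by (simp add: kron_def)

lemma Omega_nth: "Omega $ (i, k) $ (j, l) = mat 1 $ i $ l * mat 1 $ k $ j"
proof -
  have "Omega $ (i, k) $ (j, l) = (\<Sum>a\<in>UNIV. \<Sum>b\<in>UNIV. elem_mat a b $ i $ j * elem_mat b a $ k $ l)"
    by (simp add: Omega_def kron_nth)
  also have "\<dots> = (\<Sum>a\<in>UNIV. \<Sum>b\<in>UNIV. if b = j then (if a = i then mat 1 $ i $ l * mat 1 $ k $ j else 0) else 0)"
    by (intro sum.cong refl) (auto simp: elem_mat_def mat_def)
  finally show ?thesis by simp
qed

lemma kron_mult_nth:
  fixes A B :: "'n::finite cmat" and X :: "('n \<times> 'n) cmat"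
  shows "(kron A (mat 1) ** X) $ (i, k) $ q = (\<Sum>a\<in>UNIV. A $ i $ a * X $ (a, k) $ q)"
    and "(kron (mat 1) B ** X) $ (i, k) $ q = (\<Sum>b\<in>UNIV. B $ k $ b * X $ (i, b) $ q)"
    and "(X ** kron A (mat 1)) $ p $ (j, l) = (\<Sum>a\<in>UNIV. X $ p $ (a, l) * A $ a $ j)"
    and "(X ** kron (mat 1) B) $ p $ (j, l) = (\<Sum>b\<in>UNIV. X $ p $ (j, b) * B $ b $ l)"
proof -
  have pick: "(\<Sum>b\<in>UNIV. F b * mat 1 $ k $ b) = F k" "(\<Sum>b\<in>UNIV. F b * mat 1 $ b $ k) = F k"
    for F :: "'n \<Rightarrow> complex" and k
    by (simp_all add: mat_def if_distrib[of "\<lambda>x. _ * x"] cong: if_cong)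
  have "(kron A (mat 1) ** X) $ (i, k) $ q = (\<Sum>a\<in>UNIV. \<Sum>b\<in>UNIV. (A $ i $ a * X $ (a, b) $ q) * mat 1 $ k $ b)"
    by (simp add: matrix_matrix_mult_def sum_UNIV_pairs kron_nth mult_ac)
  then show "(kron A (mat 1) ** X) $ (i, k) $ q = (\<Sum>a\<in>UNIV. A $ i $ a * X $ (a, k) $ q)"
    by (simp add: pick)
  have "(kron (mat 1) B ** X) $ (i, k) $ q = (\<Sum>a\<in>UNIV. (\<Sum>b\<in>UNIV. B $ k $ b * X $ (a, b) $ q) * mat 1 $ i $ a)"
    by (simp add: matrix_matrix_mult_def sum_UNIV_pairs kron_nth mult_ac sum_distrib_left)
  then show "(kron (mat 1) B ** X) $ (i, k) $ q = (\<Sum>b\<in>UNIV. B $ k $ b * X $ (i, b) $ q)"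
    by (simp add: pick)
  have "(X ** kron A (mat 1)) $ p $ (j, l) = (\<Sum>a\<in>UNIV. \<Sum>b\<in>UNIV. (X $ p $ (a, b) * A $ a $ j) * mat 1 $ b $ l)"
    by (simp add: matrix_matrix_mult_def sum_UNIV_pairs kron_nth mult_ac)
  then show "(X ** kron A (mat 1)) $ p $ (j, l) = (\<Sum>a\<in>UNIV. X $ p $ (a, l) * A $ a $ j)"
    by (simp add: pick)
  have "(X ** kron (mat 1) B) $ p $ (j, l) = (\<Sum>a\<in>UNIV. (\<Sum>b\<in>UNIV. X $ p $ (a, b) * B $ b $ l) * mat 1 $ a $ j)"
    by (simp add: matrix_matrix_mult_def sum_UNIV_pairs kron_nth mult_ac sum_distrib_left)
  then show "(X ** kron (mat 1) B) $ p $ (j, l) = (\<Sum>b\<in>UNIV. X $ p $ (j, b) * B $ b $ l)"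
    by (simp add: pick)
qed

lemma mat_1_picks:
  fixes F :: "'n::finite \<Rightarrow> complex"
  shows "(\<Sum>b\<in>UNIV. F b * (mat 1 $ k $ b * z)) = F k * z" "(\<Sum>b\<in>UNIV. F b * (mat 1 $ b $ k * z)) = F k * z"
    "(\<Sum>b\<in>UNIV. F b * (z * mat 1 $ k $ b)) = F k * z" "(\<Sum>b\<in>UNIV. F b * (z * mat 1 $ b $ k)) = F k * z"
  by (simp_all add: mat_def if_distrib[of "\<lambda>x. x * z"] if_distrib[of "\<lambda>x. z * x"] if_distrib[of "\<lambda>x. _ * x"] cong: if_cong)

lemma Omega_kron_nth:
  fixes A B :: "'n::finite cmat"
  shows "(kron A (mat 1) ** Omega) $ (i, k) $ (j, l) = A $ i $ l * mat 1 $ k $ j"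
    and "(kron (mat 1) B ** Omega) $ (i, k) $ (j, l) = B $ k $ j * mat 1 $ i $ l"
    and "(Omega ** kron A (mat 1)) $ (i, k) $ (j, l) = A $ k $ j * mat 1 $ i $ l"
proof -
  show "(kron A (mat 1) ** Omega) $ (i, k) $ (j, l) = A $ i $ l * mat 1 $ k $ j"
    unfolding kron_mult_nth(1) Omega_nth by (rule mat_1_picks)
  show "(kron (mat 1) B ** Omega) $ (i, k) $ (j, l) = B $ k $ j * mat 1 $ i $ l"
    unfolding kron_mult_nth(2) Omega_nth by (rule mat_1_picks)
  have "(Omega ** kron A (mat 1)) $ (i, k) $ (j, l) = (\<Sum>a\<in>UNIV. A $ a $ j * (mat 1 $ i $ l * mat 1 $ k $ a))"
    unfolding kron_mult_nth(3) Omega_nth by (intro sum.cong refl) (rule mult.commute)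
  also have "\<dots> = A $ k $ j * mat 1 $ i $ l" by (rule mat_1_picks)
  finally show "(Omega ** kron A (mat 1)) $ (i, k) $ (j, l) = A $ k $ j * mat 1 $ i $ l" .
qed

lemma ks_same_nth:
  "ks_same M $ (i, k) $ (j, l) = 1 / 2 * (mat 1 $ i $ l * (M ** M) $ k $ j - mat 1 $ k $ j * (M ** M) $ i $ l)"
proof -
  have "(kron (mat 1) M ** Omega ** kron M (mat 1)) $ (i, k) $ (j, l) = mat 1 $ i $ l * (M ** M) $ k $ j"
    unfolding kron_mult_nth(3) Omega_kron_nth by (simp add: matrix_matrix_mult_def sum_distrib_left mult_ac)
  moreover have "(kron M (mat 1) ** Omega ** kron (mat 1) M) $ (i, k) $ (j, l) = mat 1 $ k $ j * (M ** M) $ i $ l"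
    unfolding kron_mult_nth(4) Omega_kron_nth by (simp add: matrix_matrix_mult_def sum_distrib_left mult_ac)
  ultimately show ?thesis by (simp add: ks_same_def Let_def mat_mult_nth)
qed

lemma ks_less_nth:
  "ks_less A B $ (i, k) $ (j, l) = 1 / 2 * (mat 1 $ k $ j * (A ** B) $ i $ l + mat 1 $ i $ l * (B ** A) $ k $ j
      - A $ k $ j * B $ i $ l - A $ i $ l * B $ k $ j)"
proof -
  have "(kron A (mat 1) ** Omega ** kron (mat 1) B) $ (i, k) $ (j, l) = mat 1 $ k $ j * (A ** B) $ i $ l"
    unfolding kron_mult_nth(4) Omega_kron_nth by (simp add: matrix_matrix_mult_def sum_distrib_left mult_ac)
  moreover have "(kron (mat 1) B ** Omega ** kron A (mat 1)) $ (i, k) $ (j, l) = mat 1 $ i $ l * (B ** A) $ k $ j"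
    unfolding kron_mult_nth(3) Omega_kron_nth by (simp add: matrix_matrix_mult_def sum_distrib_left mult_ac)
  moreover have "(Omega ** kron A (mat 1) ** kron (mat 1) B) $ (i, k) $ (j, l) = A $ k $ j * B $ i $ l"
  proof -
    have "(Omega ** kron A (mat 1) ** kron (mat 1) B) $ (i, k) $ (j, l) = (\<Sum>b\<in>UNIV. B $ b $ l * (mat 1 $ i $ b * A $ k $ j))"
      unfolding kron_mult_nth(4) Omega_kron_nth by (intro sum.cong refl) (simp only: mult_ac)
    also have "\<dots> = B $ i $ l * A $ k $ j" by (rule mat_1_picks)
    finally show ?thesis by (simp only: mult.commute)
  qed
  moreover have "(kron (mat 1) B ** kron A (mat 1) ** Omega) $ (i, k) $ (j, l) = A $ i $ l * B $ k $ j"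
  proof -
    have "(kron (mat 1) B ** (kron A (mat 1) ** Omega)) $ (i, k) $ (j, l) = B $ k $ j * A $ i $ l"
      unfolding kron_mult_nth(2) Omega_kron_nth by (rule mat_1_picks)
    then show ?thesis by (simp only: mult.commute matrix_mul_assoc)
  qed
  ultimately show ?thesis by (simp add: ks_less_def Let_def mat_mult_nth)
qed

text \<open>
  The part of the Korotkin--Samtleben bracket that belongs to a pair of poles. \<open>A\<close> and \<open>B\<close> are
  gradients with respect to the trace form, whose entries are the partial derivatives transposed.
\<close>
definition ks_pair ::
  "('n \<Rightarrow> 'n cmat) \<Rightarrow> 'n \<Rightarrow> 'n cmat \<Rightarrow> 'n \<Rightarrow> ('n::{finite,linorder}) cmat \<Rightarrow> complex" where
  "ks_pair t a A b B = (\<Sum>i\<in>UNIV. \<Sum>j\<in>UNIV. \<Sum>k\<in>UNIV. \<Sum>l\<in>UNIV.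
     A $ j $ i * B $ l $ k * ks_entry t a i j b k l)"

lemma trace_mult4:
  fixes A B X Y :: "'n::finite cmat"
  shows "(\<Sum>i\<in>UNIV. \<Sum>j\<in>UNIV. \<Sum>k\<in>UNIV. \<Sum>l\<in>UNIV. A $ j $ i * B $ l $ k * (X $ i $ l * Y $ k $ j))
     = trace (A ** X ** B ** Y)"
proof -
  let ?U = "UNIV :: 'n set"
  have "trace (A ** X ** B ** Y) = (\<Sum>j\<in>?U. \<Sum>k\<in>?U. \<Sum>l\<in>?U. \<Sum>i\<in>?U. A $ j $ i * B $ l $ k * (X $ i $ l * Y $ k $ j))"
    unfolding trace_def matrix_matrix_mult_def vec_lambda_beta sum_distrib_right
    by (intro sum.cong refl) (simp only: mult_ac)
  also have "\<dots> = (\<Sum>i\<in>?U. \<Sum>j\<in>?U. \<Sum>k\<in>?U. \<Sum>l\<in>?U. A $ j $ i * B $ l $ k * (X $ i $ l * Y $ k $ j))"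
    by (rule trans[OF sum_perm4(4) sum.swap])
  finally show ?thesis ..
qed

text \<open>
  Contraction with \<open>\<Omega>\<close> merges the two traces, and the four terms of the bracket form the product
  of two commutators.
\<close>
lemma ks_pair_less:
  assumes "a < b"
  shows "ks_pair t a A b B = - 1 / 2 * trace ((t a ** A - A ** t a) ** (t b ** B - B ** t b))"
proof -
  let ?X = "t a" and ?Y = "t b"
  have e: "A $ j $ i * B $ l $ k * ks_entry t a i j b k l =
      1 / 2 * (A $ j $ i * B $ l $ k * ((?X ** ?Y) $ i $ l * mat 1 $ k $ j))
    + 1 / 2 * (A $ j $ i * B $ l $ k * (mat 1 $ i $ l * (?Y ** ?X) $ k $ j))
    - 1 / 2 * (A $ j $ i * B $ l $ k * (?Y $ i $ l * ?X $ k $ j))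
    - 1 / 2 * (A $ j $ i * B $ l $ k * (?X $ i $ l * ?Y $ k $ j))" for i j k l
  proof -
    have "ks_entry t a i j b k l = ks_less ?X ?Y $ (i, k) $ (j, l)"
      using assms by (auto simp: ks_entry_def)
    then show ?thesis unfolding ks_less_nth by (simp only: ring_distribs mult_ac)
  qed
  have "ks_pair t a A b B = 1 / 2 * trace (A ** (?X ** ?Y) ** B ** mat 1) + 1 / 2 * trace (A ** mat 1 ** B ** (?Y ** ?X))
      - 1 / 2 * trace (A ** ?Y ** B ** ?X) - 1 / 2 * trace (A ** ?X ** B ** ?Y)"
    unfolding ks_pair_def e sum.distrib sum_subtractf sum_distrib_left[symmetric] trace_mult4 ..
  moreover have "trace (?X ** A ** ?Y ** B) = trace (A ** ?Y ** B ** ?X)" "trace (?X ** A ** B ** ?Y) = trace (A ** B ** ?Y ** ?X)"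
    using trace_mul_sym[of ?X "A ** ?Y ** B"] trace_mul_sym[of ?X "A ** B ** ?Y"] by (simp_all add: matrix_mul_assoc)
  ultimately show ?thesis
    by (simp add: matrix_mult_distribs matrix_mul_assoc trace_add trace_sub algebra_simps)
qed

lemma ks_pair_swap: "ks_pair t b B a A = - ks_pair t a A b B" if "a \<noteq> b"
proof -
  have "ks_pair t b B a A = (\<Sum>k\<in>UNIV. \<Sum>l\<in>UNIV. \<Sum>i\<in>UNIV. \<Sum>j\<in>UNIV. - (A $ j $ i * B $ l $ k * ks_entry t a i j b k l))"
    unfolding ks_pair_def using that by (intro sum.cong refl) (auto simp: ks_entry_def)
  also have "\<dots> = (\<Sum>i\<in>UNIV. \<Sum>j\<in>UNIV. \<Sum>k\<in>UNIV. \<Sum>l\<in>UNIV. - (A $ j $ i * B $ l $ k * ks_entry t a i j b k l))"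
    by (rule trans[OF sum_perm4(2)], rule trans[OF sum_perm4(2)], rule trans[OF sum_perm4(2)], rule sum_perm4(1))
  finally show ?thesis by (simp add: ks_pair_def sum_negf)
qed

lemma ks_pair_same:
  "ks_pair t a A a B = 1 / 2 * (trace (t a ** A ** (B ** t a)) - trace (A ** t a ** (t a ** B)))"
proof -
  let ?X = "t a"
  have e: "A $ j $ i * B $ l $ k * ks_entry t a i j a k l =
      1 / 2 * (A $ j $ i * B $ l $ k * (mat 1 $ i $ l * (?X ** ?X) $ k $ j))
    - 1 / 2 * (A $ j $ i * B $ l $ k * ((?X ** ?X) $ i $ l * mat 1 $ k $ j))" for i j k l
    by (simp add: ks_entry_def ks_same_nth algebra_simps)
  have "ks_pair t a A a B = 1 / 2 * trace (A ** mat 1 ** B ** (?X ** ?X)) - 1 / 2 * trace (A ** (?X ** ?X) ** B ** mat 1)"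
    unfolding ks_pair_def e sum_subtractf sum_distrib_left[symmetric] trace_mult4 ..
  moreover have "trace (?X ** A ** B ** ?X) = trace (A ** B ** ?X ** ?X)"
    using trace_mul_sym[of ?X "A ** B ** ?X"] by (simp add: matrix_mul_assoc)
  ultimately show ?thesis by (simp add: matrix_mul_assoc algebra_simps)
qed

lemma ks_pair_add:
  "ks_pair t a (A + A') b B = ks_pair t a A b B + ks_pair t a A' b B"
  "ks_pair t a A b (B + B') = ks_pair t a A b B + ks_pair t a A b B'"
  by (simp_all add: ks_pair_def distrib_right distrib_left sum.distrib)

lemma ks_pair_zero: "ks_pair t a 0 b B = 0" "ks_pair t a A b 0 = 0"
  by (simp_all add: ks_pair_def)

lemma ks_bracket_gradient:
  assumes "\<And>a i j. a \<le> c \<Longrightarrow> entry_deriv a i j F t = F' a $ j $ i"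
    and "\<And>a i j. a \<le> c \<Longrightarrow> entry_deriv a i j H t = H' a $ j $ i"
  shows "ks_bracket c F H t = (\<Sum>a\<in>{..c}. \<Sum>b\<in>{..c}. ks_pair t a (F' a) b (H' b))"
proof -
  have "ks_bracket c F H t = (\<Sum>a\<in>{..c}. \<Sum>i\<in>UNIV. \<Sum>j\<in>UNIV. \<Sum>b\<in>{..c}. \<Sum>k\<in>UNIV. \<Sum>l\<in>UNIV.
      F' a $ j $ i * H' b $ l $ k * ks_entry t a i j b k l)"
    unfolding ks_bracket_def by (intro sum.cong refl) (simp add: assms)
  also have "\<dots> = (\<Sum>a\<in>{..c}. \<Sum>b\<in>{..c}. ks_pair t a (F' a) b (H' b))"
    unfolding ks_pair_def
  proof (rule sum.cong[OF refl])
    fix a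
    show "(\<Sum>i\<in>UNIV. \<Sum>j\<in>UNIV. \<Sum>b\<in>{..c}. \<Sum>k\<in>UNIV. \<Sum>l\<in>UNIV. F' a $ j $ i * H' b $ l $ k * ks_entry t a i j b k l)
      = (\<Sum>b\<in>{..c}. \<Sum>i\<in>UNIV. \<Sum>j\<in>UNIV. \<Sum>k\<in>UNIV. \<Sum>l\<in>UNIV. F' a $ j $ i * H' b $ l $ k * ks_entry t a i j b k l)"
      by (rule sym, rule trans[OF sum.swap], rule sum.cong[OF refl], rule sum.swap)
  qed
  finally show ?thesis .
qed

section \<open>Gradients of the invariant traces\<close>

lemma trace_elem_mat: "trace (elem_mat u v ** A) = A $ v $ u"
proof -
  have "trace (elem_mat u v ** A) = (\<Sum>i\<in>UNIV. \<Sum>k\<in>UNIV. if k = v then (if i = u then A $ v $ u else 0) else 0)"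
    unfolding trace_def matrix_matrix_mult_def elem_mat_def vec_lambda_beta
    by (intro sum.cong refl) auto
  then show ?thesis by simp
qed

lemma trace_derivative:
  assumes "has_mat_derivative F D z"
  shows "((\<lambda>x. trace (F x)) has_field_derivative trace D) (at z)"
  using assms unfolding trace_def has_mat_derivative_def by (intro DERIV_sum) auto

lemma trace_sum: "trace (\<Sum>i\<in>I. F i) = (\<Sum>i\<in>I. trace (F i :: 'n::finite cmat))"
  by (induction I rule: infinite_finite_induct) (simp_all add: trace_add trace_0[unfolded mat_0])

text \<open>
  The trace is cyclic. This is the counterpart of the relation \<open>G(-k) j i = G(k) i j\<close>.
\<close>
lemma inv_trace_swap: "inv_trace c (- k) j i t = inv_trace c k i j t"
  using trace_mul_sym[of "t j ** mat_powi (t c) (- k)" "t i ** mat_powi (t c) k"]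
  by (simp add: inv_trace_def matrix_mul_assoc)

section \<open>The bracket of the invariant traces for reflections\<close>

definition dotp :: "'n::finite cvec \<Rightarrow> 'n cvec \<Rightarrow> complex" where
  "dotp u v = (\<Sum>i\<in>UNIV. u $ i * v $ i)"

text \<open>In these terms the reflections are \<open>1 - e g\<^sup>T\<close>.\<close>
definition outer :: "'n::finite cvec \<Rightarrow> 'n cvec \<Rightarrow> 'n cmat" where
  "outer u v = (\<chi> a b. u $ a * v $ b)"

lemma mult_outer: "A ** outer u v = outer (A *v u) v"
  by (simp add: vec_eq_iff outer_def matrix_matrix_mult_def matrix_vector_mult_def sum_distrib_right sum_distrib_left mult_ac)

lemma outer_mult: "outer u v ** A = outer u (v v* A)"
  by (simp add: vec_eq_iff outer_def matrix_matrix_mult_def vector_matrix_mult_def sum_distrib_left mult_ac)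

lemma outer_outer: "outer u v ** outer w z = mat (dotp v w) ** outer u z"
  by (simp add: vec_eq_iff mat_mult_nth) (simp add: outer_def matrix_matrix_mult_def dotp_def sum_distrib_left sum_distrib_right mult_ac)

lemma trace_outer_outer:
  fixes u :: "'n::finite cvec"
  shows "trace (outer u v ** outer w z) = dotp v w * dotp z u"
proof -
  have "trace (mat x ** A) = x * trace A" for x and A :: "'n cmat"
    by (simp add: trace_def mat_mult_nth sum_distrib_left)
  then show ?thesis
    by (simp add: outer_outer) (simp add: trace_def outer_def dotp_def mult.commute)
qed

lemma trace_outer: "trace (outer u v) = dotp v u"
  by (simp add: trace_def outer_def dotp_def mult.commute)

lemma dotp_matrix: "dotp (v v* A) w = dotp v (A *v w)"
  by (simp add: dotp_def vector_matrix_mult_def matrix_vector_mult_def sum_distrib_left sum_distrib_right mult_ac)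
    (rule sum.swap)

lemma mat_scale_mult: "(mat x ** A) ** B = mat x ** (A ** B)" "A ** (mat x ** B) = mat x ** (A ** B)"
  for A B :: "'n::finite cmat"
proof -
  show "(mat x ** A) ** B = mat x ** (A ** B)" by (simp add: matrix_mul_assoc)
  have "(A ** (mat x ** B)) $ i $ j = (mat x ** (A ** B)) $ i $ j" for i j
    unfolding mat_mult_nth[of x "A ** B"] matrix_matrix_mult_def[of A] vec_lambda_beta mat_mult_nth sum_distrib_left
    by (intro sum.cong refl) (simp only: mult_ac)
  then show "A ** (mat x ** B) = mat x ** (A ** B)" by (simp add: vec_eq_iff)
qed

lemma trace_scale_mult: "trace ((mat x ** A) ** (mat y ** B)) = x * y * trace (A ** B)"
  for A B :: "'n::finite cmat"
  unfolding mat_scale_mult(1) unfolding mat_scale_mult(2)[of A]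
  by (simp add: trace_def mat_mult_nth sum_distrib_left mult.assoc)

text \<open>
  Tuples of matrices with rank one perturbations of the identity at the poles below \<open>c\<close> and an arbitrary
  invertible matrix at \<open>c\<close>.
\<close>
context
  fixes c :: "'n::{finite,linorder}" and t :: "'n \<Rightarrow> 'n cmat" and e g :: "'n \<Rightarrow> 'n cvec"
  assumes inv: "invertible (t c)"
    and refl: "\<And>a. a < c \<Longrightarrow> t a = mat 1 - outer (e a) (g a)"
begin

text \<open>
  Conjugation by powers of the matrix \<open>t c\<close> moves the vectors \<open>e b\<close> and \<open>g a\<close>; their pairings \<open>gm\<close> are
  the generators \<open>G(s) a b\<close>.
\<close>
definition ep :: "'n \<Rightarrow> int \<Rightarrow> 'n cvec" where "ep b s = mat_powi (t c) s *v e b"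

definition gp :: "'n \<Rightarrow> int \<Rightarrow> 'n cvec" where "gp a s = g a v* mat_powi (t c) s"

definition gm :: "'n \<Rightarrow> 'n \<Rightarrow> int \<Rightarrow> complex" where "gm a b s = dotp (g a v* mat_powi (t c) s) (e b)"

lemma dotp_gp_ep: "dotp (gp a s) (ep b r) = gm a b (s + r)"
  unfolding gp_def ep_def gm_def mat_powi_add[OF inv] vector_matrix_mul_assoc[symmetric] dotp_matrix ..

lemma conj_outer: "mat_powi (t c) s ** outer (e b) (g a) ** mat_powi (t c) r = outer (ep b s) (gp a r)"
  by (simp add: mult_outer outer_mult ep_def gp_def)

lemma ep_0: "ep b 0 = e b" and gp_0: "gp a 0 = g a"
  by (simp_all add: ep_def gp_def)

lemma M_ep: "t c *v ep b s = ep b (s + 1)" and gp_M: "gp a s v* t c = gp a (s + 1)"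
  using mat_powi_plus1[OF inv, of s] mat_powi_add[OF inv, of s 1]
  by (simp_all add: ep_def gp_def matrix_vector_mul_assoc vector_matrix_mul_assoc mat_powi_1[OF inv])

lemma M_outer: "t c ** outer (ep b s) v = outer (ep b (s + 1)) v"
  and outer_M: "outer v (gp a s) ** t c = outer v (gp a (s + 1))"
  by (simp_all add: mult_outer outer_mult M_ep gp_M)

text \<open>
  The gradient of \<open>inv_trace c k i j\<close> with respect to the matrix of the clashed pole. The two
  families of summands come from the factors in \<open>M\<^sub>h\<^sup>k\<close> and in \<open>M\<^sub>h\<^sup>-\<^sup>k\<close>.
\<close>
definition grad_c :: "nat \<Rightarrow> 'n \<Rightarrow> 'n \<Rightarrow> 'n cmat" where
  "grad_c k i j = (\<Sum>q<k. mat (gm j i (- int k)) ** outer (ep j (int k - 1 - int q)) (gp i (int q))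
      - mat (gm i j (int k)) ** outer (ep i (int q - int k)) (gp j (- int q - 1)))"

definition inv_grad :: "nat \<Rightarrow> 'n \<Rightarrow> 'n \<Rightarrow> 'n \<Rightarrow> 'n cmat" where
  "inv_grad k i j a =
     (if a = i then mat 1 - outer (ep j (int k)) (gp j (- int k)) else 0)
     + (if a = j then mat 1 - outer (ep i (- int k)) (gp i (int k)) else 0)
     + (if a = c then grad_c k i j else 0)"

lemma entry_deriv_inv_trace_unclashed:
  assumes ij: "i < c" "j < c" and a: "a < c"
  shows "entry_deriv a u v (inv_trace c (int k) i j) t = inv_grad k i j a $ v $ u"
proof -
  let ?E = "elem_mat u v" and ?M = "mat_powi (t c)"
  let ?t = "\<lambda>z. t(a := t a + mat z ** ?E)"
  have factor: "has_mat_derivative (\<lambda>z. ?t z x) (if a = x then ?E else 0) 0" for x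
    by (cases "a = x") (auto intro: has_mat_derivative_line has_mat_derivative_const)
  have "has_mat_derivative (\<lambda>z. ?t z i ** ?M (int k) ** ?t z j ** ?M (- int k))
     ((((if a = i then ?E else 0) ** ?M (int k) + ?t 0 i ** 0) ** ?t 0 j
        + (?t 0 i ** ?M (int k)) ** (if a = j then ?E else 0)) ** ?M (- int k)
      + (?t 0 i ** ?M (int k) ** ?t 0 j) ** 0) 0"
    by (intro has_mat_derivative_mult factor has_mat_derivative_const)
  moreover have "?t 0 = t" by (auto simp: vec_eq_iff mat_mult_nth)
  ultimately have D: "has_mat_derivative (\<lambda>z. ?t z i ** ?M (int k) ** ?t z j ** ?M (- int k))
     ((if a = i then ?E ** (?M (int k) ** t j ** ?M (- int k)) else 0)
      + (if a = j then t i ** ?M (int k) ** ?E ** ?M (- int k) else 0)) 0"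
    by (simp add: matrix_mult_distribs matrix_mul_assoc if_distrib[of "\<lambda>A. A ** _"] if_distrib[of "\<lambda>A. _ ** A"] cong: if_cong)
  have "inv_trace c (int k) i j (?t z) = trace (?t z i ** ?M (int k) ** ?t z j ** ?M (- int k))" for z
    using a less_imp_neq[OF a] by (auto simp: inv_trace_def)
  then have "entry_deriv a u v (inv_trace c (int k) i j) t
      = trace ((if a = i then ?E ** (?M (int k) ** t j ** ?M (- int k)) else 0)
        + (if a = j then t i ** ?M (int k) ** ?E ** ?M (- int k) else 0))"
    unfolding entry_deriv_def using DERIV_imp_deriv[OF trace_derivative[OF D]] by simp
  also have "\<dots> = (if a = i then trace (?E ** (?M (int k) ** t j ** ?M (- int k))) else 0)
      + (if a = j then trace (?E ** (?M (- int k) ** t i ** ?M (int k))) else 0)"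
    using trace_mul_sym[of "t i ** ?M (int k)" "?E ** ?M (- int k)"]
    by (simp add: trace_add matrix_mul_assoc trace_0[unfolded mat_0])
  also have "?M (int k) ** t j ** ?M (- int k) = mat 1 - outer (ep j (int k)) (gp j (- int k))"
    by (simp add: refl ij matrix_mult_distribs mat_powi_uminus[OF inv] conj_outer)
  also have "?M (- int k) ** t i ** ?M (int k) = mat 1 - outer (ep i (- int k)) (gp i (int k))"
    by (simp add: refl ij matrix_mult_distribs mat_powi_uminus[OF inv] conj_outer)
  finally show ?thesis
    using a by (simp add: inv_grad_def trace_elem_mat)
qed

lemma mat_powi_uminus_nat: "mat_powi A (- int q) = mat_pow (matrix_inv A) q"
  by (cases "q = 0") (simp_all add: mat_powi_def)

text \<open>
  With \<open>M\<^sub>i = 1 - R\<^sub>i\<close> and \<open>M\<^sub>j = 1 - R\<^sub>j\<close> only the product \<open>R\<^sub>i M\<^sub>h\<^sup>k R\<^sub>j M\<^sub>h\<^sup>-\<^sup>k\<close> depends on \<open>M\<^sub>h\<close> inside the trace.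
  In its derivative, the trace can be rotated such that the matrix unit stands in front of a product of two
  matrices of rank one.
\<close>
lemma entry_deriv_inv_trace_clashed:
  assumes ij: "i < c" "j < c"
  shows "entry_deriv c u v (inv_trace c (int k) i j) t = inv_grad k i j c $ v $ u"
proof -
  let ?E = "elem_mat u v" and ?M = "mat_powi (t c)" and ?I = "matrix_inv (t c)"
  let ?Ri = "outer (e i) (g i)" and ?Rj = "outer (e j) (g j)"
  define N where "N z = t c + mat z ** ?E" for z
  have N0: "N 0 = t c" by (simp add: N_def)
  have N: "has_mat_derivative N ?E 0" unfolding N_def by (rule has_mat_derivative_line)
  have NI: "has_mat_derivative (\<lambda>z. matrix_inv (N z)) (- (?I ** ?E ** ?I)) 0"
    and ev: "eventually (\<lambda>z. invertible (N z)) (nhds 0)"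
    using has_mat_derivative_inv[OF N] inv by (simp_all add: N0)
  define H where "H z = ?Ri ** mat_pow (N z) k ** ?Rj ** mat_pow (matrix_inv (N z)) k" for z
  define D1 where "D1 = (\<Sum>q<k. mat_pow (t c) q ** ?E ** mat_pow (t c) (k - 1 - q))"
  define D2 where "D2 = (\<Sum>q<k. mat_pow ?I q ** (- (?I ** ?E ** ?I)) ** mat_pow ?I (k - 1 - q))"
  have "has_mat_derivative (\<lambda>z. ?Ri ** mat_pow (N z) k) (0 ** mat_pow (N 0) k + ?Ri ** D1) 0"
    unfolding D1_def N0[symmetric] by (intro has_mat_derivative_mult has_mat_derivative_const has_mat_derivative_pow N)
  then have "has_mat_derivative H (((?Ri ** D1) ** ?Rj + ?Ri ** mat_pow (N 0) k ** 0) ** mat_pow (matrix_inv (N 0)) k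
      + ?Ri ** mat_pow (N 0) k ** ?Rj ** D2) 0"
    unfolding H_def D2_def N0[symmetric]
    by (intro has_mat_derivative_mult has_mat_derivative_const has_mat_derivative_pow NI[unfolded N0[symmetric]])
      (simp add: matrix_mult_distribs)
  then have H: "has_mat_derivative H (?Ri ** D1 ** ?Rj ** ?M (- int k) + ?Ri ** ?M (int k) ** ?Rj ** D2) 0"
    by (simp add: matrix_mult_distribs N0 mat_powi_uminus_nat mat_powi_nat)
  have trace_eq: "inv_trace c (int k) i j (t(c := N z)) = of_nat CARD('n) - trace ?Ri - trace ?Rj + trace (H z)"
    if "invertible (N z)" for z
  proof -
    let ?N = "mat_powi (N z)"
    have one: "?N (int k) ** ?N (- int k) = mat 1" "?N (- int k) ** ?N (int k) = mat 1"
      using mat_powi_uminus[OF that, of "int k"] by auto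
    have "trace (?N (int k) ** ?Rj ** ?N (- int k)) = trace (?N (- int k) ** ?N (int k) ** ?Rj)"
      using trace_mul_sym[of "?N (int k) ** ?Rj" "?N (- int k)"] by (simp add: matrix_mul_assoc)
    moreover have "trace (?Ri ** ?N (int k) ** ?N (- int k)) = trace ?Ri"
      by (simp add: matrix_mul_assoc[symmetric] one)
    moreover have "H z = ?Ri ** ?N (int k) ** ?Rj ** ?N (- int k)"
      by (simp add: H_def mat_powi_uminus_nat mat_powi_nat)
    ultimately show ?thesis
      using ij less_imp_neq[OF ij(1)] less_imp_neq[OF ij(2)]
      by (simp add: inv_trace_def refl matrix_mult_distribs trace_sub trace_I one)
  qed
  have "((\<lambda>z. of_nat CARD('n) - trace ?Ri - trace ?Rj + trace (H z)) has_field_derivative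
      trace (?Ri ** D1 ** ?Rj ** ?M (- int k) + ?Ri ** ?M (int k) ** ?Rj ** D2)) (at 0)"
    using DERIV_add[OF DERIV_const trace_derivative[OF H]] by simp
  moreover have "eventually (\<lambda>z. inv_trace c (int k) i j (t(c := N z)) =
      of_nat CARD('n) - trace ?Ri - trace ?Rj + trace (H z)) (nhds 0)"
    using ev by (rule eventually_mono) (rule trace_eq)
  ultimately have "((\<lambda>z. inv_trace c (int k) i j (t(c := N z))) has_field_derivative
      trace (?Ri ** D1 ** ?Rj ** ?M (- int k) + ?Ri ** ?M (int k) ** ?Rj ** D2)) (at 0)"
    by (subst DERIV_cong_ev[OF HOL.refl _ HOL.refl])
  then have "entry_deriv c u v (inv_trace c (int k) i j) t
      = trace (?Ri ** D1 ** ?Rj ** ?M (- int k)) + trace (?Ri ** ?M (int k) ** ?Rj ** D2)"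
    unfolding entry_deriv_def N_def using DERIV_imp_deriv trace_add by metis
  also have "trace (?Ri ** D1 ** ?Rj ** ?M (- int k)) =
      (\<Sum>q<k. trace (?E ** (mat (gm j i (- int k)) ** outer (ep j (int k - 1 - int q)) (gp i (int q)))))"
    unfolding D1_def matrix_mult_sums trace_sum
  proof (rule sum.cong[OF HOL.refl])
    fix q assume q: "q \<in> {..<k}"
    have "int k - 1 - int q = int (k - 1 - q)" using q by auto
    then have p: "mat_pow (t c) (k - 1 - q) = ?M (int k - 1 - int q)" "mat_pow (t c) q = ?M (int q)"
      by (simp_all only: mat_powi_nat)
    have "trace (?Ri ** (mat_pow (t c) q ** ?E ** mat_pow (t c) (k - 1 - q)) ** ?Rj ** ?M (- int k))
        = trace ((?Ri ** ?M (int q)) ** (?E ** (?M (int k - 1 - int q) ** ?Rj ** ?M (- int k))))"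
      unfolding p by (simp add: matrix_mul_assoc)
    also have "\<dots> = trace (?E ** ((?M (int k - 1 - int q) ** ?Rj ** ?M (- int k)) ** (?M 0 ** ?Ri ** ?M (int q))))"
      by (subst trace_mul_sym) (simp add: matrix_mul_assoc)
    also have "(?M (int k - 1 - int q) ** ?Rj ** ?M (- int k)) ** (?M 0 ** ?Ri ** ?M (int q))
        = mat (gm j i (- int k)) ** outer (ep j (int k - 1 - int q)) (gp i (int q))"
      unfolding conj_outer outer_outer dotp_gp_ep by simp
    finally show "trace (?Ri ** (mat_pow (t c) q ** ?E ** mat_pow (t c) (k - 1 - q)) ** ?Rj ** ?M (- int k))
        = trace (?E ** (mat (gm j i (- int k)) ** outer (ep j (int k - 1 - int q)) (gp i (int q))))" .
  qed
  also have "trace (?Ri ** ?M (int k) ** ?Rj ** D2) =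
      (\<Sum>q<k. - trace (?E ** (mat (gm i j (int k)) ** outer (ep i (int q - int k)) (gp j (- int q - 1)))))"
    unfolding D2_def matrix_mult_sums trace_sum
  proof (rule sum.cong[OF HOL.refl])
    fix q assume q: "q \<in> {..<k}"
    have p: "mat_pow ?I q ** ?I = ?M (- int q - 1)" "?I ** mat_pow ?I (k - 1 - q) = ?M (int q - int k)"
    proof -
      have "mat_pow ?I q ** ?I = ?M (- int (Suc q))"
        unfolding mat_powi_uminus_nat mat_pow_Suc_right ..
      also have "- int (Suc q) = - int q - 1" by simp
      finally show "mat_pow ?I q ** ?I = ?M (- int q - 1)" .
      have "?I ** mat_pow ?I (k - 1 - q) = ?M (- int (Suc (k - 1 - q)))"
        unfolding mat_powi_uminus_nat mat_pow_Suc ..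
      also have "- int (Suc (k - 1 - q)) = int q - int k" using q by auto
      finally show "?I ** mat_pow ?I (k - 1 - q) = ?M (int q - int k)" .
    qed
    have "?Ri ** ?M (int k) ** ?Rj ** (mat_pow ?I q ** (- (?I ** ?E ** ?I)) ** mat_pow ?I (k - 1 - q))
        = - (?Ri ** ?M (int k) ** ?Rj ** ((mat_pow ?I q ** ?I) ** ?E ** (?I ** mat_pow ?I (k - 1 - q))))"
      by (simp add: matrix_mult_distribs matrix_mul_assoc)
    also have "\<dots> = - ((?Ri ** ?M (int k) ** ?Rj ** ?M (- int q - 1)) ** (?E ** ?M (int q - int k)))"
      unfolding p by (simp add: matrix_mul_assoc)
    finally have "trace (?Ri ** ?M (int k) ** ?Rj ** (mat_pow ?I q ** (- (?I ** ?E ** ?I)) ** mat_pow ?I (k - 1 - q)))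
        = - trace ((?E ** ?M (int q - int k)) ** (?Ri ** ?M (int k) ** ?Rj ** ?M (- int q - 1)))"
      using trace_mul_sym[of "?E ** ?M (int q - int k)"] by (simp add: trace_def sum_negf)
    also have "(?E ** ?M (int q - int k)) ** (?Ri ** ?M (int k) ** ?Rj ** ?M (- int q - 1))
        = ?E ** ((?M (int q - int k) ** ?Ri ** ?M (int k)) ** (?M 0 ** ?Rj ** ?M (- int q - 1)))"
      by (simp add: matrix_mul_assoc)
    also have "(?M (int q - int k) ** ?Ri ** ?M (int k)) ** (?M 0 ** ?Rj ** ?M (- int q - 1))
        = mat (gm i j (int k)) ** outer (ep i (int q - int k)) (gp j (- int q - 1))"
      unfolding conj_outer outer_outer dotp_gp_ep by simp
    finally show "trace (?Ri ** ?M (int k) ** ?Rj ** (mat_pow ?I q ** (- (?I ** ?E ** ?I)) ** mat_pow ?I (k - 1 - q)))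
        = - trace (?E ** (mat (gm i j (int k)) ** outer (ep i (int q - int k)) (gp j (- int q - 1))))" .
  qed
  finally show ?thesis
    using ij less_imp_neq[OF ij(1)] less_imp_neq[OF ij(2)] by (simp add: inv_grad_def grad_c_def trace_elem_mat sum_subtractf sum_negf)
qed

lemma entry_deriv_inv_trace:
  assumes "i < c" "j < c" "a \<le> c"
  shows "entry_deriv a u v (inv_trace c (int k) i j) t = inv_grad k i j a $ v $ u"
  using assms entry_deriv_inv_trace_unclashed entry_deriv_inv_trace_clashed by (cases "a = c") auto

text \<open>
  Multiplication of \<open>grad_c\<close> by \<open>t c\<close> from the left or from the right yields sums of the matrices
  \<open>end_x\<close> and \<open>end_y\<close> with consecutive \<open>q\<close>. In the commutator these sums telescope to the values at
  the ends \<open>q = 0\<close> and \<open>q = k\<close>.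
\<close>
definition end_x :: "nat \<Rightarrow> 'n \<Rightarrow> 'n \<Rightarrow> nat \<Rightarrow> 'n cmat" where
  "end_x k i j q = outer (ep j (int k - int q)) (gp i (int q))"

definition end_y :: "nat \<Rightarrow> 'n \<Rightarrow> 'n \<Rightarrow> nat \<Rightarrow> 'n cmat" where
  "end_y k i j q = outer (ep i (int q - int k)) (gp j (- int q))"

text \<open>
  For involutions the contribution of equal indices vanishes, in agreement with the sign of zero.
\<close>
lemma ks_pair_reflections:
  assumes ab: "a < c" "b < c" and sq: "t a ** t a = mat 1"
  shows "ks_pair t a A b B = 1 / 2 * ord_sign a b * trace ((t a ** A - A ** t a) ** (t b ** B - B ** t b))"
proof -
  consider "a < b" | "a = b" | "b < a" by fastforce
  then show ?thesis
  proof cases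
    case 1
    then show ?thesis by (simp add: ks_pair_less ord_sign_def)
  next
    case 2
    have "trace (t a ** A ** (B ** t a)) = trace (A ** B ** (t a ** t a))"
      using trace_mul_sym[of "t a" "A ** B ** t a"] by (simp add: matrix_mul_assoc)
    moreover have "A ** t a ** (t a ** B) = A ** (t a ** t a) ** B" by (simp add: matrix_mul_assoc)
    ultimately have "ks_pair t a A a B = 0" by (simp add: ks_pair_same sq)
    then show ?thesis by (simp add: 2 ord_sign_def)
  next
    case 3
    then show ?thesis
      using ks_pair_swap[where a = a and b = b and A = A and B = B and t = t] ks_pair_less[of b a t B A]
        trace_mul_sym[of "t a ** A - A ** t a" "t b ** B - B ** t b"]
      by (auto simp: ord_sign_def)
  qed
qed

text \<open>The symmetries of the generators. The second one makes the matrices below \<open>c\<close> reflections.\<close>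
context
  assumes gm_swap: "\<And>a b s. a < c \<Longrightarrow> b < c \<Longrightarrow> gm b a (- s) = gm a b s"
    and gm_diag: "\<And>a. a < c \<Longrightarrow> gm a a 0 = 2"
begin

lemma reflection_square: "a < c \<Longrightarrow> t a ** t a = mat 1"
proof -
  assume a: "a < c"
  have "dotp (g a) (e a) = 2" using gm_diag[OF a] by (simp add: gm_def)
  then have "outer (e a) (g a) ** outer (e a) (g a) = outer (e a) (g a) + outer (e a) (g a)"
    by (simp add: outer_outer vec_eq_iff mat_mult_nth)
  then show ?thesis by (simp add: refl[OF a] matrix_mult_distribs)
qed

lemma commutator_grads:
  assumes ij: "i < c" "j < c"
  shows "t i ** (mat 1 - outer (ep j (int k)) (gp j (- int k))) - (mat 1 - outer (ep j (int k)) (gp j (- int k))) ** t i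
      = mat (gm i j (int k)) ** (end_y k i j k - end_x k i j 0)"
    and "t j ** (mat 1 - outer (ep i (- int k)) (gp i (int k))) - (mat 1 - outer (ep i (- int k)) (gp i (int k))) ** t j
      = mat (gm i j (int k)) ** (end_x k i j k - end_y k i j 0)"
proof -
  have sw: "gm j i (- int k) = gm i j (int k)" using gm_swap ij by blast
  have comm: "(mat 1 - A) ** (mat 1 - B) - (mat 1 - B) ** (mat 1 - A) = A ** B - B ** A" for A B :: "'n cmat"
    by (simp add: matrix_mult_distribs)
  have i: "t i = mat 1 - outer (ep i 0) (gp i 0)" and j: "t j = mat 1 - outer (ep j 0) (gp j 0)"
    using ij by (simp_all add: refl ep_0 gp_0)
  show "t i ** (mat 1 - outer (ep j (int k)) (gp j (- int k))) - (mat 1 - outer (ep j (int k)) (gp j (- int k))) ** t i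
      = mat (gm i j (int k)) ** (end_y k i j k - end_x k i j 0)"
    unfolding i comm outer_outer dotp_gp_ep by (simp add: sw end_x_def end_y_def matrix_mult_distribs)
  show "t j ** (mat 1 - outer (ep i (- int k)) (gp i (int k))) - (mat 1 - outer (ep i (- int k)) (gp i (int k))) ** t j
      = mat (gm i j (int k)) ** (end_x k i j k - end_y k i j 0)"
    unfolding j comm outer_outer dotp_gp_ep by (simp add: sw end_x_def end_y_def matrix_mult_distribs)
qed

lemma grad_c_products:
  assumes ij: "i < c" "j < c"
  shows "t c ** grad_c k i j = mat (gm i j (int k)) ** (\<Sum>q<k. end_x k i j q - end_y k i j (Suc q))"
    and "grad_c k i j ** t c = mat (gm i j (int k)) ** (\<Sum>q<k. end_x k i j (Suc q) - end_y k i j q)"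
proof -
  have sw: "gm j i (- int k) = gm i j (int k)" using gm_swap ij by blast
  show "t c ** grad_c k i j = mat (gm i j (int k)) ** (\<Sum>q<k. end_x k i j q - end_y k i j (Suc q))"
    unfolding grad_c_def sw matrix_mult_sums matrix_mult_distribs mat_scale_mult M_outer end_x_def end_y_def
  proof (rule sum.cong[OF HOL.refl])
    fix q
    have "int k - 1 - int q + 1 = int k - int q" "int q - int k + 1 = int (Suc q) - int k" "- int q - 1 = - int (Suc q)"
      by simp_all
    then show "mat (gm i j (int k)) ** outer (ep j (int k - 1 - int q + 1)) (gp i (int q))
        - mat (gm i j (int k)) ** outer (ep i (int q - int k + 1)) (gp j (- int q - 1))
      = mat (gm i j (int k)) ** outer (ep j (int k - int q)) (gp i (int q))
        - mat (gm i j (int k)) ** outer (ep i (int (Suc q) - int k)) (gp j (- int (Suc q)))"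
      by (simp only:)
  qed
  show "grad_c k i j ** t c = mat (gm i j (int k)) ** (\<Sum>q<k. end_x k i j (Suc q) - end_y k i j q)"
    unfolding grad_c_def sw matrix_mult_sums matrix_mult_distribs mat_scale_mult outer_M end_x_def end_y_def
  proof (rule sum.cong[OF HOL.refl])
    fix q
    have "int k - 1 - int q = int k - int (Suc q)" "int q + 1 = int (Suc q)" "- int q - 1 + 1 = - int q"
      by simp_all
    then show "mat (gm i j (int k)) ** outer (ep j (int k - 1 - int q)) (gp i (int q + 1))
        - mat (gm i j (int k)) ** outer (ep i (int q - int k)) (gp j (- int q - 1 + 1))
      = mat (gm i j (int k)) ** outer (ep j (int k - int (Suc q))) (gp i (int (Suc q)))
        - mat (gm i j (int k)) ** outer (ep i (int q - int k)) (gp j (- int q))"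
      by (simp only:)
  qed
qed

text \<open>
  It is minus the sum of the commutators in \<open>commutator_grads\<close>: the function is
  invariant under simultaneous conjugation, and therefore the commutators of the matrices with
  the gradients add up to zero.
\<close>
lemma commutator_grad_c:
  assumes ij: "i < c" "j < c"
  shows "t c ** grad_c k i j - grad_c k i j ** t c = - (mat (gm i j (int k)) ** (end_y k i j k - end_x k i j 0)
      + mat (gm i j (int k)) ** (end_x k i j k - end_y k i j 0))"
proof -
  have tele: "(\<Sum>q<k. F (Suc q)) = (\<Sum>q<k. F q) + F k - F 0" for F :: "nat \<Rightarrow> 'n cmat" and k
    by (induction k) (simp_all add: algebra_simps)
  show ?thesis
    unfolding grad_c_products[OF ij] sum_subtractf tele[of "end_x k i j"] tele[of "end_y k i j"]
    by (simp add: matrix_mult_distribs algebra_simps)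
qed

text \<open>\<open>U\<close> and \<open>V\<close> are the two ways of pairing the four vectors.\<close>
lemma trace_ends:
  fixes k m q r :: nat
  assumes ind: "i < c" "j < c" "p < c" "l < c"
  defines "U \<equiv> \<lambda>s. gm i l s * gm p j (int k + int m - s)"
    and "V \<equiv> \<lambda>s. gm i p s * gm j l (s + int m - int k)"
  shows "trace (end_x k i j q ** end_x m p l r) = U (int q + int m - int r)"
    and "trace (end_x k i j q ** end_y m p l r) = V (int q + int r - int m)"
    and "trace (end_y k i j q ** end_x m p l r) = V (int k - int q - int r)"
    and "trace (end_y k i j q ** end_y m p l r) = U (int k + int r - int q)"
proof -
  show "trace (end_x k i j q ** end_x m p l r) = U (int q + int m - int r)"
    unfolding end_x_def trace_outer_outer dotp_gp_ep U_def by (simp add: algebra_simps)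
  have "int k - int q - int r = - (int q + int r - int k)" by simp
  then have "gm l j (int k - int q - int r) = gm j l (int q + int r - int k)"
    using gm_swap ind by metis
  then show "trace (end_x k i j q ** end_y m p l r) = V (int q + int r - int m)"
    unfolding end_x_def end_y_def trace_outer_outer dotp_gp_ep V_def by (simp add: algebra_simps)
  have "int q + int r - int k = - (int k - int q - int r)" by simp
  then have "gm p i (int q + int r - int k) = gm i p (int k - int q - int r)"
    using gm_swap ind by metis
  then show "trace (end_y k i j q ** end_x m p l r) = V (int k - int q - int r)"
    unfolding end_x_def end_y_def trace_outer_outer dotp_gp_ep V_def by (simp add: algebra_simps)
  have "int r - int q - int m = - (int q + int m - int r)" "int q - int r - int k = - (int k + int r - int q)"
    by simp_all
  then have "gm j p (int r - int q - int m) = gm p j (int q + int m - int r)"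
    "gm l i (int q - int r - int k) = gm i l (int k + int r - int q)"
    using gm_swap ind by metis+
  then show "trace (end_y k i j q ** end_y m p l r) = U (int k + int r - int q)"
    unfolding end_y_def trace_outer_outer dotp_gp_ep U_def by (simp add: algebra_simps)
qed

text \<open>
  \<open>\<xi>1\<close>, \<open>\<xi>2\<close> and \<open>\<eta>1\<close>, \<open>\<eta>2\<close> are the commutators of the reflections with the gradients. The commutators at the
  clashed pole are minus their sums. The pairs of a reflection with the clashed pole give
  traces of products of these sums with opposite signs, as the clashed pole is the last one, and
  cancel. There remain the pairs of reflections, with their signs, and the clashed pole paired
  with itself.
\<close>
lemma ks_bracket_reflections:
  assumes ind: "i < c" "j < c" "p < c" "l < c"
    and k0: "k = 0 \<Longrightarrow> i < j" and m0: "m = 0 \<Longrightarrow> p < l"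
  defines "h \<equiv> \<lambda>a b q. if q = 0 then (if a < b then gm a b 0 else if a = b then 1 else 0) else gm a b (int q)"
  shows "ks_bracket c (inv_trace c (int k) i j) (inv_trace c (int m) p l) t
     = gm i j (int k) * gm p l (int m) * level_bracket h i j k p l m"
proof -
  define U where "U s = gm i l s * gm p j (int k + int m - s)" for s
  define V where "V s = gm i p s * gm j l (s + int m - int k)" for s
  note tr = trace_ends[OF ind, of k _ m, folded U_def V_def]
  define \<kappa> where "\<kappa> = gm i j (int k)"
  define \<kappa>' where "\<kappa>' = gm p l (int m)"
  let ?A1 = "mat 1 - outer (ep j (int k)) (gp j (- int k))"
  let ?A2 = "mat 1 - outer (ep i (- int k)) (gp i (int k))"
  let ?A3 = "grad_c k i j"
  let ?B1 = "mat 1 - outer (ep l (int m)) (gp l (- int m))"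
  let ?B2 = "mat 1 - outer (ep p (- int m)) (gp p (int m))"
  let ?B3 = "grad_c m p l"
  define \<xi>1 where "\<xi>1 = mat \<kappa> ** (end_y k i j k - end_x k i j 0)"
  define \<xi>2 where "\<xi>2 = mat \<kappa> ** (end_x k i j k - end_y k i j 0)"
  define \<eta>1 where "\<eta>1 = mat \<kappa>' ** (end_y m p l m - end_x m p l 0)"
  define \<eta>2 where "\<eta>2 = mat \<kappa>' ** (end_x m p l m - end_y m p l 0)"
  have \<xi>: "t i ** ?A1 - ?A1 ** t i = \<xi>1" "t j ** ?A2 - ?A2 ** t j = \<xi>2" "t c ** ?A3 - ?A3 ** t c = - (\<xi>1 + \<xi>2)"
    unfolding \<xi>1_def \<xi>2_def \<kappa>_def using commutator_grads[OF ind(1,2), of k] commutator_grad_c[OF ind(1,2), of k] by simp_all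
  have \<eta>: "t p ** ?B1 - ?B1 ** t p = \<eta>1" "t l ** ?B2 - ?B2 ** t l = \<eta>2" "t c ** ?B3 - ?B3 ** t c = - (\<eta>1 + \<eta>2)"
    unfolding \<eta>1_def \<eta>2_def \<kappa>'_def using commutator_grads[OF ind(3,4), of m] commutator_grad_c[OF ind(3,4), of m] by simp_all
  have pick: "(\<Sum>a\<in>{..c}. F a ((if a = i then X1 else 0) + (if a = j then X2 else 0) + (if a = c then X3 else 0)))
      = F i X1 + F j X2 + F c X3"
    if ij: "i \<le> c" "j \<le> c" and add: "\<And>a X Y. F a (X + Y) = F a X + F a Y" and zero: "\<And>a. F a 0 = 0"
    for F :: "'n \<Rightarrow> 'n cmat \<Rightarrow> complex" and i j X1 X2 X3
  proof -
    have single: "F a (if a = x then X else 0) = (if a = x then F x X else 0)" for a x X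
      by (auto simp: zero)
    show ?thesis unfolding add single using ij by (simp add: sum.distrib)
  qed
  have expand: "ks_bracket c (inv_trace c (int k) i j) (inv_trace c (int m) p l) t =
      (ks_pair t i ?A1 p ?B1 + ks_pair t i ?A1 l ?B2 + ks_pair t i ?A1 c ?B3)
    + (ks_pair t j ?A2 p ?B1 + ks_pair t j ?A2 l ?B2 + ks_pair t j ?A2 c ?B3)
    + (ks_pair t c ?A3 p ?B1 + ks_pair t c ?A3 l ?B2 + ks_pair t c ?A3 c ?B3)"
  proof -
    have inner: "(\<Sum>b\<in>{..c}. ks_pair t a A b (inv_grad m p l b))
        = ks_pair t a A p ?B1 + ks_pair t a A l ?B2 + ks_pair t a A c ?B3" for a A
      unfolding inv_grad_def
      by (rule pick[where F = "\<lambda>b B. ks_pair t a A b B"]) (use ind in \<open>auto simp: ks_pair_add ks_pair_zero\<close>)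
    have "ks_bracket c (inv_trace c (int k) i j) (inv_trace c (int m) p l) t =
       (\<Sum>a\<in>{..c}. \<Sum>b\<in>{..c}. ks_pair t a (inv_grad k i j a) b (inv_grad m p l b))"
      by (intro ks_bracket_gradient entry_deriv_inv_trace ind)
    also have "\<dots> = (\<Sum>a\<in>{..c}. ks_pair t a (inv_grad k i j a) p ?B1 + ks_pair t a (inv_grad k i j a) l ?B2
        + ks_pair t a (inv_grad k i j a) c ?B3)"
      unfolding inner ..
    also have "\<dots> = (ks_pair t i ?A1 p ?B1 + ks_pair t i ?A1 l ?B2 + ks_pair t i ?A1 c ?B3)
      + (ks_pair t j ?A2 p ?B1 + ks_pair t j ?A2 l ?B2 + ks_pair t j ?A2 c ?B3)
      + (ks_pair t c ?A3 p ?B1 + ks_pair t c ?A3 l ?B2 + ks_pair t c ?A3 c ?B3)"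
      unfolding inv_grad_def[of k]
      by (rule pick[where F = "\<lambda>a A. ks_pair t a A p ?B1 + ks_pair t a A l ?B2 + ks_pair t a A c ?B3"])
        (use ind in \<open>auto simp: ks_pair_add ks_pair_zero\<close>)
    finally show ?thesis .
  qed
  have refl_part: "ks_pair t i ?A1 p ?B1 = 1 / 2 * ord_sign i p * trace (\<xi>1 ** \<eta>1)"
    "ks_pair t i ?A1 l ?B2 = 1 / 2 * ord_sign i l * trace (\<xi>1 ** \<eta>2)"
    "ks_pair t j ?A2 p ?B1 = 1 / 2 * ord_sign j p * trace (\<xi>2 ** \<eta>1)"
    "ks_pair t j ?A2 l ?B2 = 1 / 2 * ord_sign j l * trace (\<xi>2 ** \<eta>2)"
    unfolding \<xi>[symmetric] \<eta>[symmetric] by (intro ks_pair_reflections ind reflection_square)+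
  have cross: "ks_pair t i ?A1 c ?B3 = - 1 / 2 * trace (\<xi>1 ** (- (\<eta>1 + \<eta>2)))"
    "ks_pair t j ?A2 c ?B3 = - 1 / 2 * trace (\<xi>2 ** (- (\<eta>1 + \<eta>2)))"
    "ks_pair t c ?A3 p ?B1 = 1 / 2 * trace (\<eta>1 ** (- (\<xi>1 + \<xi>2)))"
    "ks_pair t c ?A3 l ?B2 = 1 / 2 * trace (\<eta>2 ** (- (\<xi>1 + \<xi>2)))"
    using ks_pair_less[OF ind(1), of t ?A1 ?B3] ks_pair_less[OF ind(2), of t ?A2 ?B3]
      ks_pair_less[OF ind(3), of t ?B1 ?A3] ks_pair_less[OF ind(4), of t ?B2 ?A3]
      ks_pair_swap[where a = p and b = c and t = t and B = ?A3 and A = ?B1]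
      ks_pair_swap[where a = l and b = c and t = t and B = ?A3 and A = ?B2] less_imp_neq[OF ind(3)] less_imp_neq[OF ind(4)]
    unfolding \<xi> \<eta> by simp_all
  have neg: "trace (- A) = - trace A" for A :: "'n cmat" by (simp add: trace_def sum_negf)
  have cancel: "ks_pair t i ?A1 c ?B3 + ks_pair t j ?A2 c ?B3 + ks_pair t c ?A3 p ?B1 + ks_pair t c ?A3 l ?B2 = 0"
    unfolding cross matrix_mult_distribs neg trace_add
    using trace_mul_sym[of \<eta>1 \<xi>1] trace_mul_sym[of \<eta>1 \<xi>2] trace_mul_sym[of \<eta>2 \<xi>1] trace_mul_sym[of \<eta>2 \<xi>2]
    by (simp add: field_simps)
  have traces: "trace (\<xi>1 ** \<eta>1) = \<kappa> * \<kappa>' * (2 * (U (int m) - V 0))"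
    "trace (\<xi>1 ** \<eta>2) = \<kappa> * \<kappa>' * (2 * (V (- int m) - U 0))"
    "trace (\<xi>2 ** \<eta>1) = \<kappa> * \<kappa>' * (2 * (V (int k) - U (int k + int m)))"
    "trace (\<xi>2 ** \<eta>2) = \<kappa> * \<kappa>' * (2 * (U (int k) - V (int k - int m)))"
    unfolding \<xi>1_def \<xi>2_def \<eta>1_def \<eta>2_def trace_scale_mult matrix_mult_distribs trace_sub tr
    by (simp_all add: algebra_simps)
  have "ks_pair t c ?A3 c ?B3 = \<kappa> * \<kappa>' * (double_step_sum k m U - double_step_sum k m (\<lambda>s. V (s - int m)))"
  proof -
    have prod: "trace ((\<Sum>q<k. F q - F' q) ** (\<Sum>r<m. G r - G' r)) =
       (\<Sum>q<k. \<Sum>r<m. trace (F q ** G r)) - (\<Sum>q<k. \<Sum>r<m. trace (F q ** G' r))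
        - (\<Sum>q<k. \<Sum>r<m. trace (F' q ** G r)) + (\<Sum>q<k. \<Sum>r<m. trace (F' q ** G' r))"
      for F F' G G' :: "nat \<Rightarrow> 'n cmat"
      unfolding matrix_mult_sums trace_sum
      by (simp add: matrix_mult_distribs matrix_mult_sums trace_sum trace_sub sum_subtractf)
        (simp add: sum.swap[of _ "{..<m}" "{..<k}"])
    have rev: "sum f {..<n} = sum f' {..<n}" if "\<And>q. q < n \<Longrightarrow> f q = f' (n - 1 - q)" for n and f f' :: "nat \<Rightarrow> complex"
      by (rule sum.reindex_bij_witness[of _ "\<lambda>q. n - 1 - q" "\<lambda>q. n - 1 - q"]) (auto simp: that)
    have left: "trace ((t c ** ?A3) ** (?B3 ** t c)) = \<kappa> * \<kappa>' *
       ((\<Sum>q<k. \<Sum>r<m. U (int q + int m - int (Suc r))) - (\<Sum>q<k. \<Sum>r<m. V (int q + int r - int m))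
       - (\<Sum>q<k. \<Sum>r<m. V (int k - int (Suc q) - int (Suc r))) + (\<Sum>q<k. \<Sum>r<m. U (int k + int r - int (Suc q))))"
      unfolding grad_c_products[OF ind(1,2)] grad_c_products[OF ind(3,4)] trace_scale_mult prod tr
        \<kappa>_def \<kappa>'_def by (simp only: mult_ac)
    have right: "trace ((?A3 ** t c) ** (t c ** ?B3)) = \<kappa> * \<kappa>' *
       ((\<Sum>q<k. \<Sum>r<m. U (int (Suc q) + int m - int r)) - (\<Sum>q<k. \<Sum>r<m. V (int (Suc q) + int (Suc r) - int m))
       - (\<Sum>q<k. \<Sum>r<m. V (int k - int q - int r)) + (\<Sum>q<k. \<Sum>r<m. U (int k + int (Suc r) - int q)))"
      unfolding grad_c_products[OF ind(1,2)] grad_c_products[OF ind(3,4)] trace_scale_mult prod tr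
        \<kappa>_def \<kappa>'_def by (simp only: mult_ac)
    have r1: "(\<Sum>q<k. \<Sum>r<m. U (int q + int m - int (Suc r))) = (\<Sum>q<k. \<Sum>r<m. U (int q + int r))"
      by (rule sum.cong[OF HOL.refl], rule rev, rule arg_cong[where f = U], simp add: of_nat_diff)
    have r2: "(\<Sum>q<k. \<Sum>r<m. U (int (Suc q) + int m - int r)) = (\<Sum>q<k. \<Sum>r<m. U (int q + int r + 2))"
      by (rule sum.cong[OF HOL.refl], rule rev, rule arg_cong[where f = U], simp add: of_nat_diff)
    have r3: "(\<Sum>q<k. \<Sum>r<m. U (int k + int r - int (Suc q))) = (\<Sum>q<k. \<Sum>r<m. U (int q + int r))"
      by (rule rev, rule sum.cong[OF HOL.refl], rule arg_cong[where f = U], simp add: of_nat_diff)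
    have r4: "(\<Sum>q<k. \<Sum>r<m. U (int k + int (Suc r) - int q)) = (\<Sum>q<k. \<Sum>r<m. U (int q + int r + 2))"
      by (rule rev, rule sum.cong[OF HOL.refl], rule arg_cong[where f = U], simp add: of_nat_diff)
    have r5: "(\<Sum>q<k. \<Sum>r<m. V (int k - int (Suc q) - int (Suc r))) = (\<Sum>q<k. \<Sum>r<m. V (int q + int r - int m))"
      by (rule rev, rule rev, rule arg_cong[where f = V], simp add: of_nat_diff)
    have r6: "(\<Sum>q<k. \<Sum>r<m. V (int k - int q - int r)) = (\<Sum>q<k. \<Sum>r<m. V (int q + int r + 2 - int m))"
      by (rule rev, rule rev, rule arg_cong[where f = V], simp add: of_nat_diff)
    have r7: "(\<Sum>q<k. \<Sum>r<m. V (int (Suc q) + int (Suc r) - int m)) = (\<Sum>q<k. \<Sum>r<m. V (int q + int r + 2 - int m))"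
      by (simp add: algebra_simps)
    show ?thesis
      unfolding ks_pair_same left right r1 r2 r3 r4 r5 r6 r7 double_step_sum_def sum_subtractf
      by (simp add: algebra_simps)
  qed
  then have "ks_bracket c (inv_trace c (int k) i j) (inv_trace c (int m) p l) t = \<kappa> * \<kappa>' *
     (ord_sign i p * (U (int m) - V 0) + ord_sign i l * (V (- int m) - U 0)
       + ord_sign j p * (V (int k) - U (int k + int m)) + ord_sign j l * (U (int k) - V (int k - int m))
       + double_step_sum k m U - double_step_sum k m (\<lambda>s. V (s - int m)))"
    using cancel unfolding expand refl_part traces by (simp add: algebra_simps)
  also have "\<dots> = \<kappa> * \<kappa>' * level_bracket h i j k p l m"
    unfolding U_def[abs_def] V_def[abs_def] h_def
    by (intro arg_cong2[where f = "(*)"] HOL.refl level_bracket_closed_form) (use gm_swap gm_diag ind k0 m0 in auto)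
  finally show ?thesis by (simp add: \<kappa>_def \<kappa>'_def)
qed
end
end

section \<open>The Korotkin--Samtleben bracket on monodromy data\<close>

lemma elem_mat_gram: "elem_mat a a ** gram S = outer (axis a 1) (gram S $ a)"
proof -
  have "(elem_mat a a ** gram S) $ i $ j = mat 1 $ i $ j - refl_mat S a $ i $ j" for i j
    by (simp add: refl_mat_def)
  then show ?thesis
    by (auto simp: vec_eq_iff refl_mat_nth outer_def axis_def mat_def)
qed

lemma refl_mat_outer: "refl_mat S a = mat 1 - outer (axis a 1) (gram S $ a)"
  by (simp add: refl_mat_def elem_mat_gram)

lemma dotp_axis: "dotp v (axis b 1) = v $ b"
  by (simp add: dotp_def axis_def if_distrib[of "\<lambda>x. _ * x"] cong: if_cong)

lemma dotp_gram: "dotp (gram S $ a v* mat_powi (M_h c S) s) (axis b 1) = realized_gen c S s a b"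
  by (simp add: dotp_axis realized_gen_def row_matrix_mult)

lemma realized_gen_unit: "upper_unitriangular S \<Longrightarrow> realized_gen c S 0 a a = 2"
  by (simp add: realized_gen_0 upper_unitriangular_def)

lemma realized_gen_stokes_coeff:
  assumes "upper_unitriangular S" "k = 0 \<Longrightarrow> i < j"
  shows "realized_gen c S (int k) i j = stokes_coeff c S i j k"
  using assms by (cases "k = 0") (auto simp: stokes_coeff_def realized_gen_0 upper_unitriangular_def)

lemma stokes_coeff_eq:
  assumes "upper_unitriangular S"
  shows "stokes_coeff c S i j k =
    (if k = 0 then (if i < j then realized_gen c S 0 i j else if i = j then 1 else 0) else realized_gen c S (int k) i j)"
  using assms by (auto simp: stokes_coeff_def realized_gen_0 upper_unitriangular_def)

text \<open>
  The trace of a product of two reflections \<open>1 - R\<^sub>i\<close> and \<open>1 - R'\<^sub>j\<close>, where \<open>R\<^sub>i\<close> and \<open>R'\<^sub>j\<close> have rank one and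
  trace 2.
\<close>
lemma inv_trace_clashed:
  assumes S: "upper_unitriangular S" and ij: "i < c" "j < c"
  shows "inv_trace c k i j (clashed_tuple c (S :: 'n::{finite,linorder} cmat)) =
     of_nat CARD('n) - 4 + realized_gen c S k i j ^ 2"
proof -
  let ?M = "mat_powi (M_h c S)"
  let ?Ri = "outer (axis i 1) (gram S $ i)"
  let ?Rj = "outer (?M k *v axis j 1) (gram S $ j v* ?M (- k))"
  have one: "?M k ** ?M (- k) = mat 1" "?M (- k) ** ?M k = mat 1"
    using mat_powi_uminus[OF M_h_invertible[OF S], of c k] by simp_all
  have "inv_trace c k i j (clashed_tuple c S) = trace ((mat 1 - ?Ri) ** (mat 1 - ?Rj))"
    using ij less_imp_neq[OF ij(1)] less_imp_neq[OF ij(2)]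
    by (simp add: inv_trace_def clashed_tuple_def refl_mat_outer matrix_mult_distribs one
        mult_outer outer_mult matrix_mul_assoc matrix_vector_mul_assoc vector_matrix_mul_assoc)
  also have "\<dots> = of_nat CARD('n) - trace ?Ri - trace ?Rj + trace (?Ri ** ?Rj)"
    by (simp add: matrix_mult_distribs trace_sub trace_I)
  also have "trace ?Ri = 2"
    using S by (simp add: trace_outer dotp_axis gram_nth upper_unitriangular_def)
  also have "trace ?Rj = 2"
    using S by (simp add: trace_outer dotp_matrix[symmetric] vector_matrix_mul_assoc one dotp_axis gram_nth upper_unitriangular_def)
  also have "trace (?Ri ** ?Rj) = realized_gen c S k i j * realized_gen c S (- k) j i"
    unfolding trace_outer_outer dotp_gram dotp_matrix[symmetric] ..
  finally show ?thesis
    by (simp add: realized_gen_swap[OF S] power2_eq_square)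
qed

lemma ks_bracket_monodromy_nat:
  assumes S: "upper_unitriangular S" and t: "t \<in> monodromy_class c S"
    and ind: "i < c" "j < c" "p < c" "l < c"
    and k0: "k = 0 \<Longrightarrow> i < j" and m0: "m = 0 \<Longrightarrow> p < l"
  shows "ks_bracket c (inv_trace c (int k) i j) (inv_trace c (int m) p l) t
     = realized_gen c S (int k) i j * realized_gen c S (int m) p l * level_bracket (stokes_coeff c S) i j k p l m"
proof -
  obtain P where P: "invertible P" and tP: "\<And>k. k \<le> c \<Longrightarrow> t k = matrix_inv P ** clashed_tuple c S k ** P"
    using t by (auto simp: monodromy_class_def)
  define e where "e a = matrix_inv P *v axis a 1" for a :: 'a
  define g where "g a = gram S $ a v* P" for a :: 'a
  have tc: "t c = matrix_inv P ** M_h c S ** P"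
    using tP[of c] by (simp add: clashed_tuple_def)
  note M = M_h_invertible[OF S, of c]
  have inv: "invertible (t c)" unfolding tc by (rule mat_powi_conj[OF M P])
  have refl: "t a = mat 1 - outer (e a) (g a)" if "a < c" for a
    using tP[of a] that P
    by (simp add: clashed_tuple_def refl_mat_outer matrix_mult_distribs mult_outer outer_mult matrix_inv_left e_def g_def)
  have gm: "gm c t e g a b s = realized_gen c S s a b" for a b s
  proof -
    have "gm c t e g a b s = dotp (gram S $ a v* (P ** (matrix_inv P ** mat_powi (M_h c S) s ** P) ** matrix_inv P)) (axis b 1)"
      by (simp add: gm_def[where c = c and t = t and e = e and g = g, OF inv refl] tc mat_powi_conj[OF M P] e_def g_def dotp_matrix[symmetric] vector_matrix_mul_assoc matrix_mul_assoc)
    also have "P ** (matrix_inv P ** mat_powi (M_h c S) s ** P) ** matrix_inv P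
        = (P ** matrix_inv P) ** mat_powi (M_h c S) s ** (P ** matrix_inv P)"
      by (simp add: matrix_mul_assoc)
    finally show ?thesis by (simp add: matrix_inv_right[OF P] dotp_gram)
  qed
  show ?thesis
    using ks_bracket_reflections[of t c e g i j p l k m] inv refl ind k0 m0
    unfolding gm stokes_coeff_eq[OF S, abs_def]
    by (simp add: realized_gen_swap[OF S] realized_gen_unit[OF S])
qed

text \<open>The trace of \<open>M\<^sub>i\<^sup>2\<close> is a Casimir function: its gradient commutes with \<open>M\<^sub>i\<close>.\<close>
lemma ks_pair_commuting: "ks_pair t a (t a) b B = 0" "ks_pair t b B a (t a) = 0"
proof -
  have *: "ks_pair t a (t a) b B = 0 \<and> ks_pair t b B a (t a) = 0" if "a \<noteq> b"
  proof (cases "a < b")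
    case True
    then show ?thesis
      using ks_pair_less[OF True, of t "t a" B] ks_pair_swap[of a b t B "t a"]
      by (simp add: matrix_mult_distribs trace_def)
  next
    case False
    then have "b < a" using that by simp
    then show ?thesis
      using ks_pair_less[OF \<open>b < a\<close>, of t B "t a"] ks_pair_swap[of b a t "t a" B]
      by (simp add: matrix_mult_distribs trace_def)
  qed
  have "trace (t a ** t a ** (B ** t a)) = trace (t a ** t a ** (t a ** B))"
    using trace_mul_sym[of "t a ** t a ** B" "t a"] by (simp add: matrix_mul_assoc)
  moreover have "trace (t a ** B ** (t a ** t a)) = trace (B ** t a ** (t a ** t a))"
    using trace_mul_sym[of "t a" "B ** t a ** t a"] by (simp add: matrix_mul_assoc)
  ultimately show "ks_pair t a (t a) b B = 0" "ks_pair t b B a (t a) = 0"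
    using * by (cases "a = b"; simp add: ks_pair_same)+
qed

lemma entry_deriv_trace_square:
  "entry_deriv a u v (inv_trace c 0 i i) t = (if a = i then t i + t i else 0) $ v $ u"
proof -
  let ?t = "\<lambda>z. t(a := t a + mat z ** elem_mat u v)"
  let ?E = "if a = i then elem_mat u v else 0"
  have t0: "?t 0 = t" by (auto simp: vec_eq_iff mat_mult_nth)
  have factor: "has_mat_derivative (\<lambda>z. ?t z i) ?E 0"
    by (cases "a = i") (auto intro: has_mat_derivative_line has_mat_derivative_const)
  have "has_mat_derivative (\<lambda>z. ?t z i ** ?t z i) (?E ** t i + t i ** ?E) 0"
    using has_mat_derivative_mult[OF factor factor] unfolding t0 .
  then have "entry_deriv a u v (inv_trace c 0 i i) t = trace (?E ** t i + t i ** ?E)"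
    unfolding entry_deriv_def inv_trace_def using DERIV_imp_deriv[OF trace_derivative] by fastforce
  also have "\<dots> = (if a = i then t i + t i else 0) $ v $ u"
    by (simp add: trace_add trace_mul_sym[of "t i"] trace_elem_mat matrix_mult_distribs trace_0[unfolded mat_0])
  finally show ?thesis .
qed

lemma ks_bracket_trace_square:
  "ks_bracket c (inv_trace c 0 i i) H t = 0" "ks_bracket c H (inv_trace c 0 i i) t = 0"
proof -
  let ?H = "\<lambda>a. \<chi> j i. entry_deriv a i j H t"
  have zero: "ks_pair t a (if a = i then t i + t i else 0) b B = 0"
    "ks_pair t b B a (if a = i then t i + t i else 0) = 0" for a b B
    by (cases "a = i"; simp only: simp_thms if_True if_False ks_pair_add ks_pair_commuting ks_pair_zero add_0_left)+
  show "ks_bracket c (inv_trace c 0 i i) H t = 0"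
    using ks_bracket_gradient[of c "inv_trace c 0 i i" t "\<lambda>a. if a = i then t i + t i else 0" H ?H]
    by (simp add: entry_deriv_trace_square zero)
  show "ks_bracket c H (inv_trace c 0 i i) t = 0"
    using ks_bracket_gradient[of c H t ?H "inv_trace c 0 i i" "\<lambda>a. if a = i then t i + t i else 0"]
    by (simp add: entry_deriv_trace_square zero)
qed

text \<open>
  Every invariant trace is one of those with \<open>k \<ge> 0\<close>, and \<open>i \<le> j\<close> if \<open>k = 0\<close>. The same change of
  indices is possible for the generators.
\<close>
lemma normal_index:
  fixes i j :: "'n::{finite,linorder}"
  assumes "i < c" "j < c"
  obtains q a b where "a < c" "b < c" "q = 0 \<longrightarrow> a \<le> b" "inv_trace c k i j = inv_trace c (int q) a b"
    "\<forall>S. upper_unitriangular S \<longrightarrow> realized_gen c S k i j = realized_gen c S (int q) a b"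
proof -
  define keep where "keep \<longleftrightarrow> k > 0 \<or> k = 0 \<and> i \<le> j"
  show thesis
  proof (cases keep)
    case True
    then show thesis using that[of i j "nat k"] assms by (auto simp: keep_def)
  next
    case False
    then have "int (nat (- k)) = - k" "nat (- k) = 0 \<Longrightarrow> j \<le> i" by (auto simp: keep_def)
    then show thesis
      using that[of j i "nat (- k)"] assms inv_trace_swap[of c k j i] realized_gen_swap[of _ c k j i]
      by (auto simp: fun_eq_iff)
  qed
qed

text \<open>
  The excluded indices \<open>k = 0\<close>, \<open>i = j\<close> of the general formula belong to \<open>Tr (M\<^sub>i\<^sup>2)\<close>, which is
  a Casimir function, and to the constant generator \<open>G(0) i i = 2\<close>.
\<close>
lemma ks_bracket_monodromy:
  assumes S: "upper_unitriangular S" and t: "t \<in> monodromy_class c S"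
    and ind: "i < c" "j < c" "p < c" "l < c"
  shows "ks_bracket c (inv_trace c k i j) (inv_trace c k' p l) t
     = realized_gen c S k i j * realized_gen c S k' p l *
       stokes_bracket (\<lambda>S. realized_gen c S k i j) (\<lambda>S. realized_gen c S k' p l) S"
proof -
  obtain q a b where x: "a < c" "b < c" "q = 0 \<longrightarrow> a \<le> b" "inv_trace c k i j = inv_trace c (int q) a b"
    "\<forall>S. upper_unitriangular S \<longrightarrow> realized_gen c S k i j = realized_gen c S (int q) a b"
    by (rule normal_index[where k = k, OF ind(1,2)])
  obtain q' a' b' where y: "a' < c" "b' < c" "q' = 0 \<longrightarrow> a' \<le> b'" "inv_trace c k' p l = inv_trace c (int q') a' b'"
    "\<forall>S. upper_unitriangular S \<longrightarrow> realized_gen c S k' p l = realized_gen c S (int q') a' b'"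
    by (rule normal_index[where k = k', OF ind(3,4)])
  have bracket: "stokes_bracket (\<lambda>S. realized_gen c S k i j) (\<lambda>S. realized_gen c S k' p l) S
      = stokes_bracket (\<lambda>S. realized_gen c S (int q) a b) (\<lambda>S. realized_gen c S (int q') a' b') S"
    by (rule stokes_bracket_cong[OF S]) (simp_all add: x y)
  consider "q = 0 \<and> a = b" | "q' = 0 \<and> a' = b'" | "(q = 0 \<longrightarrow> a < b) \<and> (q' = 0 \<longrightarrow> a' < b')"
    using x(3) y(3) by (auto simp: less_le)
  then show ?thesis
  proof cases
    case 1
    have "stokes_bracket (\<lambda>S. realized_gen c S 0 b b) H S = stokes_bracket (\<lambda>S. 2) H S" for H
      by (rule stokes_bracket_cong[OF S]) (simp_all add: realized_gen_unit)
    then show ?thesis using 1 unfolding bracket x(4) by (simp add: ks_bracket_trace_square)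
  next
    case 2
    have "stokes_bracket H (\<lambda>S. realized_gen c S 0 b' b') S = stokes_bracket H (\<lambda>S. 2) S" for H
      by (rule stokes_bracket_cong[OF S]) (simp_all add: realized_gen_unit)
    then show ?thesis using 2 unfolding bracket y(4) by (simp add: ks_bracket_trace_square)
  next
    case 3
    have "stokes_bracket (\<lambda>S. realized_gen c S (int q) a b) (\<lambda>S. realized_gen c S (int q') a' b') S
      = stokes_bracket (\<lambda>S. stokes_coeff c S a b q) (\<lambda>S. stokes_coeff c S a' b' q') S"
      by (rule stokes_bracket_cong[OF S]) (use 3 in \<open>simp_all add: realized_gen_stokes_coeff\<close>)
    then show ?thesis
      using ks_bracket_monodromy_nat[OF S t x(1,2) y(1,2), of q q'] 3 x y S
        stokes_bracket_generators[OF S x(1,2) y(1,2)]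
      unfolding bracket x(4) y(4) x(5)[rule_format, OF S] y(5)[rule_format, OF S] by simp
  qed
qed

section \<open>The realization of the abstract algebra\<close>

lemma poly_eval_D_gen:
  assumes "upper_unitriangular S"
  shows "poly_eval (gen_value c S) (D_gen k i j) = realized_gen c S k i j"
  using realized_gen_swap[OF assms, of c k j i] realized_gen_swap[OF assms, of c 0 j i] realized_gen_unit[OF assms]
  by (auto simp: D_gen_def D_var_def gen_var_def[symmetric] poly_eval_var gen_value_def simp del: One_nat_def)

lemma poly_eval_D_coeff:
  assumes "upper_unitriangular S"
  shows "poly_eval (gen_value c S) (D_coeff i j k) = stokes_coeff c S i j k"
  unfolding D_coeff_def stokes_coeff_eq[OF assms] by (simp add: poly_eval_D_gen[OF assms])

lemma poly_eval_eps: "poly_eval f (eps i j) = ord_sign i j"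
  by (auto simp: eps_def ord_sign_def poly_eval_uminus)

lemma poly_eval_D_bracket_coeff:
  assumes "upper_unitriangular S"
  shows "poly_eval (gen_value c S) (D_bracket_coeff j i k p l m) = level_bracket (stokes_coeff c S) j i k p l m"
  unfolding D_bracket_coeff_def level_bracket_def Let_def
  by (simp add: poly_eval_simps poly_eval_D_coeff[OF assms] poly_eval_eps)

lemma gen_value_bracket:
  assumes S: "upper_unitriangular S" and "(k, j, i) \<in> D_vars {..<c}" "(m, p, l) \<in> D_vars {..<c}"
  shows "stokes_bracket (\<lambda>S. gen_value c S (k, j, i)) (\<lambda>S. gen_value c S (m, p, l)) S
     = poly_eval (gen_value c S) (D_bracket_coeff j i k p l m)"
proof -
  have "stokes_bracket (\<lambda>S. gen_value c S (k, j, i)) (\<lambda>S. gen_value c S (m, p, l)) S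
     = stokes_bracket (\<lambda>S. stokes_coeff c S j i k) (\<lambda>S. stokes_coeff c S p l m) S"
    by (rule stokes_bracket_cong[OF S])
      (use assms in \<open>auto simp: D_vars_def gen_value_def intro!: realized_gen_stokes_coeff\<close>)
  then show ?thesis
    using assms by (simp add: D_vars_def stokes_bracket_generators poly_eval_D_bracket_coeff)
qed

lemma stokes_bracket_realization:
  assumes S: "upper_unitriangular S" and ab: "a \<in> D_alg {..<c}" "b \<in> D_alg {..<c}"
  shows "stokes_bracket (\<lambda>S. poly_eval (gen_value c S) a) (\<lambda>S. poly_eval (gen_value c S) b) S
     = poly_eval (gen_value c S) (D_bracket a b)"
proof -
  have "poly_eval (gen_value c S) (D_bracket a b) = (\<Sum>x\<in>poly_vars a. \<Sum>y\<in>poly_vars b.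
        poly_eval (gen_value c S) (poly_deriv x a) * poly_eval (gen_value c S) (poly_deriv y b) *
        stokes_bracket (\<lambda>S. gen_value c S x) (\<lambda>S. gen_value c S y) S)"
    unfolding D_bracket_def poly_eval_sum case_prod_unfold poly_eval_mult
    using ab by (intro sum.cong refl arg_cong2[where f = "(*)"])
      (auto simp: D_alg_def gen_value_bracket[OF S, symmetric] dest!: subsetD)
  then show ?thesis by (simp add: stokes_bracket_poly_eval)
qed

section \<open>Existence of the bracket\<close>

text \<open>
  The factor \<open>1 / 4\<close> compensates for the squares in \<open>Tr (M\<^sub>i M\<^sub>h\<^sup>k M\<^sub>j M\<^sub>h\<^sup>-\<^sup>k) = n - 4 + (G\<^sup>(\<^sup>k\<^sup>)\<^sub>i\<^sub>j)\<^sup>2\<close>.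
\<close>
definition monodromy_bracket ::
  "('n cmat \<Rightarrow> complex) \<Rightarrow> ('n cmat \<Rightarrow> complex) \<Rightarrow> ('n::{finite,linorder}) cmat \<Rightarrow> complex" where
  "monodromy_bracket F H = on_stokes (\<lambda>S. 1 / 4 * stokes_bracket F H S)"

lemma on_stokes_cong: "(\<And>S. S \<in> stokes_space \<Longrightarrow> F S = G S) \<Longrightarrow> on_stokes F = on_stokes G"
  by (auto simp: on_stokes_def)

lemma monodromy_bracket_on_stokes:
  "monodromy_bracket (on_stokes F) (on_stokes G) = on_stokes (\<lambda>S. 1 / 4 * stokes_bracket F G S)"
  unfolding monodromy_bracket_def by (rule on_stokes_cong) (simp add: stokes_bracket_on_stokes)

lemma stokes_space_unitriangular: "S \<in> stokes_space \<Longrightarrow> upper_unitriangular S"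
  by (simp add: stokes_space_iff)

lemma monodromy_algebra_pol:
  assumes "F \<in> monodromy_algebra c" obtains F' where "F' \<in> pol_fun" "F = on_stokes F'"
proof -
  obtain a where "F = realization c a" using assms by (auto simp: monodromy_algebra_def)
  then show thesis using that[OF pol_poly_eval] by (simp add: realization_eq)
qed

lemma realization_D_bracket:
  assumes "a \<in> D_alg {..<c}" "b \<in> D_alg {..<c}"
  shows "monodromy_bracket (realization c a) (realization c b) = (\<lambda>S. 1 / 4 * realization c (D_bracket a b) S)"
  unfolding realization_eq monodromy_bracket_on_stokes
  using assms by (auto simp: on_stokes_def stokes_bracket_realization stokes_space_unitriangular)

lemma realization_add: "realization c (a + b) = (\<lambda>S. realization c a S + realization c b S)"
  and realization_mult: "realization c (a * b) = (\<lambda>S. realization c a S * realization c b S)"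
  and realization_const: "realization c (Poly_Mapping.single 0 s) = on_stokes (\<lambda>S. s)"
  by (auto simp: realization_eq on_stokes_def poly_eval_simps)

lemma realization_in: "a \<in> D_alg {..<c} \<Longrightarrow> realization c a \<in> monodromy_algebra c"
  by (simp add: monodromy_algebra_def)

lemma poisson_monodromy_bracket: "poisson_bracket_on (monodromy_algebra c) monodromy_bracket"
proof -
  let ?R = "monodromy_algebra c"
  have closed: "monodromy_bracket F G \<in> ?R" if FG: "F \<in> ?R" "G \<in> ?R" for F G
  proof -
    obtain a b where ab: "a \<in> D_alg {..<c}" "b \<in> D_alg {..<c}" "F = realization c a" "G = realization c b"
      using FG unfolding monodromy_algebra_def by blast
    have "monodromy_bracket F G = realization c (Poly_Mapping.single 0 (1 / 4) * D_bracket a b)"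
      unfolding ab(3,4) realization_D_bracket[OF ab(1,2)] realization_mult realization_const
      by (auto simp: realization_def on_stokes_def)
    then show ?thesis
      using ab by (auto intro!: realization_in D_alg_mult D_alg_const D_bracket_in_D_alg)
  qed
  have skew: "monodromy_bracket F G = (\<lambda>S. - monodromy_bracket G F S)" for F G :: "'a cmat \<Rightarrow> complex"
    by (auto simp: monodromy_bracket_def on_stokes_def stokes_bracket_swap[of F])
  have linear: "monodromy_bracket (\<lambda>S. s * F S + G S) H = (\<lambda>S. s * monodromy_bracket F H S + monodromy_bracket G H S)"
    if FGH: "F \<in> ?R" "G \<in> ?R" "H \<in> ?R" for F G H s
  proof -
    obtain F' where F: "F' \<in> pol_fun" "F = on_stokes F'" by (rule monodromy_algebra_pol[OF FGH(1)])
    obtain G' where G: "G' \<in> pol_fun" "G = on_stokes G'" by (rule monodromy_algebra_pol[OF FGH(2)])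
    obtain H' where H: "H = on_stokes H'" by (rule monodromy_algebra_pol[OF FGH(3)])
    have "(\<lambda>S. s * F S + G S) = on_stokes (\<lambda>S. s * F' S + G' S)"
      by (auto simp: F G on_stokes_def)
    then show ?thesis
      using F(1) G(1) unfolding F(2) G(2) H
      by (simp add: monodromy_bracket_on_stokes)
        (auto simp: on_stokes_def stokes_bracket_add stokes_bracket_mult pol_intros algebra_simps)
  qed
  have leibniz: "monodromy_bracket (\<lambda>S. F S * G S) H = (\<lambda>S. F S * monodromy_bracket G H S + G S * monodromy_bracket F H S)"
    if FGH: "F \<in> ?R" "G \<in> ?R" "H \<in> ?R" for F G H
  proof -
    obtain F' where F: "F' \<in> pol_fun" "F = on_stokes F'" by (rule monodromy_algebra_pol[OF FGH(1)])
    obtain G' where G: "G' \<in> pol_fun" "G = on_stokes G'" by (rule monodromy_algebra_pol[OF FGH(2)])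
    obtain H' where H: "H = on_stokes H'" by (rule monodromy_algebra_pol[OF FGH(3)])
    have "(\<lambda>S. F S * G S) = on_stokes (\<lambda>S. F' S * G' S)"
      by (auto simp: F G on_stokes_def)
    then show ?thesis
      using F(1) G(1) unfolding F(2) G(2) H
      by (simp add: monodromy_bracket_on_stokes)
        (auto simp: on_stokes_def stokes_bracket_mult algebra_simps)
  qed
  have jacobi: "monodromy_bracket F (monodromy_bracket G H) S + monodromy_bracket G (monodromy_bracket H F) S
      + monodromy_bracket H (monodromy_bracket F G) S = 0" if FGH: "F \<in> ?R" "G \<in> ?R" "H \<in> ?R" for F G H S
  proof -
    obtain F' where F: "F' \<in> pol_fun" "F = on_stokes F'" by (rule monodromy_algebra_pol[OF FGH(1)])
    obtain G' where G: "G' \<in> pol_fun" "G = on_stokes G'" by (rule monodromy_algebra_pol[OF FGH(2)])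
    obtain H' where H: "H' \<in> pol_fun" "H = on_stokes H'" by (rule monodromy_algebra_pol[OF FGH(3)])
    have twice: "monodromy_bracket (on_stokes A) (monodromy_bracket (on_stokes B) (on_stokes C)) S
        = on_stokes (\<lambda>S. 1 / 16 * stokes_bracket A (stokes_bracket B C) S) S"
      if "B \<in> pol_fun" "C \<in> pol_fun" for A B C
      unfolding monodromy_bracket_on_stokes
      using stokes_bracket_mult_right[OF pol_const pol_stokes_bracket[OF that], of A "1 / 4"]
      by (simp add: on_stokes_def mult.commute)
    show ?thesis
      using jacobiator_zero[OF stokes_space_unitriangular F(1) G(1) H(1)]
      unfolding F(2) G(2) H(2) twice[OF G(1) H(1)] twice[OF H(1) F(1)] twice[OF F(1) G(1)]
      by (simp add: on_stokes_def jacobiator_def add_divide_distrib[symmetric])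
  qed
  show ?thesis
    unfolding poisson_bracket_on_def
    by (intro conjI ballI allI; rule closed skew linear leibniz jacobi; assumption)
qed

lemma induced_monodromy_bracket: "induced_by_ks (c :: 'n::{finite,linorder}) monodromy_bracket"
  unfolding induced_by_ks_def
proof (intro ballI allI impI)
  fix S :: "'n cmat" and m k k' i j p l
  assume S: "S \<in> stokes_space" and m: "m \<in> monodromy_class c S" and "i < c \<and> j < c \<and> p < c \<and> l < c"
  then have ind: "i < c" "j < c" "p < c" "l < c" by auto
  obtain q a b where x: "a < c" "b < c" "inv_trace c k i j = inv_trace c (int q) a b"
    by (rule normal_index[where k = k, OF ind(1,2)]) (rule that)
  obtain q' a' b' where y: "a' < c" "b' < c" "inv_trace c k' p l = inv_trace c (int q') a' b'"
    by (rule normal_index[where k = k', OF ind(3,4)]) (rule that)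
  let ?R = "\<lambda>S. realized_gen c S (int q) a b" and ?R' = "\<lambda>S. realized_gen c S (int q') a' b'"
  note SU = stokes_space_unitriangular[OF S]
  have square: "stokes_bracket (\<lambda>S. of_nat CARD('n) - 4 + F S ^ 2) H S = 2 * F S * stokes_bracket F H S"
    if "F \<in> pol_fun" for F H
    using that by (simp add: power2_eq_square stokes_bracket_add stokes_bracket_mult pol_intros)
  have square_right: "stokes_bracket H (\<lambda>S. of_nat CARD('n) - 4 + F S ^ 2) S = 2 * F S * stokes_bracket H F S"
    if "F \<in> pol_fun" for F H
    using square[OF that, of H] by (simp add: stokes_bracket_swap[of H])
  have "stokes_bracket (\<lambda>S. inv_trace c (int q) a b (clashed_tuple c S)) (\<lambda>S. inv_trace c (int q') a' b' (clashed_tuple c S)) S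
      = stokes_bracket (\<lambda>S. of_nat CARD('n) - 4 + ?R S ^ 2) (\<lambda>S. of_nat CARD('n) - 4 + ?R' S ^ 2) S"
    by (rule stokes_bracket_cong[OF SU]) (simp_all add: inv_trace_clashed x y)
  also have "\<dots> = 4 * (?R S * ?R' S * stokes_bracket ?R ?R' S)"
    by (simp add: square square_right pol_realized_gen)
  finally show "monodromy_bracket (on_stokes (\<lambda>S. inv_trace c k i j (clashed_tuple c S)))
      (on_stokes (\<lambda>S. inv_trace c k' p l (clashed_tuple c S))) S
    = ks_bracket c (inv_trace c k i j) (inv_trace c k' p l) m"
    unfolding monodromy_bracket_on_stokes x(3) y(3)
    using S ks_bracket_monodromy[OF SU m x(1,2) y(1,2), of "int q" "int q'"]
    by (simp add: on_stokes_def)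
qed

section \<open>Uniqueness of the bracket\<close>

text \<open>
  Along the line from \<open>S\<close> to \<open>S1\<close> all matrices are unitriangular, and the three polynomials in one
  variable given by \<open>F\<close>, \<open>H\<close> and the determinant of \<open>gram\<close> have product zero. The first one is nonzero at \<open>S1\<close>
  and the last one at \<open>S\<close>, so that the one given by \<open>H\<close> is zero.
\<close>
lemma pol_fun_cancel:
  assumes F: "F \<in> pol_fun" and H: "H \<in> pol_fun"
    and zero: "\<And>S. S \<in> stokes_space \<Longrightarrow> F S * H S = 0"
    and S1: "upper_unitriangular S1" "F S1 \<noteq> 0" and S: "S \<in> stokes_space"
  shows "H S = 0"
proof -
  let ?L = "\<lambda>t. S + mat t ** (S1 - S)"
  obtain f where f: "\<And>t. F (?L t) = poly f t" using pol_fun_on_line[OF F] by blast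
  obtain h where h: "\<And>t. H (?L t) = poly h t" using pol_fun_on_line[OF H] by blast
  obtain q where q: "\<And>t. det (gram (?L t)) = poly q t" using pol_fun_on_line[OF pol_det_gram] by blast
  have "upper_unitriangular (?L t)" for t
    using stokes_space_unitriangular[OF S] S1 by (auto simp: upper_unitriangular_def mat_mult_nth)
  then have "poly (q * f * h) t = 0" for t
    using zero[of "?L t"] by (auto simp: stokes_space_iff q f h)
  then have "q * f * h = 0" by (intro iffD1[OF poly_all_0_iff_0] allI)
  moreover have "f \<noteq> 0" using f[of 1] S1(2) by auto
  moreover have "q \<noteq> 0" using q[of 0] S by (auto simp: stokes_space_iff)
  ultimately have "h = 0" by simp
  then show ?thesis using h[of 0] by simp
qed

text \<open>
  A single matrix makes all generators nonzero, at all levels \<open>k\<close>: if the poles below \<open>c\<close> are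
  decoupled from the clashed ones, then the value of \<open>G(k) i j\<close> does not depend on \<open>k\<close>.
\<close>
lemma decoupled_stokes_matrix:
  "\<exists>S. upper_unitriangular S \<and> (\<forall>x\<in>D_vars {..<c}. gen_value c S x \<noteq> 0)"
  for c :: "'n::{finite,linorder}"
proof -
  \<comment> \<open>All entries above the diagonal are 1 among the poles below \<open>c\<close>, and 0 otherwise.\<close>
  define S where "S = ((\<chi> i j. if i = j \<or> i < j \<and> j < c then 1 else 0) :: 'n cmat)"
  have "gram S $ k $ j = 0" if "c \<le> k" "j < c" for k j
    using that by (auto simp: gram_nth S_def)
  then have "realized_gen c S (int k) i j = gram S $ i $ j" if "j < c" for k i j
    using that by (intro realized_gen_decoupled)
  moreover have "gram S $ i $ j \<noteq> 0" if "i < c" "j < c" for i j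
    using that by (auto simp: gram_nth S_def)
  ultimately have "gen_value c S x \<noteq> 0" if "x \<in> D_vars {..<c}" for x
    using that by (auto simp: D_vars_def gen_value_def)
  moreover have "upper_unitriangular S" by (auto simp: upper_unitriangular_def S_def)
  ultimately show ?thesis by blast
qed

text \<open>
  The values on the traces \<open>n - 4 + (G\<^sup>(\<^sup>k\<^sup>)\<^sub>i\<^sub>j)\<^sup>2\<close> determine \<open>\<beta>\<close> on the generators by the Leibniz rule and
  cancellation. Here the closedness of \<open>monodromy_algebra c\<close> under \<open>\<beta>\<close> is essential: it makes
  the brackets of generators polynomial functions, for which cancellation is possible.
\<close>
lemma induced_bracket_unique:
  fixes c :: "'n::{finite,linorder}"
  assumes "poisson_bracket_on (monodromy_algebra c) \<beta>" and induced: "induced_by_ks c \<beta>"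
    and ab: "a \<in> D_alg {..<c}" "b \<in> D_alg {..<c}"
  shows "\<beta> (realization c a) (realization c b) = (\<lambda>S. 1 / 4 * realization c (D_bracket a b) S)"
proof -
  let ?R = "monodromy_algebra c" and ?r = "realization c" and ?A = "D_alg {..<c}"
  let ?E = "\<lambda>S. poly_eval (gen_value c S)"
  note P = assms(1)[unfolded poisson_bracket_on_def]
  have closed: "\<beta> F G \<in> ?R" and skew: "\<beta> F G S = - \<beta> G F S" if "F \<in> ?R" "G \<in> ?R" for F G S
    using bspec[OF bspec[OF conjunct1[OF P] that(1)] that(2)] fun_cong[of "\<beta> F G" "\<lambda>x. - \<beta> G F x" S] by blast+
  have linear: "\<beta> (\<lambda>x. s * F x + G x) H S = s * \<beta> F H S + \<beta> G H S"
    and leibniz: "\<beta> (\<lambda>x. F x * G x) H S = F S * \<beta> G H S + G S * \<beta> F H S"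
    if "F \<in> ?R" "G \<in> ?R" "H \<in> ?R" for F G H s S
  proof -
    have "\<beta> (\<lambda>x. s * F x + G x) H = (\<lambda>x. s * \<beta> F H x + \<beta> G H x)" using P that by blast
    then show "\<beta> (\<lambda>x. s * F x + G x) H S = s * \<beta> F H S + \<beta> G H S" by (rule fun_cong)
    have "\<beta> (\<lambda>x. F x * G x) H = (\<lambda>x. F x * \<beta> G H x + G x * \<beta> F H x)" using P that by blast
    then show "\<beta> (\<lambda>x. F x * G x) H S = F S * \<beta> G H S + G S * \<beta> F H S" by (rule fun_cong)
  qed
  \<comment> \<open>The elements of the algebra vanish outside of \<open>stokes_space\<close> by convention.\<close>
  have outside: "\<beta> F G S = 0" if "F \<in> ?R" "G \<in> ?R" "S \<notin> stokes_space" for F G S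
    using closed[OF that(1,2)] that(3) by (auto simp: monodromy_algebra_def realization_eq on_stokes_def)
  have value_r: "?r p S = ?E S p" if "S \<in> stokes_space" for p S
    using that by (simp add: realization_eq on_stokes_def)
  have add: "\<beta> (?r (p + q)) H S = \<beta> (?r p) H S + \<beta> (?r q) H S" if "p \<in> ?A" "q \<in> ?A" "H \<in> ?R" for p q H S
    using linear[of "?r p" "?r q" H 1 S] that by (simp add: realization_in realization_add)
  have mult: "\<beta> (?r (p * q)) H S = ?E S p * \<beta> (?r q) H S + ?E S q * \<beta> (?r p) H S"
    if "p \<in> ?A" "q \<in> ?A" "H \<in> ?R" "S \<in> stokes_space" for p q H S
    using leibniz[of "?r p" "?r q" H S] that by (simp add: realization_in realization_mult value_r)
  have const: "\<beta> (?r (Poly_Mapping.single 0 s)) H S = 0" if H: "H \<in> ?R" and S: "S \<in> stokes_space" for s H S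
  proof -
    have "\<beta> (?r 1) H S = 0"
      using mult[OF D_alg_one D_alg_one H S] by simp
    moreover have "\<beta> (?r 0) H S = 0"
      using add[OF D_alg_zero D_alg_zero H, of S] by simp
    moreover have "?r (Poly_Mapping.single 0 s) = (\<lambda>x. s * ?r 1 x + ?r 0 x)"
      by (auto simp: realization_eq on_stokes_def poly_eval_const)
    ultimately show ?thesis
      using linear[OF realization_in[OF D_alg_one] realization_in[OF D_alg_zero] H, of s S] by simp
  qed
  have generators: "\<beta> (?r (gen_var x)) (?r (gen_var y)) S
      = 1 / 4 * stokes_bracket (\<lambda>S. gen_value c S x) (\<lambda>S. gen_value c S y) S"
    if x: "x \<in> D_vars {..<c}" and y: "y \<in> D_vars {..<c}" and S: "S \<in> stokes_space" for x y S
  proof -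
    let ?x = "gen_var x" and ?y = "gen_var y" and ?n = "Poly_Mapping.single 0 (of_nat CARD('n) - 4) :: 'n dalg"
    let ?gx = "\<lambda>S. gen_value c S x" and ?gy = "\<lambda>S. gen_value c S y"
    have A: "?x \<in> ?A" "?y \<in> ?A" "?n \<in> ?A" using x y by (auto intro: D_alg_var D_alg_const)
    obtain k i j m p l where kij: "x = (k, i, j)" "y = (m, p, l)" by (metis prod_cases3)
    have ind: "i < c" "j < c" "p < c" "l < c" using x y by (auto simp: kij D_vars_def)
    have trace_r: "on_stokes (\<lambda>S. inv_trace c (int k) i j (clashed_tuple c S)) = ?r (?n + gen_var (k, i, j) * gen_var (k, i, j))"
      if "i < c" "j < c" for k i j
      unfolding realization_eq using that
      by (intro on_stokes_cong)
        (simp add: inv_trace_clashed stokes_space_unitriangular poly_eval_simps gen_value_def power2_eq_square)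
    have square: "\<beta> (?r (?n + z * z)) H S = 2 * ?E S z * \<beta> (?r z) H S"
      if "z \<in> ?A" "H \<in> ?R" "S \<in> stokes_space" for z H S
      using that A by (simp add: add mult const D_alg_mult)
    have "?gx S * ?gy S * (4 * \<beta> (?r ?x) (?r ?y) S - stokes_bracket ?gx ?gy S) = 0" if S: "S \<in> stokes_space" for S
    proof -
      \<comment> \<open>It is enough to evaluate the Korotkin--Samtleben bracket at one tuple of the class.\<close>
      have "clashed_tuple c S \<in> monodromy_class c S"
        unfolding monodromy_class_def
        by (auto intro!: exI[of _ "mat 1"] simp: matrix_inv_eqI[of "mat 1" "mat 1"] invertible_def)
      then have "?gx S * ?gy S * stokes_bracket ?gx ?gy S = \<beta> (?r (?n + ?x * ?x)) (?r (?n + ?y * ?y)) S"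
        using induced S ind ks_bracket_monodromy[OF stokes_space_unitriangular[OF S] _ ind, of "clashed_tuple c S" "int k" "int m"]
        unfolding induced_by_ks_def kij trace_r[OF ind(1,2), symmetric] trace_r[OF ind(3,4), symmetric]
        by (simp add: gen_value_def)
      also have "\<dots> = 2 * ?gx S * (- \<beta> (?r (?n + ?y * ?y)) (?r ?x) S)"
        using S A skew[of "?r ?x" "?r (?n + ?y * ?y)" S]
        by (simp add: square realization_in D_alg_intros poly_eval_var)
      also have "\<dots> = 4 * (?gx S * ?gy S * \<beta> (?r ?x) (?r ?y) S)"
        using S A skew[of "?r ?x" "?r ?y" S] by (simp add: square realization_in D_alg_intros poly_eval_var)
      finally show ?thesis by (auto simp: algebra_simps)
    qed
    moreover obtain d where d: "\<beta> (?r ?x) (?r ?y) = ?r d"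
      using closed A by (metis imageE monodromy_algebra_def realization_in)
    moreover obtain S1 where "upper_unitriangular S1" "?gx S1 \<noteq> 0" "?gy S1 \<noteq> 0"
      using decoupled_stokes_matrix x y by metis
    moreover have pol: "?gx \<in> pol_fun" "?gy \<in> pol_fun"
      using pol_poly_eval[of c ?x] pol_poly_eval[of c ?y] by (simp_all add: poly_eval_var)
    ultimately have "4 * ?E S d - stokes_bracket ?gx ?gy S = 0"
      using S by (intro pol_fun_cancel[where F = "\<lambda>S. ?gx S * ?gy S" and H = "\<lambda>S. 4 * ?E S d - stokes_bracket ?gx ?gy S" and ?S1.0 = S1])
        (auto intro!: pol_intros pol_poly_eval pol_stokes_bracket simp: value_r)
    then show ?thesis using S by (simp add: d value_r mult.commute)
  qed
  have chain: "\<beta> (?r p) H S = (\<Sum>x\<in>poly_vars p. ?E S (poly_deriv x p) * \<beta> (?r (gen_var x)) H S)"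
    if "p \<in> ?A" "H \<in> ?R" "S \<in> stokes_space" for p H S
  proof (rule derivation_chain_rule[OF finite_poly_vars subset_refl])
    have A: "poly_vars q \<subseteq> poly_vars p \<Longrightarrow> q \<in> ?A" "x \<in> poly_vars p \<Longrightarrow> gen_var x \<in> ?A" for q x
      using that(1) by (auto simp: D_alg_def[of "{..<c}"] intro: D_alg_var[unfolded D_alg_def mem_Collect_eq, THEN subsetD])
    show "\<beta> (?r (q + q')) H S = \<beta> (?r q) H S + \<beta> (?r q') H S"
      if "poly_vars q \<subseteq> poly_vars p" "poly_vars q' \<subseteq> poly_vars p" for q q'
      using add A that \<open>H \<in> ?R\<close> by blast
    show "\<beta> (?r (q * gen_var x)) H S = ?E S q * \<beta> (?r (gen_var x)) H S + gen_value c S x * \<beta> (?r q) H S"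
      if "poly_vars q \<subseteq> poly_vars p" "x \<in> poly_vars p" for q x
      using mult[OF A(1)[OF that(1)] A(2)[OF that(2)] \<open>H \<in> ?R\<close> \<open>S \<in> stokes_space\<close>] by (simp add: poly_eval_var)
  qed (use that const in auto)
  show ?thesis
  proof
    fix S :: "'n cmat"
    show "\<beta> (?r a) (?r b) S = 1 / 4 * ?r (D_bracket a b) S"
    proof (cases "S \<in> stokes_space")
      case S: True
      have vars: "x \<in> D_vars {..<c}" if "x \<in> poly_vars a \<or> x \<in> poly_vars b" for x
        using that ab by (auto simp: D_alg_def)
      have "\<beta> (?r a) (?r b) S = (\<Sum>x\<in>poly_vars a. ?E S (poly_deriv x a) * \<beta> (?r (gen_var x)) (?r b) S)"
        using chain ab S by (simp add: realization_in)
      also have "\<dots> = (\<Sum>x\<in>poly_vars a. \<Sum>y\<in>poly_vars b. 1 / 4 * (?E S (poly_deriv x a) * ?E S (poly_deriv y b) *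
          stokes_bracket (\<lambda>S. gen_value c S x) (\<lambda>S. gen_value c S y) S))"
      proof (rule sum.cong[OF refl])
        fix x assume x: "x \<in> poly_vars a"
        have "\<beta> (?r (gen_var x)) (?r b) S = - \<beta> (?r b) (?r (gen_var x)) S"
          using ab x vars by (intro skew realization_in D_alg_var) auto
        also have "\<dots> = (\<Sum>y\<in>poly_vars b. ?E S (poly_deriv y b) * - \<beta> (?r (gen_var y)) (?r (gen_var x)) S)"
          using chain[OF ab(2) realization_in[OF D_alg_var] S, of x] x vars by (simp add: sum_negf)
        also have "\<dots> = (\<Sum>y\<in>poly_vars b. ?E S (poly_deriv y b) * (1 / 4 *
            stokes_bracket (\<lambda>S. gen_value c S x) (\<lambda>S. gen_value c S y) S))"
          by (intro sum.cong refl, subst generators)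
            (use x vars S in \<open>auto simp: stokes_bracket_swap[of "\<lambda>S. gen_value c S x"]\<close>)
        finally show "?E S (poly_deriv x a) * \<beta> (?r (gen_var x)) (?r b) S = (\<Sum>y\<in>poly_vars b. 1 / 4 *
            (?E S (poly_deriv x a) * ?E S (poly_deriv y b) * stokes_bracket (\<lambda>S. gen_value c S x) (\<lambda>S. gen_value c S y) S))"
          by (simp add: sum_distrib_left mult_ac)
      qed
      also have "\<dots> = 1 / 4 * ?E S (D_bracket a b)"
        unfolding stokes_bracket_realization[OF stokes_space_unitriangular[OF S] ab, symmetric] stokes_bracket_poly_eval
        by (simp only: sum_distrib_left)
      finally show ?thesis by (simp add: value_r S)
    next
      case False
      then show ?thesis using outside ab by (simp add: realization_in) (simp add: realization_eq on_stokes_def)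
    qed
  qed
qed

section \<open>The Poisson algebra of the monodromy data\<close>

theorem theorem8p3:
  fixes V :: "'n cvec \<Rightarrow> ('n::{finite,linorder}) cmat"
    and \<U> \<Omega> :: "'n cvec set"
    and \<mu> :: "'n \<Rightarrow> complex"
    and \<phi> \<sigma> :: real
    and J S C :: "'n cmat"
    and c :: 'n
    and v :: "'n cvec"
    and A0 B0 :: "'n \<Rightarrow> 'n cvec \<Rightarrow> 'n cmat"
  assumes "open \<U>" "\<U> \<noteq> {}"
    and "\<forall>u\<in>\<U>. \<forall>i j. i < j \<longrightarrow> Re (cis \<phi> * (u $ i - u $ j)) < 0"
    and skew: "\<forall>u\<in>\<U>. transpose (V u) = - V u"
    and isomonodromic: "\<forall>u\<in>\<U>. monodromy_data \<phi> u (V u) J S C"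
    and stokes: "upper_unitriangular S"
    and spectrum: "\<forall>u\<in>\<U>. \<forall>x. det (mat x - V u) = (\<Prod>k\<in>UNIV. x - \<mu> k)"
    and nonresonant: "\<forall>i j. \<mu> i - \<mu> j \<notin> \<int> - {0}"
    and strip: "\<forall>i. - 1 / 2 < Re (\<mu> i) \<and> Re (\<mu> i) < 1 / 2"
    and full_rank: "rank (S + transpose S) = CARD('n)"
    and \<Omega>_open: "openin (top_of_set {w. \<forall>k\<ge>c. w $ k = 0}) \<Omega>"
    and "\<forall>w\<in>\<Omega>. \<forall>i j. i < j \<and> j \<le> c \<longrightarrow> Re (cis \<phi> * (w $ i - w $ j)) < 0"
    and "\<forall>k<c. v $ k = 0"
    and \<sigma>: "\<forall>i\<ge>c. \<forall>j\<ge>c. \<bar>Re (\<mu> i - \<mu> j)\<bar> < \<sigma>" "\<sigma> < 1"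
    and clashing: "\<forall>w\<in>\<Omega>. clash_limit c V \<U> v \<sigma> A0 B0 w"
    and clashed_monodromy:
      "\<forall>w\<in>\<Omega>. has_monodromy \<phi> c w (clashed_residue c A0 B0 w) (clashed_tuple c S)"
  shows "S \<in> stokes_space \<and>
         (\<forall>w\<in>\<Omega>. \<forall>m. has_monodromy \<phi> c w (clashed_residue c A0 B0 w) m \<longrightarrow>
           m \<in> monodromy_class c S) \<and>
         (\<forall>S'\<in>stokes_space. \<forall>k i j. i < c \<and> j < c \<longrightarrow>
           realization c (D_gen k i j) S' = realized_gen c S' k i j) \<and>
         (\<exists>\<beta>. poisson_bracket_on (monodromy_algebra c) \<beta> \<and> induced_by_ks c \<beta>) \<and>
         (\<forall>\<beta>. poisson_bracket_on (monodromy_algebra c) \<beta> \<and> induced_by_ks c \<beta> \<longrightarrow>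
           (\<forall>a\<in>D_alg {..<c}. \<forall>b\<in>D_alg {..<c}.
              \<beta> (realization c a) (realization c b) =
              (\<lambda>S'. 1 / 4 * realization c (D_bracket a b) S')))"
proof (intro conjI ballI allI impI)
  show "S \<in> stokes_space"
    using stokes full_rank by (simp add: stokes_space_def)
next
  fix w m
  assume w: "w \<in> \<Omega>" and m: "has_monodromy \<phi> c w (clashed_residue c A0 B0 w) m"
  have "\<And>i j. i < j \<Longrightarrow> j \<le> c \<Longrightarrow> Re (cis \<phi> * (w $ i - w $ j)) < 0"
    using assms(12) w by blast
  then show "m \<in> monodromy_class c S"
    using has_monodromy_unique[OF _ m] clashed_monodromy w unfolding monodromy_class_def by blast
next
  fix S' :: "'n cmat" and k i j
  assume "S' \<in> stokes_space" "i < c \<and> j < c"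
  then show "realization c (D_gen k i j) S' = realized_gen c S' k i j"
    by (simp add: realization_eq on_stokes_def poly_eval_D_gen stokes_space_unitriangular)
next
  show "\<exists>\<beta>. poisson_bracket_on (monodromy_algebra c) \<beta> \<and> induced_by_ks c \<beta>"
    using poisson_monodromy_bracket induced_monodromy_bracket by blast
next
  fix \<beta> a b
  assume "poisson_bracket_on (monodromy_algebra c) \<beta> \<and> induced_by_ks c \<beta>"
    "a \<in> D_alg {..<c}" "b \<in> D_alg {..<c}"
  then show "\<beta> (realization c a) (realization c b) = (\<lambda>S'. 1 / 4 * realization c (D_bracket a b) S')"
    by (intro induced_bracket_unique) auto
qed

end
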